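(* Suppose player II has a winning strategy in $\Game_{\omega_1}^{\omega\alpha}(I_{\text{bdd}}^{\mathrm{cof}(\omega_1)})$, where $\alpha<\omega_1$. Let $S\subseteq E_{\omega}^{\omega_2}$ be stationary. Let $\Theta$ be a sufficiently large regular cardinal and let $\mathcal{A}$ be an algebra on $H(\Theta)$ extending $(H(\Theta),\in,S,\alpha,<_\Theta)$ where $<_{\Theta}$ is a well order on $H(\Theta)$. Whenever $(M_i)_{i<\alpha}$ is an $\alpha$-tower of countable elementary submodels of $\mathcal{A}$, there is an $\alpha$-tower $(M_i')_{i<\alpha}$ of countable elementary submodels of $\mathcal{A}$ such that for every $i<\alpha$, $M_i\subseteq M_i'$, $M_i\cap\omega_1=M_i'\cap\omega_1$ and $\sup(M_i\cap\omega_2)\in S$.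
   Context: $E^{\omega_2}_\omega=\{\eta<\omega_2:\mathrm{cf}(\eta)=\omega\}$. $I_{\text{bdd}}^{\mathrm{cof}(\omega_1)}$ is the ideal of all $A\subseteq\omega_2$ with $A\cap\{\eta<\omega_2:\mathrm{cf}(\eta)=\omega_1\}$ bounded in $\omega_2$. For an ideal $I$ on $\omega_2$ and a countable ordinal $\gamma$, the game $\Game_{\omega_1}^{\gamma}(I)$ lasts $\gamma$ rounds: in round $\beta$, player I plays a function $f_\beta:\omega_2\to\omega_1$ and player II responds with an ordinal $\xi_\beta<\omega_1$; II wins iff there is $X\in I^+$ such that $f_\beta(\eta)\le\xi_\beta$ for all $\eta\in X$ and $\beta<\gamma$. An $\alpha$-tower is a sequence $(M_i)_{i<\alpha}$ of countable elementary submodels with $M_\delta=\bigcup_{i<\delta}M_i$ for limit $\delta$ and $(M_i)_{i<j}\in M_j$ for successor $j$.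
   Formalization: The last clause is read as sup(M'_i ∩ ω_2) ∈ S for the new tower; as printed, about the given tower M_i, it fails for α = 1 when E_ω^{ω_2} \ S is stationary. "Sufficiently large" is made explicit as 2^{ω_2} < Θ. *)

theory Defs
  imports Main "HOL-Library.Countable_Set" "HOL-Library.FuncSet" "HOL-Library.Equipollence"
begin

section \<open>The set-theoretic universe\<close>

text \<open>
  HOL has no type of all sets, so the ambient universe is an arbitrary type carrying a membership
  relation; \<open>elts x\<close> is the collection of the members of \<open>x\<close>. Separation and Replacement are
  second order (they range over all HOL sets and functions), and Choice is that of HOL.
  The Power Set axiom is not required; instead of it and Infinity there is the weak consequence
  that \<open>\<aleph>\<^sub>2\<close> exists. Every universe of ZFC is an instance, but so is \<open>H(\<kappa>)\<close> for each
  regular \<open>\<kappa> > \<aleph>\<^sub>2\<close>. Hence, unlike for full ZFC, suitable instances do not go beyond what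
  HOL itself can construct.
\<close>

class set_universe =
  fixes elts :: "'a \<Rightarrow> 'a set"
  assumes extensionality: "elts x = elts y \<Longrightarrow> x = y"
    and foundation: "wf {(x, y). x \<in> elts y}"
    and pairing: "\<exists>z. elts z = {x, y}"
    and union: "\<exists>z. elts z = \<Union> (elts ` elts x)"
    and separation: "A \<subseteq> elts x \<Longrightarrow> \<exists>z. elts z = A"
    and replacement: "\<exists>z. elts z = f ` elts x"
    and two_uncountable_cardinals: "\<exists>x y. uncountable (elts x) \<and> elts x \<prec> elts y"

text \<open>\<open>set_of A\<close> is the element of the universe with members \<open>A\<close>; it is meaningful exactly for
  the collections \<open>A\<close> that are sets of the universe (see \<open>elts_set_of\<close> below).\<close>

definition set_of :: "'v::set_universe set \<Rightarrow> 'v" where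
  "set_of A = (THE x. elts x = A)"

text \<open>Kuratowski pairs, and sequences indexed by an ordinal as sets of pairs.\<close>

definition vpair :: "'v::set_universe \<Rightarrow> 'v \<Rightarrow> 'v" where
  "vpair x y = set_of {set_of {x}, set_of {x, y}}"

definition vseq :: "'v::set_universe \<Rightarrow> ('v \<Rightarrow> 'v) \<Rightarrow> 'v" where
  "vseq j M = set_of ((\<lambda>i. vpair i (M i)) ` elts j)"

section \<open>Ordinals and cardinals\<close>

definition transitive_set :: "'v::set_universe \<Rightarrow> bool" where
  "transitive_set x \<longleftrightarrow> (\<forall>y\<in>elts x. elts y \<subseteq> elts x)"

text \<open>Von Neumann ordinals: for ordinals, \<open>a < b\<close> is \<open>a \<in> elts b\<close> and \<open>a \<le> b\<close> is
  \<open>elts a \<subseteq> elts b\<close>.\<close>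

definition Ord :: "'v::set_universe \<Rightarrow> bool" where
  "Ord x \<longleftrightarrow> transitive_set x \<and> (\<forall>y\<in>elts x. transitive_set y)"

definition vsucc :: "'v::set_universe \<Rightarrow> 'v" where
  "vsucc x = set_of (insert x (elts x))"

definition successor_ordinal :: "'v::set_universe \<Rightarrow> bool" where
  "successor_ordinal j \<longleftrightarrow> (\<exists>i. Ord i \<and> j = vsucc i)"

definition limit_ordinal :: "'v::set_universe \<Rightarrow> bool" where
  "limit_ordinal d \<longleftrightarrow> Ord d \<and> elts d \<noteq> {} \<and> (\<forall>i\<in>elts d. vsucc i \<in> elts d)"

text \<open>Supremum of a collection of ordinals.\<close>

definition vsup :: "'v::set_universe set \<Rightarrow> 'v" where
  "vsup A = set_of (\<Union> (elts ` A))"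

text \<open>Ordinal arithmetic by recursion on the second argument:
  \<open>x + y = x \<union> {x + z | z < y}\<close> and \<open>x \<cdot> y = {x \<cdot> u + r | u < y, r < x}\<close>.\<close>

function vplus :: "'v::set_universe \<Rightarrow> 'v \<Rightarrow> 'v" where
  "vplus x y = set_of (elts x \<union> vplus x ` elts y)"
  by pat_completeness auto
termination
  by (relation "inv_image {(x, y). x \<in> elts y} snd") (auto simp: foundation)

declare vplus.simps [simp del]

function vtimes :: "'v::set_universe \<Rightarrow> 'v \<Rightarrow> 'v" where
  "vtimes x y = set_of (\<Union> ((\<lambda>u. vplus (vtimes x u) ` elts x) ` elts y))"
  by pat_completeness auto
termination
  by (relation "inv_image {(x, y). x \<in> elts y} snd") (auto simp: foundation)

declare vtimes.simps [simp del]

definition omega :: "'v::set_universe" where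
  "omega = set_of {a. Ord a \<and> finite (elts a)}"

definition omega1 :: "'v::set_universe" where
  "omega1 = set_of {a. Ord a \<and> countable (elts a)}"

definition omega2 :: "'v::set_universe" where
  "omega2 = set_of {a. Ord a \<and> elts a \<lesssim> elts (omega1 :: 'v)}"

text \<open>\<open>has_cofinal_map d k\<close>: some function from \<open>k\<close> to \<open>d\<close> has cofinal range.\<close>

definition has_cofinal_map :: "'v::set_universe \<Rightarrow> 'v \<Rightarrow> bool" where
  "has_cofinal_map d k \<longleftrightarrow>
     (\<exists>f. f \<in> elts k \<rightarrow> elts d \<and> (\<forall>x\<in>elts d. \<exists>y\<in>elts k. elts x \<subseteq> elts (f y)))"

definition cf :: "'v::set_universe \<Rightarrow> 'v" where
  "cf d = (THE k. Ord k \<and> has_cofinal_map d k \<and> (\<forall>m\<in>elts k. \<not> has_cofinal_map d m))"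

definition regular_cardinal :: "'v::set_universe \<Rightarrow> bool" where
  "regular_cardinal k \<longleftrightarrow> Ord k \<and> infinite (elts k) \<and> cf k = k"

text \<open>\<open>hereditary \<Theta>\<close> is \<open>H(\<Theta>)\<close>, the collection of all sets whose transitive closure has fewer
  than \<open>\<Theta>\<close> members.\<close>

definition trans_closure :: "'v::set_universe \<Rightarrow> 'v set" where
  "trans_closure x = {y. (y, x) \<in> {(a, b). a \<in> elts b}\<^sup>+}"

definition hereditary :: "'v::set_universe \<Rightarrow> 'v set" where
  "hereditary \<Theta> = {x. trans_closure x \<prec> elts \<Theta>}"

section \<open>Stationary sets and the ideal\<close>

definition unbounded_in :: "'v::set_universe \<Rightarrow> 'v set \<Rightarrow> bool" where
  "unbounded_in k C \<longleftrightarrow> (\<forall>z\<in>elts k. \<exists>c\<in>C. c \<in> elts k \<and> z \<in> elts c)"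

definition club :: "'v::set_universe \<Rightarrow> 'v set \<Rightarrow> bool" where
  "club k C \<longleftrightarrow> C \<subseteq> elts k \<and> unbounded_in k C \<and>
     (\<forall>d\<in>elts k. limit_ordinal d \<and> unbounded_in d C \<longrightarrow> d \<in> C)"

definition stationary :: "'v::set_universe \<Rightarrow> 'v set \<Rightarrow> bool" where
  "stationary k S \<longleftrightarrow> S \<subseteq> elts k \<and> (\<forall>C. club k C \<longrightarrow> C \<inter> S \<noteq> {})"

definition bounded_in :: "'v::set_universe \<Rightarrow> 'v set \<Rightarrow> bool" where
  "bounded_in k A \<longleftrightarrow> (\<exists>z\<in>elts k. \<forall>a\<in>A. a \<in> elts z)"

text \<open>\<open>E_omega2 k\<close> is the set of all ordinals below \<open>\<omega>\<^sub>2\<close> of cofinality \<open>k\<close>.\<close>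

definition E_omega2 :: "'v::set_universe \<Rightarrow> 'v set" where
  "E_omega2 k = {\<eta> \<in> elts omega2. cf \<eta> = k}"

definition I_bdd_cof_omega1 :: "'v::set_universe set set" where
  "I_bdd_cof_omega1 = {A. A \<subseteq> elts omega2 \<and> bounded_in omega2 (A \<inter> E_omega2 omega1)}"

definition positive_sets :: "'v::set_universe set set \<Rightarrow> 'v set set" where
  "positive_sets I = {X. X \<subseteq> elts omega2 \<and> X \<notin> I}"

section \<open>The game\<close>

text \<open>\<open>f \<beta>\<close> and \<open>\<xi> \<beta>\<close> are the moves of the two players in round \<open>\<beta> < \<gamma>\<close>.\<close>

definition II_wins_play ::
    "'v::set_universe \<Rightarrow> 'v set set \<Rightarrow> ('v \<Rightarrow> 'v \<Rightarrow> 'v) \<Rightarrow> ('v \<Rightarrow> 'v) \<Rightarrow> bool" where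
  "II_wins_play \<gamma> I f \<xi> \<longleftrightarrow>
     (\<exists>X\<in>positive_sets I. \<forall>\<eta>\<in>X. \<forall>\<beta>\<in>elts \<gamma>. elts (f \<beta> \<eta>) \<subseteq> elts (\<xi> \<beta>))"

text \<open>A strategy \<open>\<sigma>\<close> of player II maps the round \<open>\<beta>\<close> and the sequence of moves made by player I in
  the rounds up to and including \<open>\<beta>\<close> to an answer below \<open>\<omega>\<^sub>1\<close>. Since \<open>f\<close> is restricted
  to these rounds, \<open>\<sigma>\<close> sees nothing of the future; II's own earlier moves are determined
  by \<open>\<sigma>\<close> and the earlier moves of I.\<close>

definition winning_strategy_II ::
    "'v::set_universe \<Rightarrow> 'v set set \<Rightarrow> ('v \<Rightarrow> ('v \<Rightarrow> 'v \<Rightarrow> 'v) \<Rightarrow> 'v) \<Rightarrow> bool" where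
  "winning_strategy_II \<gamma> I \<sigma> \<longleftrightarrow>
     (\<forall>f \<in> elts \<gamma> \<rightarrow>\<^sub>E (elts omega2 \<rightarrow>\<^sub>E elts omega1).
        let \<xi> = (\<lambda>\<beta>. \<sigma> \<beta> (restrict f (elts (vsucc \<beta>))))
        in (\<forall>\<beta>\<in>elts \<gamma>. \<xi> \<beta> \<in> elts omega1) \<and> II_wins_play \<gamma> I f \<xi>)"

section \<open>First-order structures, elementary submodels and towers\<close>

text \<open>Function and relation symbols carry no arity: a symbol applied to lists of different lengths
  plays the role of different symbols, and constants are functions applied to the empty list.\<close>

datatype 'f trm = Var nat | App 'f "'f trm list"

datatype ('f, 'r) form =
    Eq "'f trm" "'f trm"
  | Rel 'r "'f trm list"
  | Neg "('f, 'r) form"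
  | Conj "('f, 'r) form" "('f, 'r) form"
  | Exi nat "('f, 'r) form"

record ('f, 'r, 'v) model =
  dom_of :: "'v set"
  fun_of :: "'f \<Rightarrow> 'v list \<Rightarrow> 'v"
  rel_of :: "'r \<Rightarrow> 'v list \<Rightarrow> bool"

primrec trm_val :: "('f, 'r, 'v) model \<Rightarrow> (nat \<Rightarrow> 'v) \<Rightarrow> 'f trm \<Rightarrow> 'v" where
  "trm_val A e (Var n) = e n"
| "trm_val A e (App g ts) = fun_of A g (map (trm_val A e) ts)"

primrec satisfies :: "('f, 'r, 'v) model \<Rightarrow> (nat \<Rightarrow> 'v) \<Rightarrow> ('f, 'r) form \<Rightarrow> bool" where
  "satisfies A e (Eq s t) \<longleftrightarrow> trm_val A e s = trm_val A e t"
| "satisfies A e (Rel r ts) \<longleftrightarrow> rel_of A r (map (trm_val A e) ts)"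
| "satisfies A e (Neg \<phi>) \<longleftrightarrow> \<not> satisfies A e \<phi>"
| "satisfies A e (Conj \<phi> \<psi>) \<longleftrightarrow> satisfies A e \<phi> \<and> satisfies A e \<psi>"
| "satisfies A e (Exi n \<phi>) \<longleftrightarrow> (\<exists>x\<in>dom_of A. satisfies A (e(n := x)) \<phi>)"

definition is_structure :: "('f, 'r, 'v) model \<Rightarrow> bool" where
  "is_structure A \<longleftrightarrow> dom_of A \<noteq> {} \<and>
     (\<forall>g. \<forall>xs\<in>lists (dom_of A). fun_of A g xs \<in> dom_of A)"

definition elementary_submodel :: "'v set \<Rightarrow> ('f, 'r, 'v) model \<Rightarrow> bool" where
  "elementary_submodel N A \<longleftrightarrow> N \<subseteq> dom_of A \<and> is_structure (A\<lparr>dom_of := N\<rparr>) \<and>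
     (\<forall>e \<phi>. range e \<subseteq> N \<longrightarrow> (satisfies (A\<lparr>dom_of := N\<rparr>) e \<phi> \<longleftrightarrow> satisfies A e \<phi>))"

text \<open>\<open>A\<close> is a structure on \<open>H(\<Theta>)\<close> in a countable language which extends
  \<open>(H(\<Theta>), \<in>, S, \<alpha>, <\<^sub>\<Theta>)\<close>, where \<open><\<^sub>\<Theta>\<close> is the strict part of the well order \<open>W\<close> and
  \<open>S\<close>, \<open>\<alpha>\<close> (both elements of \<open>H(\<Theta>)\<close>) are constants.\<close>

definition algebra_extending ::
    "('f::countable, 'r::countable, 'v::set_universe) model \<Rightarrow> 'v \<Rightarrow> 'v \<Rightarrow> 'v \<Rightarrow> 'v rel \<Rightarrow> bool" where
  "algebra_extending A \<Theta> S \<alpha> W \<longleftrightarrow>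
     is_structure A \<and> dom_of A = hereditary \<Theta> \<and>
     (\<exists>r. \<forall>x\<in>hereditary \<Theta>. \<forall>y\<in>hereditary \<Theta>. rel_of A r [x, y] \<longleftrightarrow> x \<in> elts y) \<and>
     (\<exists>c. fun_of A c [] = S) \<and>
     (\<exists>c. fun_of A c [] = \<alpha>) \<and>
     (\<exists>r. \<forall>x\<in>hereditary \<Theta>. \<forall>y\<in>hereditary \<Theta>. rel_of A r [x, y] \<longleftrightarrow> (x, y) \<in> W \<and> x \<noteq> y)"

definition tower :: "('f, 'r, 'v::set_universe) model \<Rightarrow> 'v \<Rightarrow> ('v \<Rightarrow> 'v) \<Rightarrow> bool" where
  "tower A \<alpha> M \<longleftrightarrow>
     (\<forall>i\<in>elts \<alpha>. countable (elts (M i)) \<and> elementary_submodel (elts (M i)) A) \<and>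
     (\<forall>d\<in>elts \<alpha>. limit_ordinal d \<longrightarrow> elts (M d) = (\<Union>i\<in>elts d. elts (M i))) \<and>
     (\<forall>j\<in>elts \<alpha>. successor_ordinal j \<longrightarrow> vseq j M \<in> elts (M j))"

section \<open>The constants are well defined\<close>

lemma elts_set_of_eq: "elts z = A \<Longrightarrow> elts (set_of A) = A"
  for z :: "'v::set_universe"
  unfolding set_of_def by (rule theI[of _ z]) (auto intro: extensionality)

lemma elts_set_of:
  fixes A :: "'v::set_universe set"
  assumes "A \<lesssim> elts (x :: 'v::set_universe)"
  shows "elts (set_of A) = A"
proof -
  obtain g where g: "A \<subseteq> g ` elts x"
    using assms unfolding lepoll_iff by blast
  obtain z where z: "elts z = g ` elts x" using replacement[of g x] by blast
  then obtain y where "elts y = A" using separation[of A z] g by auto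
  then show ?thesis by (rule elts_set_of_eq)
qed

lemma elts_set_of_subset: "A \<subseteq> elts x \<Longrightarrow> elts (set_of A) = A"
  for x :: "'v::set_universe"
  by (rule elts_set_of[OF subset_imp_lepoll])

lemma elts_set_of_pair: "elts (set_of {x, y}) = {x, y}" for x :: "'v::set_universe"
  using pairing[of x y] elts_set_of_eq by blast

lemma elts_vpair: "elts (vpair x y) = {set_of {x}, set_of {x, y}}" for x :: "'v::set_universe"
  unfolding vpair_def by (rule elts_set_of_pair)

lemma elts_vseq: "elts (vseq j M) = (\<lambda>i. vpair i (M i)) ` elts j" for j :: "'v::set_universe"
  unfolding vseq_def by (rule elts_set_of[OF image_lepoll])

lemma elts_vsucc: "elts (vsucc x) = insert x (elts x)" for x :: "'v::set_universe"
proof -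
  define p where "p = set_of {set_of {x, x}, x}"
  have p: "elts p = {set_of {x, x}, x}" unfolding p_def by (rule elts_set_of_pair)
  obtain z where "elts z = \<Union> (elts ` elts p)" using union[of p] by blast
  then have "elts z = insert x (elts x)" unfolding p using elts_set_of_pair[of x x] by simp
  then show ?thesis unfolding vsucc_def by (rule elts_set_of_eq)
qed

lemma elts_set_of_UN:
  fixes g :: "'v::set_universe \<Rightarrow> 'v"
  shows "elts (set_of (\<Union>u\<in>elts y. elts (g u))) = (\<Union>u\<in>elts y. elts (g u))"
proof -
  obtain p where p: "elts p = g ` elts y" using replacement[of g y] by blast
  obtain z where "elts z = \<Union> (elts ` elts p)" using union[of p] by blast
  then have "elts z = (\<Union>u\<in>elts y. elts (g u))" unfolding p by simp
  then show ?thesis by (rule elts_set_of_eq)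
qed

lemma elts_vplus: "elts (vplus x y) = elts x \<union> vplus x ` elts y" for x :: "'v::set_universe"
proof -
  have r: "elts (set_of (vplus x ` elts y)) = vplus x ` elts y"
    by (rule elts_set_of[OF image_lepoll])
  show ?thesis
    using elts_set_of_UN[of "\<lambda>u. u" "set_of {x, set_of (vplus x ` elts y)}"]
    unfolding elts_set_of_pair
    by (subst vplus.simps) (simp add: r)
qed

lemma elts_vtimes: "elts (vtimes x y) = (\<Union>u\<in>elts y. vplus (vtimes x u) ` elts x)"
  for x :: "'v::set_universe"
proof -
  have r: "elts (set_of (vplus (vtimes x u) ` elts x)) = vplus (vtimes x u) ` elts x" for u
    by (rule elts_set_of[OF image_lepoll])
  show ?thesis
    using elts_set_of_UN[of "\<lambda>u. set_of (vplus (vtimes x u) ` elts x)" y]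
    by (subst vtimes.simps) (simp add: r)
qed

lemma elts_vsup_subset:
  fixes A :: "'v::set_universe set"
  assumes "A \<subseteq> elts x"
  shows "elts (vsup A) = \<Union> (elts ` A)"
proof -
  have "elts (set_of A) = A" using assms by (rule elts_set_of_subset)
  then show ?thesis
    using elts_set_of_UN[of "\<lambda>u. u" "set_of A"] unfolding vsup_def by simp
qed

lemma Ord_in_Ord: "Ord a \<Longrightarrow> b \<in> elts a \<Longrightarrow> Ord b" for a :: "'v::set_universe"
  unfolding Ord_def transitive_set_def by blast

lemma Ord_linear:
  fixes a b :: "'v::set_universe"
  assumes "Ord a" "Ord b"
  shows "a \<in> elts b \<or> a = b \<or> b \<in> elts a"
  using assms
proof (induction a arbitrary: b rule: wf_induct_rule[OF foundation])
  case (1 a)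
  note outer = 1
  from outer(3) show ?case
  proof (induction b rule: wf_induct_rule[OF foundation])
    case (1 b)
    have Ib: "a \<in> elts c \<or> a = c \<or> c \<in> elts a" if "c \<in> elts b" for c
      using 1(1)[of c] that Ord_in_Ord[OF 1(2) that] by simp
    have Ia: "c \<in> elts b \<or> c = b \<or> b \<in> elts c" if "c \<in> elts a" for c
      using outer(1)[of c b] that Ord_in_Ord[OF outer(2) that] 1(2) by simp
    show ?case
    proof (rule ccontr)
      assume n: "\<not> ?case"
      have ta: "\<And>c. c \<in> elts a \<Longrightarrow> elts c \<subseteq> elts a" and tb: "\<And>c. c \<in> elts b \<Longrightarrow> elts c \<subseteq> elts b"
        using outer(2) 1(2) unfolding Ord_def transitive_set_def by auto
      have "elts a \<subseteq> elts b" using Ia ta n by blast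
      moreover have "elts b \<subseteq> elts a" using Ib tb n by blast
      ultimately show False using extensionality[of a b] n by blast
    qed
  qed
qed

lemma mem_irrefl: "x \<notin> elts x" for x :: "'v::set_universe"
  using wf_not_refl[OF foundation, of x] by simp

lemma cf_props:
  fixes d :: "'v::set_universe"
  assumes "Ord d"
  shows "Ord (cf d) \<and> has_cofinal_map d (cf d) \<and> (\<forall>m\<in>elts (cf d). \<not> has_cofinal_map d m)"
proof -
  let ?P = "\<lambda>k. Ord k \<and> has_cofinal_map d k"
  have "?P d" using assms unfolding has_cofinal_map_def by (auto intro!: exI[of _ "\<lambda>x. x"])
  then obtain k where k: "?P k" "\<And>m. m \<in> elts k \<Longrightarrow> \<not> ?P m"
    using wfE_min[OF foundation, of d "Collect ?P"] by auto
  have "\<forall>m\<in>elts k. \<not> has_cofinal_map d m" using k Ord_in_Ord by blast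
  then have ex: "Ord k \<and> has_cofinal_map d k \<and> (\<forall>m\<in>elts k. \<not> has_cofinal_map d m)"
    using k(1) by blast
  show ?thesis
    unfolding cf_def by (rule theI[of _ k]) (use ex Ord_linear in blast)+
qed

lemma Ord_eqpoll_exists:
  fixes x :: "'v::set_universe"
  shows "\<exists>k::'v. Ord k \<and> elts k \<approx> elts x"
proof -
  obtain r where r: "well_order_on (elts x) r" using well_order_on by blast
  have wf: "wf (r - Id)" and lin: "linear_order_on (elts x) r"
    using r unfolding well_order_on_def by auto
  have fld: "r \<subseteq> elts x \<times> elts x"
    using lin unfolding linear_order_on_def partial_order_on_def preorder_on_def by simp
  have tr: "trans (r - Id)"
    using lin unfolding linear_order_on_def partial_order_on_def preorder_on_def
    by (auto intro: trans_diff_Id)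
  have tot: "\<And>z w. z \<in> elts x \<Longrightarrow> w \<in> elts x \<Longrightarrow> z \<noteq> w \<Longrightarrow> (z, w) \<in> r - Id \<or> (w, z) \<in> r - Id"
    using lin unfolding linear_order_on_def total_on_def by blast
  define G :: "'v \<Rightarrow> 'v"
    where "G = wfrec (r - Id) (\<lambda>g z. set_of (g ` {w. (w, z) \<in> r - Id}))"
  have Gcut: "G z = set_of (cut G (r - Id) z ` {w. (w, z) \<in> r - Id})" for z
    by (rule def_wfrec[OF _ wf]) (simp add: G_def)
  have cut: "cut G (r - Id) z ` {w. (w, z) \<in> r - Id} = G ` {w. (w, z) \<in> r - Id}" for z
    by (rule image_cong[OF refl]) (simp add: cut_def)
  have small: "G ` {w. (w, z) \<in> r - Id} \<lesssim> elts x" for z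
    using fld by (intro lepoll_trans[OF image_lepoll] subset_imp_lepoll) auto
  have G: "elts (G z) = G ` {w. (w, z) \<in> r - Id}" for z
    by (subst Gcut, subst cut, rule elts_set_of[OF small])
  define k where "k = set_of (G ` elts x)"
  have k: "elts k = G ` elts x" unfolding k_def by (rule elts_set_of[OF image_lepoll])
  have tG: "transitive_set (G z)" for z
    unfolding transitive_set_def G using tr by (auto simp: G dest: transD)
  have "Ord k"
    unfolding Ord_def using tG k fld by (auto simp: transitive_set_def G)
  moreover have "inj_on G (elts x)"
  proof (rule inj_onI, rule ccontr)
    fix z w assume zw: "z \<in> elts x" "w \<in> elts x" "G z = G w" "z \<noteq> w"
    then have "G z \<in> elts (G w) \<or> G w \<in> elts (G z)" using tot[of z w] unfolding G by blast
    then show False using zw(3) mem_irrefl by metis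
  qed
  ultimately show ?thesis unfolding k
    by (metis inj_on_image_eqpoll_self k)
qed

lemma Ord_subset_of_lepoll:
  fixes k :: "'v::set_universe"
  assumes k: "Ord k" and P: "\<And>a::'v. Ord a \<Longrightarrow> P a \<Longrightarrow> \<not> elts k \<lesssim> elts a"
  shows "{a. Ord a \<and> P a} \<subseteq> elts k"
proof
  fix a assume "a \<in> {a. Ord a \<and> P a}"
  then have a: "Ord a" "\<not> elts k \<lesssim> elts a" using P by auto
  have "elts k \<subseteq> elts a" if "a = k \<or> k \<in> elts a"
    using that a(1) unfolding Ord_def transitive_set_def by blast
  then show "a \<in> elts k"
    using Ord_linear[OF a(1) k] a(2) subset_imp_lepoll by blast
qed

lemma ex_uncountable_Ords:
  obtains k l :: "'v::set_universe"
  where "Ord k" "Ord l" "uncountable (elts k)" "elts k \<prec> elts l"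
proof -
  obtain x y :: 'v where xy: "uncountable (elts x)" "elts x \<prec> elts y"
    using two_uncountable_cardinals by blast
  obtain k l :: 'v where kl: "Ord k" "elts k \<approx> elts x" "Ord l" "elts l \<approx> elts y"
    using Ord_eqpoll_exists by metis
  have "uncountable (elts k)"
    using xy(1) kl(2) by (meson countable_lepoll eqpoll_imp_lepoll eqpoll_sym)
  moreover have "elts k \<prec> elts l"
    using xy(2) kl(2,4) eq_lesspoll_trans eqpoll_sym lesspoll_eq_trans by metis
  ultimately show thesis using that kl by blast
qed

lemma elts_omega: "elts (omega :: 'v::set_universe) = {a. Ord a \<and> finite (elts a)}"
proof -
  obtain k l :: 'v where k: "Ord k" "uncountable (elts k)" using ex_uncountable_Ords by metis
  have "{a. Ord a \<and> finite (elts a)} \<subseteq> elts k"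
    using k by (intro Ord_subset_of_lepoll) (auto dest: countable_lepoll countable_finite)
  then show ?thesis unfolding omega_def by (rule elts_set_of_subset)
qed

lemma elts_omega1: "elts (omega1 :: 'v::set_universe) = {a. Ord a \<and> countable (elts a)}"
proof -
  obtain k l :: 'v where k: "Ord k" "uncountable (elts k)" using ex_uncountable_Ords by metis
  have "{a. Ord a \<and> countable (elts a)} \<subseteq> elts k"
    using k by (intro Ord_subset_of_lepoll) (auto dest: countable_lepoll)
  then show ?thesis unfolding omega1_def by (rule elts_set_of_subset)
qed

lemma elts_omega2:
  "elts (omega2 :: 'v::set_universe) = {a. Ord a \<and> elts a \<lesssim> elts (omega1 :: 'v)}"
proof -
  obtain k l :: 'v where kl: "Ord k" "Ord l" "uncountable (elts k)" "elts k \<prec> elts l"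
    using ex_uncountable_Ords by metis
  have "elts (omega1 :: 'v) \<subseteq> elts k"
    unfolding elts_omega1 using kl by (intro Ord_subset_of_lepoll) (auto dest: countable_lepoll)
  then have "elts (omega1 :: 'v) \<prec> elts l"
    using kl(4) subset_imp_lepoll lesspoll_trans1 by blast
  then have "{a. Ord a \<and> elts a \<lesssim> elts (omega1 :: 'v)} \<subseteq> elts l"
    using kl(2)
    by (intro Ord_subset_of_lepoll) (auto dest: lepoll_trans simp: lesspoll_def lepoll_antisym)
  then show ?thesis unfolding omega2_def by (rule elts_set_of_subset)
qed

end

theory Submission
  imports Defs
begin

text \<open>
  To add an ordinal \<open>\<eta>\<close> to a model \<open>M\<close> means to pass to the set of all \<open>f(\<eta>)\<close>, \<open>f \<in> M\<close>. Let player I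
  list, in the \<open>i\<close>-th block of \<open>\<omega>\<close> rounds, the functions from \<open>\<omega>\<^sub>2\<close> to \<open>\<omega>\<^sub>1\<close> which belong to \<open>M\<^sub>i\<close>. For a
  successor \<open>i\<close>, the sequence of all \<open>M\<^sub>k\<close>, \<open>k < i\<close>, is a member of \<open>M\<^sub>i\<close>, and hence so are the answers of a
  winning strategy in this block; at limits, take unions. Thus there are unboundedly many
  \<open>\<eta>\<close> which can be added to all \<open>M\<^sub>i\<close> at once without adding a countable ordinal.

  To bring the suprema into \<open>S\<close> we use induction on the last index \<open>j\<close> of the tower. Choose \<open>\<delta> \<in> S\<close> closed
  under all finite stages of the following process, ordinals \<open>\<zeta>\<^sub>n\<close> cofinal in \<open>\<delta>\<close>, and non-limit indices
  \<open>\<lambda>\<^sub>n \<le> j\<close> which exhaust \<open>j\<close>. In stage \<open>n\<close> add some \<open>\<eta> \<ge> \<zeta>\<^sub>n\<close> to all models of index at least \<open>\<lambda>\<^sub>n\<close>;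
  then, by the induction hypothesis and elementarity, there is inside the model of index
  \<open>\<lambda>\<^bsub>n+1\<^esub>\<close> an improvement of the models of index less than \<open>\<lambda>\<^bsub>n+1\<^esub>\<close>, which is final for these. In the
  limit the last model has supremum \<open>\<delta>\<close>.
\<close>

section \<open>Cardinalities and ordinals\<close>

text \<open>Three obstacles shape the proof. First, the answers have to be computed inside the
  models, so a strategy must be one of their members. It is coded by a set of at most 2^{omega_2}
  entries, which therefore belongs to H(\<Theta>), and by elementarity the least model contains such
  a code. Second, elementarity in the algebra cannot be expressed in the algebra, so an improved
  tower cannot be reflected into a model as it stands. It is replaced by a first-order relation
  between a model and its extension under which elementarity is inherited. Third, the sequence of
  the new models below a successor i must belong to the new i-th model, although infinitely many
  changes are made. So every initial segment has to become constant at a finite stage, and each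
  segment must be found inside the next model. The indices at which changes set in are not limits,
  since enlarging a model of limit index while keeping those below it would destroy
  continuity.\<close>

lemma lepoll_iff_ordLeq: "X \<lesssim> Y \<longleftrightarrow> (card_of X, card_of Y) \<in> ordLeq"
  unfolding lepoll_def card_of_ordLeq[symmetric] by blast

lemma UN_lepoll_infinite:
  assumes "infinite K" "X \<lesssim> K" "\<And>x. x \<in> X \<Longrightarrow> f x \<lesssim> K"
  shows "(\<Union>x\<in>X. f x) \<lesssim> K"
  using assms card_of_UNION_ordLeq_infinite[of K X f] unfolding lepoll_iff_ordLeq by blast

lemma times_lepoll_infinite:
  assumes "infinite K" "X \<lesssim> K" "Y \<lesssim> K"
  shows "X \<times> Y \<lesssim> K"
  using assms card_of_Sigma_ordLeq_infinite[of K X "\<lambda>_. Y"] unfolding lepoll_iff_ordLeq by blast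

lemma lists_length_lepoll:
  assumes "infinite K" "X \<lesssim> K"
  shows "{xs \<in> lists X. length xs = n} \<lesssim> K"
proof (induction n)
  case 0
  have "{xs \<in> lists X. length xs = 0} = {[]}" by auto
  then show ?case using assms(1) by (simp add: finite_lepoll_infinite)
next
  case (Suc n)
  have "{xs \<in> lists X. length xs = Suc n}
      \<subseteq> (\<lambda>(x, xs). x # xs) ` (X \<times> {xs \<in> lists X. length xs = n})"
    by (auto simp: length_Suc_conv image_iff)
  then show ?case
    by (rule lepoll_trans[OF subset_image_lepoll times_lepoll_infinite[OF assms Suc]])
qed

lemma lists_lepoll:
  assumes "infinite K" "X \<lesssim> K"
  shows "lists X \<lesssim> K"
proof -
  have "lists X = (\<Union>n. {xs \<in> lists X. length xs = n})" by auto
  moreover have "(\<Union>n. {xs \<in> lists X. length xs = n}) \<lesssim> K"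
    using assms lists_length_lepoll[OF assms] by (intro UN_lepoll_infinite) (auto simp: infinite_le_lepoll)
  ultimately show ?thesis by simp
qed

lemma uncountable_lepoll:
  assumes "uncountable X" "countable Y" shows "Y \<lesssim> X"
proof -
  have "Y \<lesssim> (UNIV :: nat set)" using assms(2) unfolding countable_def lepoll_def by blast
  moreover have "(UNIV :: nat set) \<lesssim> X" using assms(1) countable_finite infinite_le_lepoll by blast
  ultimately show ?thesis by (rule lepoll_trans)
qed

section \<open>Pairs, sequences and countable collections as sets\<close>

lemma elts_set_of_single: "elts (set_of {x}) = {x}" for x :: "'v::set_universe"
  using elts_set_of_pair[of x x] by simp

lemma vpair_inject [simp]: "vpair a b = vpair c d \<longleftrightarrow> a = c \<and> b = d" for a :: "'v::set_universe"
proof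
  assume "vpair a b = vpair c d"
  then have "elts ` elts (vpair a b) = elts ` elts (vpair c d)" by simp
  then have "{{a}, {a, b}} = {{c}, {c, d}}"
    by (simp add: elts_vpair elts_set_of_single elts_set_of_pair)
  then show "a = c \<and> b = d" by (auto simp: doubleton_eq_iff)
qed simp

lemma vpair_mem_vseq [simp]: "vpair i m \<in> elts (vseq j M) \<longleftrightarrow> i \<in> elts j \<and> m = M i"
  for i :: "'v::set_universe"
  unfolding elts_vseq by auto

lemma vpair_not_empty: "elts (vpair x y) \<noteq> {}" for x :: "'v::set_universe"
  by (simp add: elts_vpair)

lemma vseq_cong: "(\<And>i. i \<in> elts j \<Longrightarrow> M i = N i) \<Longrightarrow> vseq j M = vseq j N"
  for j :: "'v::set_universe"
  by (rule extensionality) (auto simp: elts_vseq)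

text \<open>The universe has an uncountable set, into which every countable collection embeds, so
  Replacement and Separation apply. Hulls of countable models and unions of omega-chains of such
  models are thereby sets.\<close>

lemma countable_set_exists:
  fixes X :: "'v::set_universe set"
  assumes "countable X"
  shows "elts (set_of X) = X"
proof -
  obtain x :: 'v where "uncountable (elts x)" using two_uncountable_cardinals by blast
  then show ?thesis using elts_set_of[OF uncountable_lepoll[OF _ assms]] by blast
qed

section \<open>Ordinals up to omega_2\<close>

lemma Ord_subset: "Ord a \<Longrightarrow> b \<in> elts a \<Longrightarrow> elts b \<subseteq> elts a" for a :: "'v::set_universe"
  unfolding Ord_def transitive_set_def by blast

lemma mem_asym: "x \<in> elts y \<Longrightarrow> y \<notin> elts x" for x :: "'v::set_universe"
  using wf_asym[OF foundation, of x y] by auto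

lemma Ord_vsucc: "Ord a \<Longrightarrow> Ord (vsucc a)" for a :: "'v::set_universe"
  unfolding Ord_def transitive_set_def elts_vsucc by blast

lemma OrdI: "(\<And>y. y \<in> elts x \<Longrightarrow> Ord y \<and> elts y \<subseteq> elts x) \<Longrightarrow> Ord x" for x :: "'v::set_universe"
  unfolding Ord_def transitive_set_def by blast

lemma Ord_subset_iff: "Ord a \<Longrightarrow> Ord b \<Longrightarrow> elts a \<subseteq> elts b \<longleftrightarrow> a \<in> elts b \<or> a = b"
  for a :: "'v::set_universe"
  using Ord_linear[of a b] Ord_subset[of b a] mem_irrefl by blast

lemma Ord_not_mem_iff: "Ord a \<Longrightarrow> Ord b \<Longrightarrow> a \<notin> elts b \<longleftrightarrow> elts b \<subseteq> elts a"
  for a :: "'v::set_universe"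
  using Ord_linear[of a b] Ord_subset[of a b] mem_irrefl by blast

lemma Ord_trichotomy:
  fixes i :: "'v::set_universe"
  assumes "Ord i"
  obtains "elts i = {}" | "limit_ordinal i" | k where "k \<in> elts i" "Ord k" "i = vsucc k"
proof (cases "elts i = {} \<or> limit_ordinal i")
  case False
  then obtain k where k: "k \<in> elts i" "vsucc k \<notin> elts i" using assms unfolding limit_ordinal_def by blast
  have ok: "Ord k" using assms k Ord_in_Ord by blast
  have "elts (vsucc k) \<subseteq> elts i" unfolding elts_vsucc using k Ord_subset[OF assms] by blast
  then have "i = vsucc k" using k Ord_subset_iff[OF Ord_vsucc[OF ok] assms] by blast
  then show ?thesis using that k ok by blast
qed (use that in blast)

lemma not_limit_vsucc: "\<not> limit_ordinal (vsucc k)" for k :: "'v::set_universe"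
  unfolding limit_ordinal_def elts_vsucc using mem_irrefl[of "vsucc k"] elts_vsucc[of k] by auto

lemma vsucc_mem_vsucc: "Ord j \<Longrightarrow> k \<in> elts j \<Longrightarrow> vsucc k \<in> elts (vsucc j)" for k :: "'v::set_universe"
proof -
  assume j: "Ord j" "k \<in> elts j"
  have "elts (vsucc k) \<subseteq> elts j" unfolding elts_vsucc using j Ord_subset by blast
  then show ?thesis using Ord_subset_iff[of "vsucc k" j] Ord_vsucc Ord_in_Ord j elts_vsucc by blast
qed

lemma Ord_omega1: "Ord (omega1 :: 'v::set_universe)"
  by (rule OrdI) (auto simp: elts_omega1 dest: Ord_in_Ord Ord_subset countable_subset)

lemma Ord_omega2: "Ord (omega2 :: 'v::set_universe)"
  by (rule OrdI)
    (auto simp: elts_omega2 dest: Ord_in_Ord Ord_subset intro: lepoll_trans[OF subset_imp_lepoll])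

lemma Ord_omega: "Ord (omega :: 'v::set_universe)"
  by (rule OrdI) (auto simp: elts_omega dest: Ord_in_Ord Ord_subset finite_subset)

lemma uncountable_omega1: "uncountable (elts (omega1 :: 'v::set_universe))"
  using mem_irrefl[of "omega1::'v"] Ord_omega1 elts_omega1 by blast

lemma infinite_omega1: "infinite (elts (omega1 :: 'v::set_universe))"
  using uncountable_omega1 countable_finite by blast

lemma omega1_in_omega2: "omega1 \<in> elts (omega2 :: 'v::set_universe)"
  unfolding elts_omega2 using Ord_omega1 by blast

lemma omega1_subset_omega2: "elts omega1 \<subseteq> elts (omega2 :: 'v::set_universe)"
  using Ord_subset[OF Ord_omega2 omega1_in_omega2] .

lemma limit_omega: "limit_ordinal (omega :: 'v::set_universe)"
proof -
  obtain z :: 'v where z: "elts z = {}" using separation[of "{}"] by blast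
  then have "Ord z" unfolding Ord_def transitive_set_def by simp
  then have "z \<in> elts omega" unfolding elts_omega using z by simp
  then show ?thesis unfolding limit_ordinal_def
    using Ord_omega by (auto simp: elts_omega elts_vsucc intro: Ord_vsucc)
qed

text \<open>On a finite set the converse of membership is acyclic, hence well founded. A minimal
  element for it would be a greatest member of \<open>d\<close>, contradicting closure under
  successors.\<close>

lemma limit_infinite:
  fixes d :: "'v::set_universe"
  assumes "limit_ordinal d" shows "infinite (elts d)"
proof
  assume fin: "finite (elts d)"
  have d: "Ord d" "elts d \<noteq> {}" using assms unfolding limit_ordinal_def by auto
  have "wf ({(x, y). x \<in> elts y}\<inverse> \<inter> elts d \<times> elts d)"
  proof (rule finite_acyclic_wf)
    show "finite ({(x, y). x \<in> elts y}\<inverse> \<inter> elts d \<times> elts d)" using fin by simp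
    have "acyclic ({(x, y). x \<in> elts y}\<inverse>)"
      using wf_acyclic[OF foundation] acyclic_converse by blast
    then show "acyclic ({(x, y). x \<in> elts y}\<inverse> \<inter> elts d \<times> elts d)"
      by (rule acyclic_subset) auto
  qed
  then obtain m where m: "m \<in> elts d" "\<And>y. (y, m) \<in> {(x, y). x \<in> elts y}\<inverse> \<inter> elts d \<times> elts d \<Longrightarrow> y \<notin> elts d"
    using d(2) wfE_min by (metis equals0I)
  have "vsucc m \<in> elts d" using assms m(1) unfolding limit_ordinal_def by blast
  then show False using m(1) m(2)[of "vsucc m"] elts_vsucc[of m] by simp
qed

lemma infinite_omega: "infinite (elts (omega :: 'v::set_universe))"
  using limit_infinite limit_omega by blast

lemma limit_omega2: "limit_ordinal (omega2 :: 'v::set_universe)"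
proof -
  have "elts (vsucc a) \<lesssim> elts (omega1 :: 'v)" if "elts a \<lesssim> elts (omega1 :: 'v)" for a :: 'v
    unfolding elts_vsucc using finite_lepoll_infinite[OF infinite_omega1, of "insert a (elts a)"]
      lepoll_trans[OF infinite_insert_lepoll[of "elts a" a] that] by (cases "finite (elts a)") simp_all
  then have "\<And>i :: 'v. i \<in> elts omega2 \<Longrightarrow> vsucc i \<in> elts omega2"
    using Ord_vsucc unfolding elts_omega2 by blast
  then show ?thesis unfolding limit_ordinal_def using Ord_omega2 omega1_in_omega2 by blast
qed

text \<open>Regularity of omega_2: the union \<open>u\<close> of \<open>B\<close> is an ordinal of
  size at most omega_1. The bound is the successor of \<open>u\<close>, because \<open>u\<close>
  itself may belong to \<open>B\<close>.\<close>

lemma omega2_bounded: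
  fixes B :: "'v::set_universe set"
  assumes "B \<subseteq> elts omega2" "B \<lesssim> elts (omega1 :: 'v)"
  obtains c where "c \<in> elts omega2" "\<And>b. b \<in> B \<Longrightarrow> b \<in> elts c"
proof -
  have B: "elts (set_of B) = B" using assms(2) by (rule elts_set_of)
  define u where "u = set_of (\<Union>b\<in>B. elts b)"
  have u: "elts u = (\<Union>b\<in>B. elts b)" using elts_set_of_UN[of "\<lambda>b. b" "set_of B"] unfolding B u_def by simp
  have ob: "Ord b" if "b \<in> B" for b using that assms(1) elts_omega2 by blast
  have "Ord u"
  proof (rule OrdI)
    fix y assume "y \<in> elts u"
    then obtain b where b: "b \<in> B" "y \<in> elts b" using u by blast
    then show "Ord y \<and> elts y \<subseteq> elts u" using Ord_in_Ord[OF ob] Ord_subset[OF ob] u by blast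
  qed
  moreover have "elts u \<lesssim> elts (omega1 :: 'v)" unfolding u
    using assms by (intro UN_lepoll_infinite infinite_omega1) (auto simp: elts_omega2)
  ultimately have "u \<in> elts omega2" unfolding elts_omega2 by blast
  then have "vsucc u \<in> elts omega2" using limit_omega2 unfolding limit_ordinal_def by blast
  moreover have "b \<in> elts (vsucc u)" if "b \<in> B" for b
  proof -
    have "elts b \<subseteq> elts u" using that u by blast
    then show ?thesis unfolding elts_vsucc using Ord_subset_iff[OF ob[OF that] \<open>Ord u\<close>] by blast
  qed
  ultimately show ?thesis using that by blast
qed

section \<open>Comparing ordinals with sets of arbitrary type\<close>

lemma Ord_of_set_lepoll:
  fixes X :: "'a set" and \<Theta> :: "'v::set_universe"
  assumes "X \<lesssim> elts \<Theta>"
  obtains k :: 'v where "Ord k" "elts k \<approx> X"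
proof -
  obtain f where f: "inj_on f X" "f ` X \<subseteq> elts \<Theta>" using assms unfolding lepoll_def by blast
  obtain x where x: "elts x = f ` X" using separation[OF f(2)] by blast
  obtain k :: 'v where "Ord k" "elts k \<approx> elts x" using Ord_eqpoll_exists by blast
  then show ?thesis using that x eqpoll_trans[OF _ inj_on_image_eqpoll_self[OF f(1)]] by metis
qed

lemma lepoll_total: "X \<lesssim> Y \<or> Y \<lesssim> X"
  unfolding lepoll_iff_ordLeq by (rule ordLeq_total[OF card_of_Well_order card_of_Well_order])

text \<open>Otherwise \<open>X\<close> embeds into \<kappa> and is equinumerous with an ordinal
  \<open>k\<close>, which has to lie below \<kappa>. As \<open>X\<close> may have any type, this can
  compare cardinals of two different universes.\<close>

lemma lepoll_of_initial_segments:
  fixes \<kappa> :: "'v::set_universe" and X :: "'a set"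
  assumes "Ord \<kappa>" and "\<And>k. k \<in> elts \<kappa> \<Longrightarrow> \<not> X \<lesssim> elts k"
  shows "elts \<kappa> \<lesssim> X"
proof (rule ccontr)
  assume n: "\<not> elts \<kappa> \<lesssim> X"
  then have "X \<lesssim> elts \<kappa>" using lepoll_total by blast
  then obtain k :: 'v where k: "Ord k" "elts k \<approx> X" by (rule Ord_of_set_lepoll)
  have "\<not> elts \<kappa> \<subseteq> elts k" using n lepoll_trans2[OF subset_imp_lepoll k(2)] by blast
  then have "k \<in> elts \<kappa>" using Ord_not_mem_iff[OF k(1) assms(1)] by blast
  then show False using assms(2) eqpoll_imp_lepoll[OF eqpoll_sym[OF k(2)]] by blast
qed

text \<open>In the theorem, the hypothesis on the power set of \<open>\<omega>\<^sub>2\<close> leaves open to which universe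
  this \<open>\<omega>\<^sub>2\<close> belongs.\<close>

lemma omega2_lepoll_omega2: "elts (omega2 :: 'v::set_universe) \<lesssim> elts (omega2 :: 'w::set_universe)"
proof (rule lepoll_of_initial_segments[OF Ord_omega2])
  fix k :: 'v assume "k \<in> elts omega2"
  then have k: "elts k \<lesssim> elts (omega1 :: 'v)" unfolding elts_omega2 by blast
  have "elts (omega1 :: 'v) \<lesssim> elts (omega1 :: 'w)"
  proof (rule lepoll_of_initial_segments[OF Ord_omega1])
    fix k :: 'v assume "k \<in> elts omega1"
    then have "countable (elts k)" unfolding elts_omega1 by blast
    then show "\<not> elts (omega1 :: 'w) \<lesssim> elts k" using uncountable_omega1 countable_lepoll by blast
  qed
  then have *: "elts k \<lesssim> elts (omega1 :: 'w)" by (rule lepoll_trans[OF k])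
  show "\<not> elts (omega2 :: 'w) \<lesssim> elts k"
  proof
    assume "elts (omega2 :: 'w) \<lesssim> elts k"
    then have "elts (omega2 :: 'w) \<lesssim> elts (omega1 :: 'w)" using * by (rule lepoll_trans)
    then have "(omega2 :: 'w) \<in> elts omega2" using Ord_omega2 elts_omega2 by blast
    then show False using mem_irrefl by blast
  qed
qed

section \<open>The collection \<open>H(\<Theta>)\<close>\<close>

context
  fixes \<Theta> :: "'v::set_universe"
  assumes reg: "regular_cardinal \<Theta>"
begin

lemma Ord_regular: "Ord \<Theta>" and infinite_regular: "infinite (elts \<Theta>)"
  using reg unfolding regular_cardinal_def by auto

lemma no_cofinal_map_regular: "m \<in> elts \<Theta> \<Longrightarrow> \<not> has_cofinal_map \<Theta> m"
  using cf_props[of \<Theta>] reg unfolding regular_cardinal_def by auto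

lemma regular_mem_lesspoll:
  assumes "m \<in> elts \<Theta>" shows "elts m \<prec> elts \<Theta>"
proof -
  have "\<not> elts \<Theta> \<lesssim> elts m"
  proof
    assume "elts \<Theta> \<lesssim> elts m"
    then obtain g where g: "inj_on g (elts \<Theta>)" "g ` elts \<Theta> \<subseteq> elts m" unfolding lepoll_def by blast
    \<comment> \<open>Off the range of \<open>g\<close> the value only has to lie below \<Theta>,
      and \<open>m\<close> does.\<close>
    define f where "f y = (if y \<in> g ` elts \<Theta> then inv_into (elts \<Theta>) g y else m)" for y
    have "f \<in> elts m \<rightarrow> elts \<Theta>" using assms inv_into_into[of _ g "elts \<Theta>"] unfolding f_def by auto
    moreover have "f (g x) = x" if "x \<in> elts \<Theta>" for x using g(1) that unfolding f_def by simp
    ultimately have "has_cofinal_map \<Theta> m" unfolding has_cofinal_map_def using g(2) 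
      by (intro exI[of _ f]) (metis image_subset_iff order_refl)
    then show False using no_cofinal_map_regular assms by blast
  qed
  moreover have "elts m \<lesssim> elts \<Theta>" by (rule subset_imp_lepoll[OF Ord_subset[OF Ord_regular assms]])
  ultimately show ?thesis unfolding lesspoll_def using eqpoll_imp_lepoll[OF eqpoll_sym] by auto
qed

lemma lesspoll_regular_Ord:
  fixes X :: "'a set"
  assumes "X \<prec> elts \<Theta>"
  obtains k where "k \<in> elts \<Theta>" "elts k \<approx> X"
proof -
  obtain k :: 'v where k: "Ord k" "elts k \<approx> X"
    using Ord_of_set_lepoll[OF lesspoll_imp_lepoll[OF assms]] by blast
  have "\<not> elts \<Theta> \<subseteq> elts k"
    using lesspoll_trans1[OF subset_imp_lepoll eq_lesspoll_trans[OF k(2) assms]] by auto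
  then have "k \<in> elts \<Theta>" using Ord_not_mem_iff[OF k(1) Ord_regular] by blast
  then show ?thesis using that k by blast
qed

lemma regular_bounded:
  assumes "X \<prec> elts \<Theta>" "\<And>x. x \<in> X \<Longrightarrow> g x \<in> elts \<Theta>"
  obtains m where "m \<in> elts \<Theta>" "\<And>x. x \<in> X \<Longrightarrow> g x \<in> elts m"
proof -
  obtain k where k: "k \<in> elts \<Theta>" "elts k \<approx> X" using lesspoll_regular_Ord assms(1) by blast
  then obtain h where h: "bij_betw h (elts k) X" unfolding eqpoll_def by blast
  have hX: "h ` elts k = X" using h unfolding bij_betw_def by blast
  then have "g \<circ> h \<in> elts k \<rightarrow> elts \<Theta>" using assms(2) by auto
  then obtain m where m: "m \<in> elts \<Theta>" "\<And>y. y \<in> elts k \<Longrightarrow> \<not> elts m \<subseteq> elts (g (h y))"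
    using no_cofinal_map_regular[OF k(1)] unfolding has_cofinal_map_def by (metis comp_apply)
  have "g x \<in> elts m" if x: "x \<in> X" for x
  proof -
    obtain y where y: "y \<in> elts k" "x = h y" using x hX by blast
    have "Ord (g x)" "Ord m" using assms(2)[OF x] m(1) Ord_in_Ord[OF Ord_regular] by auto
    then show ?thesis using m(2)[OF y(1)] Ord_not_mem_iff[of "g x" m] y(2) by blast
  qed
  then show ?thesis using that m(1) by blast
qed

text \<open>Regularity bounds the sizes of all \<open>f x\<close> by one ordinal below \<Theta>, so
  \<open>X\<close> and every \<open>f x\<close> embed into a single \<open>n\<close>. An infinite
  \<open>n\<close> also bounds the union, and for finite \<open>n\<close> the union is
  finite.\<close>

lemma regular_UN_lesspoll:
  fixes f :: "'a \<Rightarrow> 'b set"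
  assumes X: "X \<prec> elts \<Theta>" and f: "\<And>x. x \<in> X \<Longrightarrow> f x \<prec> elts \<Theta>"
  shows "(\<Union>x\<in>X. f x) \<prec> elts \<Theta>"
proof -
  have "\<exists>k. k \<in> elts \<Theta> \<and> elts k \<approx> f x" if "x \<in> X" for x using lesspoll_regular_Ord f that by metis
  then obtain g where g: "\<And>x. x \<in> X \<Longrightarrow> g x \<in> elts \<Theta> \<and> elts (g x) \<approx> f x" by metis
  obtain m where m: "m \<in> elts \<Theta>" "\<And>x. x \<in> X \<Longrightarrow> g x \<in> elts m" using regular_bounded[OF X] g by metis
  obtain k where k: "k \<in> elts \<Theta>" "elts k \<approx> X" using lesspoll_regular_Ord X by blast
  obtain n where n: "n \<in> elts \<Theta>" "elts m \<subseteq> elts n" "elts k \<subseteq> elts n"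
    using Ord_linear[of m k] m k Ord_in_Ord[OF Ord_regular] Ord_subset by (metis order_refl)
  have Xn: "X \<lesssim> elts n" by (rule lepoll_trans1[OF eqpoll_sym[OF k(2)] subset_imp_lepoll[OF n(3)]])
  have fn: "f x \<lesssim> elts n" if "x \<in> X" for x
  proof -
    have "elts (g x) \<subseteq> elts n" using Ord_subset[of m "g x"] Ord_in_Ord[OF Ord_regular m(1)] m(2)[OF that] n(2) by blast
    then show ?thesis using lepoll_trans1[OF eqpoll_sym subset_imp_lepoll, of "elts (g x)" "f x"] g[OF that] by simp
  qed
  show ?thesis
  proof (cases "finite (elts n)")
    case True
    then have "finite X" "\<And>x. x \<in> X \<Longrightarrow> finite (f x)" 
      using lepoll_trans[OF _ Xn] lepoll_trans[OF _ fn] True by (metis infinite_le_lepoll)+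
    then show ?thesis by (intro finite_lesspoll_infinite infinite_regular) auto
  next
    case False
    show ?thesis
      by (rule lesspoll_trans1[OF UN_lepoll_infinite[OF False Xn fn] regular_mem_lesspoll[OF n(1)]])
  qed
qed

lemma insert_lesspoll_regular: "X \<prec> elts \<Theta> \<Longrightarrow> insert x X \<prec> elts \<Theta>"
  using eq_lesspoll_trans[OF infinite_insert_eqpoll[of X x]]
    finite_lesspoll_infinite[OF infinite_regular, of "insert x X"] by (cases "finite X") auto

lemma mem_trans_closure: "y \<in> elts x \<Longrightarrow> y \<in> trans_closure x" for x y :: 'v
  unfolding trans_closure_def by auto

lemma trans_closure_mono: "y \<in> elts x \<Longrightarrow> trans_closure y \<subseteq> trans_closure x" for x y :: 'v
  unfolding trans_closure_def by (auto intro: trancl_into_trancl)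

lemma trans_closure_eq: "trans_closure x = (\<Union>y\<in>elts x. insert y (trans_closure y))" for x :: 'v
proof
  show "trans_closure x \<subseteq> (\<Union>y\<in>elts x. insert y (trans_closure y))"
    unfolding trans_closure_def by (auto elim: tranclE)
  show "(\<Union>y\<in>elts x. insert y (trans_closure y)) \<subseteq> trans_closure x"
    using mem_trans_closure trans_closure_mono by blast
qed

lemma hereditary_trans: "x \<in> hereditary \<Theta> \<Longrightarrow> y \<in> elts x \<Longrightarrow> y \<in> hereditary \<Theta>"
  unfolding hereditary_def using lesspoll_trans1[OF subset_imp_lepoll[OF trans_closure_mono]] by simp

lemma hereditary_lesspoll: "x \<in> hereditary \<Theta> \<Longrightarrow> elts x \<prec> elts \<Theta>"
  unfolding hereditary_def
  using lesspoll_trans1[OF subset_imp_lepoll[OF subsetI[OF mem_trans_closure]]] by simp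

text \<open>The transitive closure of \<open>x\<close> is a union of fewer than \<Theta> sets of
  size below \<Theta>. Membership in H(\<Theta>) can thus be checked one level down.\<close>

lemma hereditary_iff: "x \<in> hereditary \<Theta> \<longleftrightarrow> elts x \<subseteq> hereditary \<Theta> \<and> elts x \<prec> elts \<Theta>"
proof
  assume x: "elts x \<subseteq> hereditary \<Theta> \<and> elts x \<prec> elts \<Theta>"
  have "(\<Union>y\<in>elts x. insert y (trans_closure y)) \<prec> elts \<Theta>"
    using x by (intro regular_UN_lesspoll insert_lesspoll_regular) (auto simp: hereditary_def)
  then show "x \<in> hereditary \<Theta>" unfolding hereditary_def by (simp add: trans_closure_eq[of x])
qed (use hereditary_trans hereditary_lesspoll in blast)

lemma set_of_hereditary:
  assumes "X \<subseteq> hereditary \<Theta>" "X \<prec> elts \<Theta>"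
  shows "elts (set_of X) = X" "set_of X \<in> hereditary \<Theta>"
proof -
  show "elts (set_of X) = X" by (rule elts_set_of[OF lesspoll_imp_lepoll[OF assms(2)]])
  then show "set_of X \<in> hereditary \<Theta>" using hereditary_iff assms by simp
qed

lemma finite_hereditary: "finite X \<Longrightarrow> X \<subseteq> hereditary \<Theta> \<Longrightarrow> set_of X \<in> hereditary \<Theta>"
  using set_of_hereditary(2) finite_lesspoll_infinite[OF infinite_regular] by blast

lemma vpair_hereditary [simp]: "vpair x y \<in> hereditary \<Theta> \<longleftrightarrow> x \<in> hereditary \<Theta> \<and> y \<in> hereditary \<Theta>"
proof
  assume p: "vpair x y \<in> hereditary \<Theta>"
  have "set_of {x, y} \<in> hereditary \<Theta>" using hereditary_trans[OF p] elts_vpair by blast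
  then show "x \<in> hereditary \<Theta> \<and> y \<in> hereditary \<Theta>"
    using hereditary_trans elts_set_of_pair by blast
next
  assume "x \<in> hereditary \<Theta> \<and> y \<in> hereditary \<Theta>"
  then show "vpair x y \<in> hereditary \<Theta>"
    unfolding vpair_def by (intro finite_hereditary) (auto intro: finite_hereditary)
qed

lemma Ord_hereditary:
  assumes "Ord a" "elts a \<prec> elts \<Theta>"
  shows "a \<in> hereditary \<Theta>"
proof -
  have "trans_closure a \<subseteq> elts a"
  proof
    fix y assume "y \<in> trans_closure a"
    then have "(y, a) \<in> {(a, b). a \<in> elts b}\<^sup>+" unfolding trans_closure_def by simp
    then show "y \<in> elts a"
      by (induction rule: converse_trancl_induct) (use Ord_subset[OF assms(1)] in auto)
  qed
  then show ?thesis unfolding hereditary_def using lesspoll_trans1[OF subset_imp_lepoll assms(2)] by simp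
qed

lemma vseq_hereditary:
  assumes "j \<in> hereditary \<Theta>" "\<And>i. i \<in> elts j \<Longrightarrow> M i \<in> hereditary \<Theta>"
  shows "vseq j M \<in> hereditary \<Theta>"
proof -
  have "elts (vseq j M) \<subseteq> hereditary \<Theta>" unfolding elts_vseq using assms hereditary_trans by auto
  moreover have "elts (vseq j M) \<prec> elts \<Theta>" unfolding elts_vseq
    using lesspoll_trans1[OF image_lepoll hereditary_lesspoll[OF assms(1)]] .
  ultimately show ?thesis using hereditary_iff by blast
qed

end

section \<open>Definable predicates and elementary submodels\<close>

primrec ren_trm :: "(nat \<Rightarrow> nat) \<Rightarrow> 'f trm \<Rightarrow> 'f trm" where
  "ren_trm \<rho> (Var n) = Var (\<rho> n)"
| "ren_trm \<rho> (App g ts) = App g (map (ren_trm \<rho>) ts)"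

primrec ren_form :: "(nat \<Rightarrow> nat) \<Rightarrow> ('f, 'r) form \<Rightarrow> ('f, 'r) form" where
  "ren_form \<rho> (Eq s t) = Eq (ren_trm \<rho> s) (ren_trm \<rho> t)"
| "ren_form \<rho> (Rel r ts) = Rel r (map (ren_trm \<rho>) ts)"
| "ren_form \<rho> (Neg \<phi>) = Neg (ren_form \<rho> \<phi>)"
| "ren_form \<rho> (Conj \<phi> \<psi>) = Conj (ren_form \<rho> \<phi>) (ren_form \<rho> \<psi>)"
| "ren_form \<rho> (Exi n \<phi>) = Exi (\<rho> n) (ren_form \<rho> \<phi>)"

lemma trm_val_ren: "trm_val A e (ren_trm \<rho> t) = trm_val A (e \<circ> \<rho>) t"
  by (induction t) (auto intro!: arg_cong[of _ _ "fun_of A _"])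

text \<open>Injectivity prevents capture: no other variable is renamed to the new name of a bound
  variable.\<close>

lemma satisfies_ren:
  assumes "inj \<rho>"
  shows "satisfies A e (ren_form \<rho> \<phi>) \<longleftrightarrow> satisfies A (e \<circ> \<rho>) \<phi>"
proof (induction \<phi> arbitrary: e)
  case (Rel r ts)
  have "trm_val A e \<circ> ren_trm \<rho> = trm_val A (e \<circ> \<rho>)" by (rule ext) (simp add: trm_val_ren)
  then show ?case by (simp only: ren_form.simps satisfies.simps map_map)
next
  case (Exi n \<phi>)
  have "e(\<rho> n := x) \<circ> \<rho> = (e \<circ> \<rho>)(n := x)" for x
    using assms by (auto simp: fun_eq_iff inj_eq)
  then show ?case by (simp only: ren_form.simps satisfies.simps Exi)
qed (simp_all add: trm_val_ren)

lemma map_finite_support: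
  assumes "\<And>t. t \<in> set ts \<Longrightarrow> \<exists>N. \<forall>e e'. (\<forall>n<N. e n = e' n) \<longrightarrow> F e t = F e' t"
  shows "\<exists>N::nat. \<forall>e e'. (\<forall>n<N. e n = e' n) \<longrightarrow> map (F e) ts = map (F e') ts"
  using assms
proof (induction ts)
  case (Cons t ts)
  obtain N where N: "\<forall>e e'. (\<forall>n<N. e n = e' n) \<longrightarrow> F e t = F e' t"
    using Cons.prems[OF list.set_intros(1)] ..
  obtain N' where N': "\<forall>e e'. (\<forall>n<N'. e n = e' n) \<longrightarrow> map (F e) ts = map (F e') ts"
    using Cons.IH[OF Cons.prems[OF list.set_intros(2)]] ..
  have "map (F e) (t # ts) = map (F e') (t # ts)" if "\<forall>n<max N N'. e n = e' n" for e e'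
  proof -
    have "F e t = F e' t" "map (F e) ts = map (F e') ts" using N N' that by auto
    then show ?thesis by simp
  qed
  then show ?case by blast
qed simp

lemma trm_val_finite_support:
  "\<exists>N. \<forall>e e'. (\<forall>n<N. e n = e' n) \<longrightarrow> trm_val A e t = trm_val A e' t"
proof (induction t)
  case (Var n)
  show ?case by (auto intro: exI[of _ "Suc n"])
next
  case (App g ts)
  have "\<exists>N::nat. \<forall>e e'. (\<forall>n<N. e n = e' n) \<longrightarrow> map (trm_val A e) ts = map (trm_val A e') ts"
    by (rule map_finite_support) (rule App)
  then show ?case unfolding trm_val.simps by metis
qed

text \<open>A bound on the relevant variables stands in for the set of free variables: it provides a
  fresh variable and permits changes of the environment beyond it. At a quantifier the same bound
  serves, since both environments are updated alike.\<close>

lemma satisfies_finite_support: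
  "\<exists>N. \<forall>e e'. (\<forall>n<N. e n = e' n) \<longrightarrow> satisfies A e \<phi> = satisfies A e' \<phi>"
proof (induction \<phi>)
  case (Eq s t)
  obtain N where N: "\<forall>e e'. (\<forall>n<N. e n = e' n) \<longrightarrow> trm_val A e s = trm_val A e' s"
    using trm_val_finite_support by blast
  obtain N' where N': "\<forall>e e'. (\<forall>n<N'. e n = e' n) \<longrightarrow> trm_val A e t = trm_val A e' t"
    using trm_val_finite_support by blast
  have "satisfies A e (Eq s t) = satisfies A e' (Eq s t)" if "\<forall>n<max N N'. e n = e' n" for e e'
  proof -
    have "trm_val A e s = trm_val A e' s" "trm_val A e t = trm_val A e' t" using N N' that by auto
    then show ?thesis by simp
  qed
  then show ?case by blast
next
  case (Rel r ts)
  obtain N where "\<forall>e e'. (\<forall>n<N. e n = e' n) \<longrightarrow> map (trm_val A e) ts = map (trm_val A e') ts"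
    using map_finite_support[of ts "trm_val A", OF trm_val_finite_support] ..
  then show ?case unfolding satisfies.simps by metis
next
  case (Neg \<phi>)
  then show ?case by simp
next
  case (Conj \<phi> \<psi>)
  then obtain N N' where N: "\<forall>e e'. (\<forall>n<N. e n = e' n) \<longrightarrow> satisfies A e \<phi> = satisfies A e' \<phi>"
    "\<forall>e e'. (\<forall>n<N'. e n = e' n) \<longrightarrow> satisfies A e \<psi> = satisfies A e' \<psi>" by blast
  have "satisfies A e (Conj \<phi> \<psi>) = satisfies A e' (Conj \<phi> \<psi>)" if "\<forall>n<max N N'. e n = e' n" for e e'
  proof -
    have "satisfies A e \<phi> = satisfies A e' \<phi>" "satisfies A e \<psi> = satisfies A e' \<psi>" using N that by auto
    then show ?thesis by simp
  qed
  then show ?case by blast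
next
  case (Exi n \<phi>)
  then obtain N where N: "\<forall>e e'. (\<forall>n<N. e n = e' n) \<longrightarrow> satisfies A e \<phi> = satisfies A e' \<phi>" by blast
  have "satisfies A e (Exi n \<phi>) = satisfies A e' (Exi n \<phi>)" if "\<forall>n<N. e n = e' n" for e e'
  proof -
    have "satisfies A (e(n := x)) \<phi> = satisfies A (e'(n := x)) \<phi>" for x using N that by auto
    then show ?thesis by simp
  qed
  then show ?case by blast
qed

section \<open>Definability over the algebra and the criterion for elementarity\<close>

locale algebra =
  fixes A :: "('f::countable, 'r::countable, 'v::set_universe) model" and \<Theta> S \<alpha> :: 'v
  assumes regular: "regular_cardinal \<Theta>"
    and large: "Pow (elts (omega2 :: 'v)) \<prec> elts \<Theta>"
    and struct: "is_structure A"
    and dom: "dom_of A = hereditary \<Theta>"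
    and mem_symbol: "\<exists>r. \<forall>x\<in>hereditary \<Theta>. \<forall>y\<in>hereditary \<Theta>. rel_of A r [x, y] \<longleftrightarrow> x \<in> elts y"
    and S_symbol: "\<exists>c. fun_of A c [] = S"
    and \<alpha>_symbol: "\<exists>c. fun_of A c [] = \<alpha>"
    and \<alpha>_countable: "\<alpha> \<in> elts omega1"
begin

abbreviation "H \<equiv> hereditary \<Theta>"

lemmas H_trans = hereditary_trans[OF regular]
lemmas H_iff = hereditary_iff[OF regular]
lemmas H_lesspoll = hereditary_lesspoll[OF regular]
lemmas H_set_of = set_of_hereditary[OF regular]
lemmas H_vpair [simp] = vpair_hereditary[OF regular]
lemmas H_Ord = Ord_hereditary[OF regular]
lemmas H_vseq = vseq_hereditary[OF regular]

lemma H_image: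
  assumes "X \<subseteq> g ` elts d" "d \<in> H" "X \<subseteq> H"
  shows "elts (set_of X) = X" "set_of X \<in> H"
  using H_set_of[OF assms(3) lesspoll_trans1[OF subset_image_lepoll[OF assms(1)] H_lesspoll[OF assms(2)]]]
  by auto

text \<open>The notion is semantic: a HOL predicate of the environment counts if some formula agrees
  with it on all environments in \<open>H\<close>. The rules that follow decompose the HOL text of a
  predicate, so formulas are written out only in basic cases.\<close>

definition definable :: "((nat \<Rightarrow> 'v) \<Rightarrow> bool) \<Rightarrow> bool" where
  "definable P \<longleftrightarrow> (\<exists>\<phi> :: ('f, 'r) form. \<forall>e. range e \<subseteq> H \<longrightarrow> (satisfies A e \<phi> \<longleftrightarrow> P e))"

named_theorems definable

lemma definable_cong: "(\<And>e. range e \<subseteq> H \<Longrightarrow> P e \<longleftrightarrow> Q e) \<Longrightarrow> definable Q \<Longrightarrow> definable P"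
  unfolding definable_def by metis

lemma definable_eq [definable]: "definable (\<lambda>e. e i = e j)"
  unfolding definable_def by (rule exI[of _ "Eq (Var i) (Var j)"]) simp

lemma definable_mem [definable]: "definable (\<lambda>e. e i \<in> elts (e j))"
proof -
  obtain r where r: "\<forall>x\<in>H. \<forall>y\<in>H. rel_of A r [x, y] \<longleftrightarrow> x \<in> elts y" using mem_symbol by blast
  show ?thesis unfolding definable_def
    by (rule exI[of _ "Rel r [Var i, Var j]"]) (use r in \<open>simp add: image_subset_iff\<close>)
qed

lemma definable_not [definable]: "definable P \<Longrightarrow> definable (\<lambda>e. \<not> P e)"
  unfolding definable_def by (meson satisfies.simps(3))

lemma definable_conj [definable]: "definable P \<Longrightarrow> definable Q \<Longrightarrow> definable (\<lambda>e. P e \<and> Q e)"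
  unfolding definable_def by (meson satisfies.simps(4))

lemma definable_disj [definable]:
  assumes "definable P" "definable Q" shows "definable (\<lambda>e. P e \<or> Q e)"
proof (rule definable_cong)
  show "definable (\<lambda>e. \<not> (\<not> P e \<and> \<not> Q e))" by (intro definable_not definable_conj assms)
qed blast

lemma definable_imp [definable]:
  assumes "definable P" "definable Q" shows "definable (\<lambda>e. P e \<longrightarrow> Q e)"
proof (rule definable_cong)
  show "definable (\<lambda>e. \<not> P e \<or> Q e)" by (intro definable_not definable_disj assms)
qed blast

lemma definable_iff [definable]:
  assumes "definable P" "definable Q" shows "definable (\<lambda>e. P e \<longleftrightarrow> Q e)"
proof (rule definable_cong)
  show "definable (\<lambda>e. (P e \<longrightarrow> Q e) \<and> (Q e \<longrightarrow> P e))" by (intro definable_conj definable_imp assms)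
qed blast

lemma definable_True [definable]: "definable (\<lambda>e. True)"
  using definable_eq[of 0 0] by simp

text \<open>The top of the stack goes to the fresh variable \<open>N\<close>, and the entries below
  it move down by one. From \<open>N\<close> on nothing moves down, which keeps the map
  injective.\<close>

definition shift_ren :: "nat \<Rightarrow> nat \<Rightarrow> nat" where
  "shift_ren N k = (case k of 0 \<Rightarrow> N | Suc k \<Rightarrow> if k < N then k else Suc k)"

lemma inj_shift_ren: "inj (shift_ren N)"
  unfolding inj_def shift_ren_def by (auto split: nat.splits if_splits)

text \<open>Definable predicates treat the environment as a de Bruijn stack; the bound variable of the
  formula is chosen beyond all variables of its body, and the stack is shifted by renaming.\<close>

lemma shift_form:
  obtains N \<psi> where "\<And>e x. satisfies A (e(N := x)) \<psi> \<longleftrightarrow> satisfies A (case_nat x e) \<phi>"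
proof -
  obtain N where N: "\<And>e e'. (\<forall>n<N. e n = e' n) \<Longrightarrow> satisfies A e \<phi> = satisfies A e' \<phi>"
    using satisfies_finite_support[of A \<phi>] by blast
  have "satisfies A (e(N := x)) (ren_form (shift_ren N) \<phi>) \<longleftrightarrow> satisfies A (case_nat x e) \<phi>" for e x
    unfolding satisfies_ren[OF inj_shift_ren]
    by (rule N) (auto simp: shift_ren_def split: nat.splits)
  then show ?thesis using that by blast
qed

lemma definable_ex [definable]:
  assumes "definable (\<lambda>e. Q (e 0) (\<lambda>n. e (Suc n)))"
  shows "definable (\<lambda>e. \<exists>x\<in>H. Q x e)"
proof -
  obtain \<phi> where \<phi>: "\<And>e. range e \<subseteq> H \<Longrightarrow> satisfies A e \<phi> \<longleftrightarrow> Q (e 0) (\<lambda>n. e (Suc n))"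
    using assms unfolding definable_def by blast
  obtain N \<psi> where \<psi>: "\<And>e x. satisfies A (e(N := x)) \<psi> \<longleftrightarrow> satisfies A (case_nat x e) \<phi>"
    using shift_form by blast
  have "satisfies A e (Exi N \<psi>) \<longleftrightarrow> (\<exists>x\<in>H. Q x e)" if e: "range e \<subseteq> H" for e
  proof -
    have "range (case_nat x e) \<subseteq> H" if "x \<in> H" for x
      using e that by (auto simp: image_subset_iff split: nat.splits)
    then show ?thesis using \<phi>[of "case_nat _ e"] by (auto simp: dom \<psi>)
  qed
  then show ?thesis unfolding definable_def by blast
qed

lemma definable_all [definable]:
  assumes "definable (\<lambda>e. Q (e 0) (\<lambda>n. e (Suc n)))"
  shows "definable (\<lambda>e. \<forall>x\<in>H. Q x e)"
  using definable_not[OF definable_ex[of "\<lambda>x e. \<not> Q x e", OF definable_not[OF assms]]] by simp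

lemma definable_bex [definable]:
  assumes "definable (\<lambda>e. Q (e 0) (\<lambda>n. e (Suc n)))"
  shows "definable (\<lambda>e. \<exists>x\<in>elts (e i). Q x e)"
proof (rule definable_cong)
  show "definable (\<lambda>e. \<exists>x\<in>H. x \<in> elts (e i) \<and> Q x e)" by (intro definable assms)
qed (use H_trans in blast)

lemma definable_ball [definable]:
  assumes "definable (\<lambda>e. Q (e 0) (\<lambda>n. e (Suc n)))"
  shows "definable (\<lambda>e. \<forall>x\<in>elts (e i). Q x e)"
  using definable_not[OF definable_bex[of "\<lambda>x e. \<not> Q x e", OF definable_not[OF assms]]] by simp

text \<open>The criterion of Tarski and Vaught, which characterises the elementary submodels.\<close>

definition TV :: "'v set \<Rightarrow> bool" where
  "TV N \<longleftrightarrow> N \<noteq> {} \<and> N \<subseteq> H \<and> (\<forall>P e. definable P \<longrightarrow> range e \<subseteq> N \<longrightarrow>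
     (\<exists>x\<in>H. P (case_nat x e)) \<longrightarrow> (\<exists>x\<in>N. P (case_nat x e)))"

lemma elementary_imp_TV:
  assumes N: "elementary_submodel N A"
  shows "TV N"
proof -
  have el: "\<And>e \<phi>. range e \<subseteq> N \<Longrightarrow> satisfies (A\<lparr>dom_of := N\<rparr>) e \<phi> \<longleftrightarrow> satisfies A e \<phi>"
    and NH: "N \<subseteq> H" and ne: "N \<noteq> {}"
    using N unfolding elementary_submodel_def is_structure_def dom by auto
  have "\<exists>x\<in>N. P (case_nat x e)"
    if P: "definable P" and e: "range e \<subseteq> N" and ex: "\<exists>x\<in>H. P (case_nat x e)" for P e
  proof -
    obtain \<phi> where \<phi>: "\<And>e. range e \<subseteq> H \<Longrightarrow> satisfies A e \<phi> \<longleftrightarrow> P e" using P unfolding definable_def by blast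
    obtain n \<psi> where \<psi>: "\<And>e x. satisfies A (e(n := x)) \<psi> \<longleftrightarrow> satisfies A (case_nat x e) \<phi>"
      using shift_form by blast
    have r: "range (case_nat x e) \<subseteq> H" if "x \<in> H" for x
      using e NH that by (auto simp: image_subset_iff subset_iff split: nat.splits)
    then have "satisfies A e (Exi n \<psi>)" using ex \<phi> by (auto simp: dom \<psi>)
    then have "satisfies (A\<lparr>dom_of := N\<rparr>) e (Exi n \<psi>)" using el[OF e] by blast
    then obtain x where x: "x \<in> N" "satisfies (A\<lparr>dom_of := N\<rparr>) (e(n := x)) \<psi>" by auto
    moreover have "range (e(n := x)) \<subseteq> N" using e x(1) by auto
    ultimately have "satisfies A (case_nat x e) \<phi>" using el \<psi> by blast
    then show ?thesis using \<phi> r x(1) NH by blast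
  qed
  then show ?thesis unfolding TV_def using ne NH by blast
qed

text \<open>The default is a member of \<open>N\<close>, so that the environment stays in
  \<open>N\<close> beyond the listed parameters.\<close>

definition penv :: "'v set \<Rightarrow> 'v list \<Rightarrow> nat \<Rightarrow> 'v" where
  "penv N ps n = (if n < length ps then ps ! n else (SOME x. x \<in> N))"

lemma penv_simps [simp]: "penv N (a # ps) 0 = a" "penv N (a # ps) (Suc n) = penv N ps n"
  unfolding penv_def by auto

text \<open>The form in which elementarity is applied: a witness known in \<open>H\<close> is moved
  into \<open>N\<close>. In \<open>Q\<close> the witness is at the top of the stack and the
  parameters \<open>ps\<close> follow.\<close>

lemma TV_ex:
  assumes N: "TV N" and Q: "definable (\<lambda>e. Q (e 0) (\<lambda>n. e (Suc n)))" and ps: "set ps \<subseteq> N"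
    and x: "x \<in> H" "Q x (penv N ps)"
  shows "\<exists>x\<in>N. Q x (penv N ps)"
proof -
  have "N \<noteq> {}" using N unfolding TV_def by blast
  then have "range (penv N ps) \<subseteq> N" using ps unfolding penv_def by (auto simp: some_in_eq subset_iff)
  then show ?thesis
    using N Q x unfolding TV_def
    by (auto dest!: spec[of _ "\<lambda>e. Q (e 0) (\<lambda>n. e (Suc n))"] spec[of _ "penv N ps"])
qed

lemma trm_val_dom_update: "trm_val (A\<lparr>dom_of := N\<rparr>) e t = trm_val A e t"
  by (induction t) (auto intro!: arg_cong[of _ _ "fun_of A _"])

lemma TV_imp_elementary:
  assumes N: "TV N"
  shows "elementary_submodel N A"
proof -
  have NH: "N \<subseteq> H" and ne: "N \<noteq> {}" using N unfolding TV_def by auto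
  have "fun_of A g xs \<in> N" if xs: "xs \<in> lists N" for g xs
  proof -
    define n where "n = length xs"
    \<comment> \<open>Closure under the functions of the algebra is a case of the criterion: the
      value is the only witness of an equation with parameters \<open>xs\<close>.\<close>
    have "definable (\<lambda>e. e 0 = fun_of A g (map (\<lambda>k. e (Suc k)) [0..<n]))" unfolding definable_def
      by (rule exI[of _ "Eq (Var 0) (App g (map (\<lambda>k. Var (Suc k)) [0..<n]))"]) (simp add: comp_def)
    moreover have "map (penv N xs) [0..<n] = xs"
      unfolding n_def by (rule nth_equalityI) (simp_all add: penv_def)
    moreover have "fun_of A g xs \<in> H" using struct xs NH lists_mono[OF NH] unfolding is_structure_def dom by blast
    ultimately have "\<exists>x\<in>N. x = fun_of A g (map (penv N xs) [0..<n])"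
      using xs by (intro TV_ex[OF N, where x = "fun_of A g xs"]) (auto simp only: in_lists_conv_set)
    then show ?thesis using \<open>map (penv N xs) [0..<n] = xs\<close> by simp
  qed
  then have str: "is_structure (A\<lparr>dom_of := N\<rparr>)" unfolding is_structure_def using ne by simp
  have "satisfies (A\<lparr>dom_of := N\<rparr>) e \<phi> \<longleftrightarrow> satisfies A e \<phi>" if "range e \<subseteq> N" for e \<phi>
    using that
  proof (induction \<phi> arbitrary: e)
    case (Rel r ts)
    have "trm_val (A\<lparr>dom_of := N\<rparr>) e = trm_val A e" using trm_val_dom_update by blast
    then show ?case by simp
  next
    case (Exi n \<phi>)
    \<comment> \<open>The bound variable \<open>n\<close> is moved to the top of the stack and all
      others up by one, which is the shape the criterion asks for.\<close>
    define \<rho> where "\<rho> k = (if k = n then 0 else Suc k)" for k :: nat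
    have "inj \<rho>" unfolding inj_def \<rho>_def by auto
    then have "definable (\<lambda>e. satisfies A (e \<circ> \<rho>) \<phi>)"
      unfolding definable_def using satisfies_ren[of \<rho> A] by blast
    moreover have "case_nat x e \<circ> \<rho> = e(n := x)" for x by (auto simp: \<rho>_def fun_eq_iff)
    ultimately have "(\<exists>x\<in>H. satisfies A (e(n := x)) \<phi>) \<longrightarrow> (\<exists>x\<in>N. satisfies A (e(n := x)) \<phi>)"
      using N Exi.prems unfolding TV_def by (metis (no_types, lifting))
    moreover have "range (e(n := x)) \<subseteq> N" if "x \<in> N" for x using Exi.prems that by auto
    ultimately have "satisfies (A\<lparr>dom_of := N\<rparr>) (e(n := x)) \<phi> \<longleftrightarrow> satisfies A (e(n := x)) \<phi>"
      if "x \<in> N" for x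
      using Exi.IH that by blast
    then show ?case
      using \<open>(\<exists>x\<in>H. satisfies A (e(n := x)) \<phi>) \<longrightarrow> (\<exists>x\<in>N. satisfies A (e(n := x)) \<phi>)\<close> NH
      unfolding satisfies.simps dom by (auto simp del: fun_upd_apply)
  qed (simp_all add: trm_val_dom_update)
  then show ?thesis unfolding elementary_submodel_def dom using NH str by blast
qed

end

section \<open>Definability of set-theoretic notions\<close>

text \<open>Only single-valuedness is asked. Domains are arbitrary, and members that are not pairs
  are allowed.\<close>

definition isfun :: "'v::set_universe \<Rightarrow> bool" where
  "isfun f \<longleftrightarrow> (\<forall>x y z. vpair x y \<in> elts f \<longrightarrow> vpair x z \<in> elts f \<longrightarrow> y = z)"

definition seq_restrict :: "'v::set_universe \<Rightarrow> 'v \<Rightarrow> 'v" where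
  "seq_restrict x l = set_of {p \<in> elts x. \<exists>k\<in>elts l. \<exists>m. p = vpair k m}"

text \<open>The next condition on \<open>N\<close> and \<open>N'\<close> is first order over \<open>H(\<Theta>)\<close>, whereas elementarity in the
  algebra is not; it implies that \<open>N'\<close> is elementary if \<open>N\<close> is.\<close>

definition extends :: "'v::set_universe set \<Rightarrow> 'v set \<Rightarrow> bool" where
  "extends N N' \<longleftrightarrow> N \<subseteq> N' \<and> (\<forall>x\<in>N'. \<exists>d\<in>N. x \<in> elts d) \<and> (\<forall>x\<in>N'. \<forall>y\<in>N'. vpair x y \<in> N') \<and>
     (\<forall>f\<in>N. isfun f \<longrightarrow> (\<forall>x\<in>N'. \<forall>y. vpair x y \<in> elts f \<longrightarrow> y \<in> N'))"

lemma elts_seq_restrict: "elts (seq_restrict x l) = {p \<in> elts x. \<exists>k\<in>elts l. \<exists>m. p = vpair k m}"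
  for x :: "'v::set_universe"
  unfolding seq_restrict_def by (rule elts_set_of_subset[of _ x]) auto

lemma seq_restrict_vseq:
  fixes l :: "'v::set_universe"
  assumes "elts l \<subseteq> elts j"
  shows "seq_restrict (vseq j M) l = vseq l M"
  by (rule extensionality) (use assms in \<open>auto simp: elts_seq_restrict elts_vseq\<close>)

lemma isfun_vseq: "isfun (vseq j M)" for j :: "'v::set_universe"
  unfolding isfun_def by simp

lemma countable_omega: "countable (elts (omega :: 'v::set_universe))"
proof (rule countableI)
  show "inj_on (\<lambda>a. card (elts a)) (elts (omega :: 'v))"
  proof (rule inj_onI)
    fix a b :: 'v
    assume ab: "a \<in> elts omega" "b \<in> elts omega" and eq: "card (elts a) = card (elts b)"
    have less: "card (elts c) < card (elts d)" if "c \<in> elts d" "Ord d" "finite (elts d)" for c d :: 'v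
      using that Ord_subset[of d c] mem_irrefl[of c] by (intro psubset_card_mono) auto
    show "a = b"
      using Ord_linear[of a b] less[of a b] less[of b a] ab eq unfolding elts_omega by auto
  qed
qed

lemma countable_iff_lepoll_omega: "countable X \<longleftrightarrow> X \<lesssim> elts (omega :: 'v::set_universe)"
proof
  assume "countable X"
  then have "X \<lesssim> (UNIV :: nat set)" unfolding countable_def lepoll_def by blast
  then show "X \<lesssim> elts (omega :: 'v)"
    using lepoll_trans infinite_omega infinite_le_lepoll by blast
qed (rule countable_lepoll[OF countable_omega])

lemma omega_unique:
  assumes "limit_ordinal d" "\<And>x. x \<in> elts d \<Longrightarrow> \<not> limit_ordinal x"
  shows "d = (omega :: 'v::set_universe)"
proof -
  have "Ord d" using assms(1) unfolding limit_ordinal_def by blast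
  moreover have "omega \<notin> elts d" using assms(2) limit_omega by blast
  moreover have "d \<notin> elts omega" using limit_infinite[OF assms(1)] unfolding elts_omega by blast
  ultimately show ?thesis using Ord_linear Ord_omega by blast
qed

lemma omega_no_limit: "x \<in> elts omega \<Longrightarrow> \<not> limit_ordinal x" for x :: "'v::set_universe"
  using limit_infinite unfolding elts_omega by blast

lemma omega_in_omega1: "omega \<in> elts (omega1 :: 'v::set_universe)"
  unfolding elts_omega1 using Ord_omega countable_omega by blast

context algebra begin

lemma lepoll_omega2_lesspoll: "X \<lesssim> elts (omega2 :: 'v) \<Longrightarrow> X \<prec> elts \<Theta>"
  by (rule lesspoll_trans1[OF _ lesspoll_trans[OF lesspoll_Pow_self large]])

lemma omega2_H: "omega2 \<in> H"
  by (rule H_Ord[OF Ord_omega2 lepoll_omega2_lesspoll]) simp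

lemma omega1_H: "omega1 \<in> H" using omega2_H H_trans omega1_in_omega2 by blast

lemma omega_H: "omega \<in> H" using omega1_H H_trans omega_in_omega1 by blast

lemma countable_lesspoll_\<Theta>: "countable X \<Longrightarrow> X \<prec> elts \<Theta>"
  using lepoll_omega2_lesspoll uncountable_lepoll[OF _ , of "elts (omega2 :: 'v)" X]
    countable_subset[OF omega1_subset_omega2] uncountable_omega1 by blast

lemma countable_set_of_H: "countable X \<Longrightarrow> X \<subseteq> H \<Longrightarrow> set_of X \<in> H"
  by (rule H_set_of(2)[OF _ countable_lesspoll_\<Theta>])

lemma S_H: "S \<in> H" and \<alpha>_H: "\<alpha> \<in> H"
  using S_symbol \<alpha>_symbol struct unfolding is_structure_def dom by (metis lists.Nil)+

lemma envH: "range e \<subseteq> H \<Longrightarrow> e i \<in> H"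
  by blast

lemma definable_subset [definable]: "definable (\<lambda>e. elts (e i) \<subseteq> elts (e j))"
  unfolding subset_eq by (intro definable)

lemma definable_empty [definable]: "definable (\<lambda>e. elts (e i) = {})"
proof (rule definable_cong)
  show "definable (\<lambda>e. \<forall>x\<in>elts (e i). \<not> True)" by (intro definable)
qed auto

lemma definable_doubleton: "definable (\<lambda>e. e i = set_of {e j, e k})"
proof (rule definable_cong)
  show "definable (\<lambda>e. e j \<in> elts (e i) \<and> e k \<in> elts (e i) \<and> (\<forall>z\<in>elts (e i). z = e j \<or> z = e k))"
    by (intro definable)
  fix e :: "nat \<Rightarrow> 'v"
  have "e i = set_of {e j, e k} \<longleftrightarrow> elts (e i) = {e j, e k}"
    using elts_set_of_pair extensionality by metis
  then show "e i = set_of {e j, e k} \<longleftrightarrow> e j \<in> elts (e i) \<and> e k \<in> elts (e i) \<and> (\<forall>z\<in>elts (e i). z = e j \<or> z = e k)"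
    by blast
qed

lemma doubleton_H: "x \<in> H \<Longrightarrow> y \<in> H \<Longrightarrow> set_of {x, y} \<in> H"
  by (intro countable_set_of_H) auto

lemma definable_vpair [definable]: "definable (\<lambda>e. e i = vpair (e j) (e k))"
proof (rule definable_cong)
  show "definable (\<lambda>e. \<exists>u\<in>H. \<exists>v\<in>H. u = set_of {e j, e j} \<and> v = set_of {e j, e k} \<and> e i = set_of {u, v})"
    by (intro definable definable_doubleton)
  fix e :: "nat \<Rightarrow> 'v" assume "range e \<subseteq> H"
  then have "set_of {e j, e j} \<in> H" "set_of {e j, e k} \<in> H" using doubleton_H by blast+
  then show "e i = vpair (e j) (e k) \<longleftrightarrow>
      (\<exists>u\<in>H. \<exists>v\<in>H. u = set_of {e j, e j} \<and> v = set_of {e j, e k} \<and> e i = set_of {u, v})"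
    unfolding vpair_def by simp
qed

lemma definable_vpair_mem [definable]: "definable (\<lambda>e. vpair (e i) (e j) \<in> elts (e k))"
proof (rule definable_cong)
  show "definable (\<lambda>e. \<exists>p\<in>elts (e k). p = vpair (e i) (e j))" by (intro definable)
qed blast

lemma isfun_H_iff: "f \<in> H \<Longrightarrow>
    isfun f \<longleftrightarrow> (\<forall>x\<in>H. \<forall>y\<in>H. \<forall>z\<in>H. vpair x y \<in> elts f \<longrightarrow> vpair x z \<in> elts f \<longrightarrow> y = z)"
  unfolding isfun_def using H_trans H_vpair by blast

lemma definable_isfun [definable]: "definable (\<lambda>e. isfun (e i))"
proof (rule definable_cong)
  show "definable (\<lambda>e. \<forall>x\<in>H. \<forall>y\<in>H. \<forall>z\<in>H. vpair x y \<in> elts (e i) \<longrightarrow> vpair x z \<in> elts (e i) \<longrightarrow> y = z)"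
    by (intro definable)
qed (simp add: isfun_H_iff[OF envH])

lemma definable_transitive [definable]: "definable (\<lambda>e. transitive_set (e i))"
  unfolding transitive_set_def by (intro definable)

lemma definable_Ord [definable]: "definable (\<lambda>e. Ord (e i))"
  unfolding Ord_def by (intro definable)

lemma definable_vsucc [definable]: "definable (\<lambda>e. e i = vsucc (e j))"
proof (rule definable_cong)
  show "definable (\<lambda>e. e j \<in> elts (e i) \<and> elts (e j) \<subseteq> elts (e i) \<and> (\<forall>z\<in>elts (e i). z = e j \<or> z \<in> elts (e j)))"
    by (intro definable)
  fix e :: "nat \<Rightarrow> 'v"
  have "e i = vsucc (e j) \<longleftrightarrow> elts (e i) = insert (e j) (elts (e j))"
    using elts_vsucc extensionality by metis
  then show "e i = vsucc (e j) \<longleftrightarrow> e j \<in> elts (e i) \<and> elts (e j) \<subseteq> elts (e i) \<and> (\<forall>z\<in>elts (e i). z = e j \<or> z \<in> elts (e j))"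
    by blast
qed

lemma definable_limit [definable]: "definable (\<lambda>e. limit_ordinal (e i))"
proof (rule definable_cong)
  show "definable (\<lambda>e. Ord (e i) \<and> \<not> elts (e i) = {} \<and> (\<forall>x\<in>elts (e i). \<exists>y\<in>elts (e i). y = vsucc x))"
    by (intro definable)
qed (simp add: limit_ordinal_def)

lemma successor_ordinal_iff: "successor_ordinal j \<longleftrightarrow> (\<exists>i\<in>elts j. Ord i \<and> j = vsucc i)" for j :: 'v
  unfolding successor_ordinal_def using elts_vsucc by blast

lemma definable_successor [definable]: "definable (\<lambda>e. successor_ordinal (e i))"
  unfolding successor_ordinal_iff by (intro definable)

text \<open>The injection is coded by its inverse, a function from part of \<open>k\<close> onto
  \<open>m\<close>. A model that contains \<open>g\<close> and all members of \<open>k\<close> then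
  contains all members of \<open>m\<close>, as its values.\<close>

lemma lepoll_code:
  assumes "m \<in> H" "k \<in> H"
  shows "elts m \<lesssim> elts k \<longleftrightarrow> (\<exists>g\<in>H. isfun g \<and> (\<forall>y\<in>elts m. \<exists>n\<in>elts k. vpair n y \<in> elts g))"
proof
  assume "elts m \<lesssim> elts k"
  then obtain f where f: "inj_on f (elts m)" "f ` elts m \<subseteq> elts k" unfolding lepoll_def by blast
  let ?X = "(\<lambda>y. vpair (f y) y) ` elts m"
  have "?X \<subseteq> H" using f(2) assms H_trans by auto
  note g = H_image[OF subset_refl assms(1) this]
  have "isfun (set_of ?X)" unfolding isfun_def g using f(1) by (auto dest: inj_onD)
  moreover have "\<exists>n\<in>elts k. vpair n y \<in> elts (set_of ?X)" if "y \<in> elts m" for y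
    using that f(2) unfolding g by auto
  ultimately show "\<exists>g\<in>H. isfun g \<and> (\<forall>y\<in>elts m. \<exists>n\<in>elts k. vpair n y \<in> elts g)" using g(2) by blast
next
  assume "\<exists>g\<in>H. isfun g \<and> (\<forall>y\<in>elts m. \<exists>n\<in>elts k. vpair n y \<in> elts g)"
  then obtain g where g: "isfun g" "\<And>y. y \<in> elts m \<Longrightarrow> \<exists>n\<in>elts k. vpair n y \<in> elts g" by blast
  have "elts m \<subseteq> (\<lambda>n. THE y. vpair n y \<in> elts g) ` elts k"
  proof
    fix y assume "y \<in> elts m"
    then obtain n where n: "n \<in> elts k" "vpair n y \<in> elts g" using g(2) by blast
    then have "(THE y. vpair n y \<in> elts g) = y" using g(1) unfolding isfun_def by (intro the_equality) auto
    then show "y \<in> (\<lambda>n. THE y. vpair n y \<in> elts g) ` elts k" by (intro image_eqI[OF _ n(1)]) simp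
  qed
  then show "elts m \<lesssim> elts k" by (rule subset_image_lepoll)
qed

lemma definable_lepoll [definable]: "definable (\<lambda>e. elts (e i) \<lesssim> elts (e j))"
proof (rule definable_cong)
  show "definable (\<lambda>e. \<exists>g\<in>H. isfun g \<and> (\<forall>y\<in>elts (e i). \<exists>n\<in>elts (e j). vpair n y \<in> elts g))"
    by (intro definable)
qed (simp add: lepoll_code[OF envH envH])

section \<open>Definable constants\<close>

definition definable_const :: "'v \<Rightarrow> bool" where "definable_const c \<longleftrightarrow> c \<in> H \<and> (\<forall>i. definable (\<lambda>e. e i = c))"

lemma definable_eq_const [definable]: "definable_const c \<Longrightarrow> definable (\<lambda>e. e i = c)"
  unfolding definable_const_def by blast

lemma definable_subst_const:
  assumes "definable_const c" "definable (\<lambda>e. Q (e 0) (\<lambda>n. e (Suc n)))"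
  shows "definable (\<lambda>e. Q c e)"
proof (rule definable_cong)
  show "definable (\<lambda>e. \<exists>x\<in>H. x = c \<and> Q x e)" using assms by (intro definable)
qed (use assms in \<open>auto simp: definable_const_def\<close>)

lemma definable_mem_const [definable]: "definable_const c \<Longrightarrow> definable (\<lambda>e. e i \<in> elts c)"
  by (rule definable_subst_const[of c "\<lambda>x e. e i \<in> elts x"], assumption, intro definable)

lemma definable_bex_const [definable]:
  assumes "definable_const c" "definable (\<lambda>e. Q (e 0) (\<lambda>n. e (Suc n)))"
  shows "definable (\<lambda>e. \<exists>x\<in>elts c. Q x e)"
proof (rule definable_cong)
  show "definable (\<lambda>e. \<exists>x\<in>H. x \<in> elts c \<and> Q x e)" using assms by (intro definable)
qed (use assms H_trans in \<open>auto simp: definable_const_def\<close>)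

lemma definable_ball_const [definable]:
  assumes "definable_const c" "definable (\<lambda>e. Q (e 0) (\<lambda>n. e (Suc n)))"
  shows "definable (\<lambda>e. \<forall>x\<in>elts c. Q x e)"
proof (rule definable_cong)
  show "definable (\<lambda>e. \<forall>x\<in>H. x \<in> elts c \<longrightarrow> Q x e)" using assms by (intro definable)
qed (use assms H_trans in \<open>auto simp: definable_const_def\<close>)

lemma definable_const_S [definable]: "definable_const S"
proof -
  obtain c where c: "fun_of A c [] = S" using S_symbol by blast
  then have "definable (\<lambda>e. e i = S)" for i
    unfolding definable_def by (intro exI[of _ "Eq (Var i) (App c [])"]) simp
  then show ?thesis unfolding definable_const_def using S_H by blast
qed

lemma definable_const_\<alpha> [definable]: "definable_const \<alpha>"
proof -
  obtain c where c: "fun_of A c [] = \<alpha>" using \<alpha>_symbol by blast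
  then have "definable (\<lambda>e. e i = \<alpha>)" for i
    unfolding definable_def by (intro exI[of _ "Eq (Var i) (App c [])"]) simp
  then show ?thesis unfolding definable_const_def using \<alpha>_H by blast
qed

lemma definable_const_omega [definable]: "definable_const omega"
proof -
  have "definable (\<lambda>e. e i = omega)" for i
  proof (rule definable_cong)
    show "definable (\<lambda>e. limit_ordinal (e i) \<and> (\<forall>x\<in>elts (e i). \<not> limit_ordinal x))" by (intro definable)
  qed (use omega_unique limit_omega omega_no_limit in metis)
  then show ?thesis unfolding definable_const_def using omega_H by blast
qed

lemma definable_countable [definable]: "definable (\<lambda>e. countable (elts (e i)))"
  unfolding countable_iff_lepoll_omega[where 'v='v]
  by (rule definable_subst_const[of omega "\<lambda>x e. elts (e i) \<lesssim> elts x"]) (intro definable)+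

lemma eq_iff_H: "c \<in> H \<Longrightarrow> d \<in> H \<Longrightarrow> c = d \<longleftrightarrow> (\<forall>y\<in>H. y \<in> elts c \<longleftrightarrow> y \<in> elts d)"
  by (metis H_trans extensionality set_eqI)

lemma definable_const_by_elements:
  assumes c: "c \<in> H" and P: "\<And>y. y \<in> elts c \<longleftrightarrow> P y" "definable (\<lambda>e. P (e 0))"
  shows "definable_const c"
proof -
  have "definable (\<lambda>e. e i = c)" for i
  proof (rule definable_cong)
    show "definable (\<lambda>e. \<forall>y\<in>H. y \<in> elts (e i) \<longleftrightarrow> P y)" using P(2) by (intro definable)
  qed (simp add: eq_iff_H[OF envH c] P(1))
  then show ?thesis unfolding definable_const_def using c by blast
qed

lemma definable_const_omega1 [definable]: "definable_const omega1"
  by (rule definable_const_by_elements[OF omega1_H, of "\<lambda>y. Ord y \<and> countable (elts y)"])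
    (simp add: elts_omega1, intro definable)

lemma definable_const_omega2 [definable]: "definable_const omega2"
proof (rule definable_const_by_elements[OF omega2_H, of "\<lambda>y. Ord y \<and> elts y \<lesssim> elts (omega1 :: 'v)"])
  have "definable (\<lambda>e. elts (e 0) \<lesssim> elts (omega1 :: 'v))"
    by (rule definable_subst_const[of omega1 "\<lambda>x e. elts (e 0) \<lesssim> elts x"]) (intro definable)+
  then show "definable (\<lambda>e. Ord (e 0) \<and> elts (e 0) \<lesssim> elts (omega1 :: 'v))" by (intro definable)
qed (simp add: elts_omega2)

lemma definable_seq_restrict [definable]: "definable (\<lambda>e. e i = seq_restrict (e j) (e k))"
proof (rule definable_cong)
  show "definable (\<lambda>e. \<forall>p\<in>H. p \<in> elts (e i) \<longleftrightarrow> p \<in> elts (e j) \<and> (\<exists>l\<in>elts (e k). \<exists>m\<in>H. p = vpair l m))"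
    by (intro definable)
  fix e :: "nat \<Rightarrow> 'v" assume e: "range e \<subseteq> H"
  have "elts (seq_restrict (e j) (e k)) \<subseteq> elts (e j)" unfolding elts_seq_restrict by blast
  then have "seq_restrict (e j) (e k) \<in> H" using H_iff[of "e j"] envH[OF e, of j]
      H_iff[of "seq_restrict (e j) (e k)"] lesspoll_trans1[OF subset_imp_lepoll] by blast
  then show "e i = seq_restrict (e j) (e k) \<longleftrightarrow>
      (\<forall>p\<in>H. p \<in> elts (e i) \<longleftrightarrow> p \<in> elts (e j) \<and> (\<exists>l\<in>elts (e k). \<exists>m\<in>H. p = vpair l m))"
    using eq_iff_H[OF envH[OF e]] by (auto simp: elts_seq_restrict)
qed

lemma vsup_omega2: "elts (vsup (X \<inter> elts omega2)) = (\<Union>b\<in>X \<inter> elts omega2. elts b)" for X :: "'v set"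
  using elts_vsup_subset[of "X \<inter> elts omega2" omega2] by simp

text \<open>Equality of the supremum with a member \<open>s\<close> of \<open>S\<close> is tested on
  the members of \<open>s\<close>, so it suffices to quantify over \<open>s\<close>.\<close>

lemma definable_sup_mem_S [definable]: "definable (\<lambda>e. vsup (elts (e i) \<inter> elts omega2) \<in> elts S)"
proof (rule definable_cong)
  show "definable (\<lambda>e. \<exists>s\<in>elts S. \<forall>z\<in>H. z \<in> elts s \<longleftrightarrow> (\<exists>b\<in>elts (e i). b \<in> elts omega2 \<and> z \<in> elts b))"
    by (intro definable)
  fix e :: "nat \<Rightarrow> 'v" assume e: "range e \<subseteq> H"
  let ?s = "vsup (elts (e i) \<inter> elts omega2)"
  have z: "z \<in> elts ?s \<longleftrightarrow> (\<exists>b\<in>elts (e i). b \<in> elts omega2 \<and> z \<in> elts b)" for z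
    unfolding vsup_omega2 by blast
  have "s = ?s \<longleftrightarrow> (\<forall>z\<in>H. z \<in> elts s \<longleftrightarrow> (\<exists>b\<in>elts (e i). b \<in> elts omega2 \<and> z \<in> elts b))"
    if s: "s \<in> elts S" for s
  proof
    assume *: "\<forall>z\<in>H. z \<in> elts s \<longleftrightarrow> (\<exists>b\<in>elts (e i). b \<in> elts omega2 \<and> z \<in> elts b)"
    show "s = ?s"
    proof (rule extensionality, rule set_eqI)
      fix x
      show "x \<in> elts s \<longleftrightarrow> x \<in> elts ?s"
        unfolding z using * H_trans[OF H_trans[OF S_H s]] H_trans[OF H_trans[OF envH[OF e]]] by metis
    qed
  qed (simp add: z)
  then show "?s \<in> elts S \<longleftrightarrow>
      (\<exists>s\<in>elts S. \<forall>z\<in>H. z \<in> elts s \<longleftrightarrow> (\<exists>b\<in>elts (e i). b \<in> elts omega2 \<and> z \<in> elts b))"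
    by blast
qed

lemma definable_extends [definable]: "definable (\<lambda>e. extends (elts (e i)) (elts (e j)))"
proof (rule definable_cong)
  show "definable (\<lambda>e. elts (e i) \<subseteq> elts (e j) \<and> (\<forall>x\<in>elts (e j). \<exists>d\<in>elts (e i). x \<in> elts d) \<and>
      (\<forall>x\<in>elts (e j). \<forall>y\<in>elts (e j). \<exists>p\<in>elts (e j). p = vpair x y) \<and>
      (\<forall>f\<in>elts (e i). isfun f \<longrightarrow> (\<forall>x\<in>elts (e j). \<forall>y\<in>H. vpair x y \<in> elts f \<longrightarrow> y \<in> elts (e j))))"
    by (intro definable)
  fix e :: "nat \<Rightarrow> 'v" assume e: "range e \<subseteq> H"
  have "y \<in> H" if "f \<in> elts (e i)" "vpair x y \<in> elts f" for f x y
    using H_trans[OF H_trans[OF envH[OF e] that(1)] that(2)] by simp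
  then show "extends (elts (e i)) (elts (e j)) \<longleftrightarrow>
     elts (e i) \<subseteq> elts (e j) \<and> (\<forall>x\<in>elts (e j). \<exists>d\<in>elts (e i). x \<in> elts d) \<and>
      (\<forall>x\<in>elts (e j). \<forall>y\<in>elts (e j). \<exists>p\<in>elts (e j). p = vpair x y) \<and>
      (\<forall>f\<in>elts (e i). isfun f \<longrightarrow> (\<forall>x\<in>elts (e j). \<forall>y\<in>H. vpair x y \<in> elts f \<longrightarrow> y \<in> elts (e j)))"
    unfolding extends_def by blast
qed

end

section \<open>Extensions of elementary submodels\<close>

definition hull :: "'v::set_universe set \<Rightarrow> 'v \<Rightarrow> 'v set" where
  "hull N \<eta> = {y. \<exists>f\<in>N. isfun f \<and> vpair \<eta> y \<in> elts f}"

text \<open>Partial functions are taken because cutting any function down to arguments below omega_2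
  and values below omega_1 yields one of these.\<close>

definition small_pfun :: "'v::set_universe \<Rightarrow> bool" where
  "small_pfun f \<longleftrightarrow> isfun f \<and> (\<forall>p\<in>elts f. \<exists>a\<in>elts omega2. \<exists>b\<in>elts omega1. p = vpair a b)"

lemma extends_subset: "extends N N' \<Longrightarrow> N \<subseteq> N'"
  unfolding extends_def by blast

lemma hull_mono: "N \<subseteq> N' \<Longrightarrow> hull N \<eta> \<subseteq> hull N' \<eta>"
  unfolding hull_def by blast

lemma hull_UN: "hull (\<Union>i\<in>I. N i) \<eta> = (\<Union>i\<in>I. hull (N i) \<eta>)"
  unfolding hull_def by blast

lemma countable_hull:
  assumes "countable N" shows "countable (hull N \<eta>)"
proof -
  have "hull N \<eta> \<subseteq> (\<lambda>f. THE y. vpair \<eta> y \<in> elts f) ` N"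
  proof
    fix y assume "y \<in> hull N \<eta>"
    then obtain f where f: "f \<in> N" "isfun f" "vpair \<eta> y \<in> elts f" unfolding hull_def by blast
    then have "(THE y. vpair \<eta> y \<in> elts f) = y" unfolding isfun_def by (intro the_equality) auto
    then show "y \<in> (\<lambda>f. THE y. vpair \<eta> y \<in> elts f) ` N" by (intro image_eqI[OF _ f(1)]) simp
  qed
  then show ?thesis using assms countable_image countable_subset by blast
qed

context algebra begin

section \<open>Closure properties of elementary submodels\<close>

lemma TV_H: "TV N \<Longrightarrow> x \<in> N \<Longrightarrow> x \<in> H"
  unfolding TV_def by blast

text \<open>By extensionality \<open>y\<close> is the only witness of the formula describing its
  members. The parameters start at index 2 because index 0 holds the member \<open>p\<close> and
  index 1 the set being described.\<close>

lemma TV_set: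
  assumes N: "TV N" and ps: "set ps \<subseteq> N"
    and P: "definable (\<lambda>e. P (e 0) (\<lambda>n. e (Suc (Suc n))))"
    and y: "y \<in> H" "\<And>p. p \<in> H \<Longrightarrow> p \<in> elts y \<longleftrightarrow> P p (penv N ps)"
  shows "y \<in> N"
proof -
  have "\<exists>x\<in>N. \<forall>p\<in>H. p \<in> elts x \<longleftrightarrow> P p (penv N ps)"
    by (rule TV_ex[OF N, of "\<lambda>x e. \<forall>p\<in>H. p \<in> elts x \<longleftrightarrow> P p e"])
      (use ps y in \<open>auto intro!: definable P\<close>)
  then obtain x where x: "x \<in> N" "\<forall>p\<in>H. p \<in> elts x \<longleftrightarrow> P p (penv N ps)" by blast
  then have "x = y" using eq_iff_H[OF TV_H[OF N x(1)] y(1)] y(2) by blast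
  then show ?thesis using x(1) by blast
qed

lemma TV_const: "TV N \<Longrightarrow> definable_const c \<Longrightarrow> c \<in> N"
  using TV_ex[of N "\<lambda>x e. x = c" "[]" c] unfolding definable_const_def by auto

lemmas TV_omega2 = TV_const[OF _ definable_const_omega2]
lemmas TV_\<alpha> = TV_const[OF _ definable_const_\<alpha>]

lemma TV_vpair:
  assumes "TV N" "x \<in> N" "y \<in> N" shows "vpair x y \<in> N"
proof -
  have "\<exists>p\<in>N. p = vpair (penv N [x, y] 0) (penv N [x, y] (Suc 0))"
    by (rule TV_ex[of N "\<lambda>p e. p = vpair (e 0) (e (Suc 0))" "[x, y]" "vpair x y"])
      (use assms TV_H in \<open>auto intro: definable\<close>)
  then show ?thesis by simp
qed

lemma TV_singleton:
  assumes "TV N" "x \<in> N" shows "set_of {x} \<in> N"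
proof -
  have "set_of {x} \<in> H" using doubleton_H[of x x] TV_H assms by simp
  then have "\<exists>p\<in>N. p = set_of {penv N [x] 0, penv N [x] 0}"
    by (intro TV_ex[of N "\<lambda>p e. p = set_of {e 0, e 0}" "[x]" "set_of {x}"])
      (use assms definable_doubleton[of 0 "Suc 0" "Suc 0"] in auto)
  then show ?thesis by simp
qed

lemma TV_vsucc:
  assumes N: "TV N" and x: "x \<in> N" shows "vsucc x \<in> N"
proof -
  have xH: "x \<in> H" using N x TV_H by blast
  then have "vsucc x \<in> H" using H_iff[of "vsucc x"] H_iff[of x] elts_vsucc[of x]
      insert_lesspoll_regular[OF regular, of "elts x" x] by simp
  then have "\<exists>p\<in>N. p = vsucc (penv N [x] 0)"
    by (intro TV_ex[of N "\<lambda>p e. p = vsucc (e 0)" "[x]" "vsucc x"])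
      (use N x in \<open>auto intro: definable\<close>)
  then show ?thesis by simp
qed

lemma TV_apply:
  assumes N: "TV N" and f: "f \<in> N" "isfun f" and x: "x \<in> N" "vpair x y \<in> elts f"
  shows "y \<in> N"
proof -
  have "y \<in> H" using H_trans[OF TV_H[OF N f(1)] x(2)] by simp
  then have "\<exists>y\<in>N. vpair (penv N [f, x] (Suc 0)) y \<in> elts (penv N [f, x] 0)"
    by (intro TV_ex[of N "\<lambda>y e. vpair (e (Suc 0)) y \<in> elts (e 0)" "[f, x]" y])
      (use N f x in \<open>auto intro: definable\<close>)
  then obtain z where "z \<in> N" "vpair x z \<in> elts f" by auto
  then show ?thesis using x(2) f(2) unfolding isfun_def by blast
qed

lemma TV_omega_subset:
  assumes N: "TV N" shows "elts omega \<subseteq> N"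
proof
  fix n :: 'v assume "n \<in> elts omega"
  then show "n \<in> N"
  proof (induction n rule: wf_induct_rule[OF foundation])
    case (1 n)
    then have "Ord n" unfolding elts_omega by blast
    then show ?case
    proof (cases n rule: Ord_trichotomy)
      case 1
      have "n \<in> H" using \<open>n \<in> elts omega\<close> omega_H H_trans by blast
      then have "\<exists>x\<in>N. elts x = {}"
        by (intro TV_ex[of N "\<lambda>x e. elts x = {}" "[]" n]) (use N 1 in \<open>auto intro: definable\<close>)
      then show ?thesis using 1 extensionality by metis
    next
      case 2
      then show ?thesis using omega_no_limit 1(2) by blast
    next
      case (3 k)
      then have "k \<in> N" using 1(1)[of k] 1(2) Ord_subset[OF Ord_omega 1(2)] by blast
      then show ?thesis using TV_vsucc[OF N] 3 by blast
    qed
  qed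
qed

text \<open>By elementarity \<open>N\<close> contains a function that enumerates \<open>m\<close>
  along omega, and every natural number is in \<open>N\<close>.\<close>

lemma TV_countable_subset:
  assumes N: "TV N" and m: "m \<in> N" "countable (elts m)" shows "elts m \<subseteq> N"
proof
  fix y assume y: "y \<in> elts m"
  obtain g where g: "g \<in> H" "isfun g" "\<forall>y\<in>elts m. \<exists>n\<in>elts omega. vpair n y \<in> elts g"
    using m(2) lepoll_code[OF TV_H[OF N m(1)] omega_H] countable_iff_lepoll_omega by blast
  then have "\<exists>g\<in>N. isfun g \<and> (\<forall>y\<in>elts (penv N [m] 0). \<exists>n\<in>elts omega. vpair n y \<in> elts g)"
    by (intro TV_ex[of N "\<lambda>g e. isfun g \<and> (\<forall>y\<in>elts (e 0). \<exists>n\<in>elts omega. vpair n y \<in> elts g)" "[m]" g])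
      (use N m in \<open>simp_all, intro definable\<close>)
  then obtain g n where g: "g \<in> N" "isfun g" "n \<in> elts omega" "vpair n y \<in> elts g" using y by auto
  then show "y \<in> N" using TV_apply[OF N g(1,2) _ g(4)] TV_omega_subset[OF N] by blast
qed

lemma TV_omega1_subset: "TV N \<Longrightarrow> i \<in> N \<Longrightarrow> i \<in> elts omega1 \<Longrightarrow> elts i \<subseteq> N"
  using TV_countable_subset elts_omega1 by blast

lemma TV_\<alpha>_subset: "TV N \<Longrightarrow> elts \<alpha> \<subseteq> N"
  using TV_omega1_subset TV_\<alpha> \<alpha>_countable by blast

text \<open>The graph is a set by Replacement and lies in \<open>N\<close> by \<open>TV_set\<close>.
  In \<open>R\<close> the parameters start at index 5, below \<open>y\<close>, \<open>z\<close>, the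
  pair, the graph and \<open>d\<close>.\<close>

lemma TV_fun:
  assumes N: "TV N" and d: "d \<in> N" and ps: "set ps \<subseteq> N"
    and R: "definable (\<lambda>e. R (e (Suc 0)) (e 0) (\<lambda>n. e (Suc (Suc (Suc (Suc (Suc n)))))))"
    and fnl: "\<And>z y y'. R z y (penv N ps) \<Longrightarrow> R z y' (penv N ps) \<Longrightarrow> y = y'"
  obtains f where "f \<in> N" "isfun f"
    "\<And>z y. vpair z y \<in> elts f \<longleftrightarrow> z \<in> elts d \<and> y \<in> H \<and> R z y (penv N ps)"
proof -
  let ?r = "\<lambda>z. THE y. R z y (penv N ps)"
  define X where "X = {p. \<exists>z\<in>elts d. \<exists>y\<in>H. p = vpair z y \<and> R z y (penv N ps)}"
  have dH: "d \<in> H" using TV_H N d by blast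
  have sub: "X \<subseteq> (\<lambda>z. vpair z (?r z)) ` elts d"
  proof
    fix p assume "p \<in> X"
    then obtain z y where p: "z \<in> elts d" "p = vpair z y" "R z y (penv N ps)" unfolding X_def by blast
    then have "?r z = y" using fnl by (intro the_equality) auto
    then show "p \<in> (\<lambda>z. vpair z (?r z)) ` elts d" using p by blast
  qed
  have "X \<subseteq> H" unfolding X_def using H_trans[OF dH] by auto
  note X = H_image[OF sub dH this]
  let ?P = "\<lambda>p e. \<exists>z\<in>elts (e 0). \<exists>y\<in>H. p = vpair z y \<and> R z y (\<lambda>n. e (Suc n))"
  have f: "set_of X \<in> N"
  proof (rule TV_set[OF N, of "d # ps" ?P])
    show "definable (\<lambda>e. ?P (e 0) (\<lambda>n. e (Suc (Suc n))))" by (intro definable R)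
    show "p \<in> elts (set_of X) \<longleftrightarrow> ?P p (penv N (d # ps))" for p unfolding X(1) by (simp add: X_def)
  qed (use d ps X in auto)
  have mem: "vpair z y \<in> elts (set_of X) \<longleftrightarrow> z \<in> elts d \<and> y \<in> H \<and> R z y (penv N ps)" for z y
    unfolding X(1) by (auto simp: X_def)
  have "isfun (set_of X)" unfolding isfun_def mem using fnl by blast
  then show ?thesis using that f mem by blast
qed

lemma definable_rename:
  assumes "definable P" "inj \<rho>" shows "definable (\<lambda>e. P (e \<circ> \<rho>))"
proof -
  obtain \<phi> where \<phi>: "\<And>e. range e \<subseteq> H \<Longrightarrow> satisfies A e \<phi> \<longleftrightarrow> P e" using assms(1) unfolding definable_def by blast
  have "satisfies A e (ren_form \<rho> \<phi>) \<longleftrightarrow> P (e \<circ> \<rho>)" if "range e \<subseteq> H" for e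
    unfolding satisfies_ren[OF assms(2)] using that by (intro \<phi>) auto
  then show ?thesis unfolding definable_def by blast
qed

text \<open>Several parameters are coded by one, by pairing them one after the other; for a single
  parameter \<open>b \<in> d \<in> N\<close>, a function in \<open>N\<close> choosing witnesses for all members of \<open>d\<close> is applied to \<open>b\<close>.\<close>

lemma TV_extends:
  assumes N: "TV N" and ext: "extends N N'"
  shows "TV N'"
proof -
  have NN': "N \<subseteq> N'" using ext extends_subset by blast
  have N'H: "N' \<subseteq> H"
  proof
    fix x assume "x \<in> N'"
    then obtain d where "d \<in> N" "x \<in> elts d" using ext unfolding extends_def by blast
    then show "x \<in> H" using TV_H[OF N] H_trans by blast
  qed
  have one: "\<exists>x\<in>N'. P (case_nat x e)"
    if P: "definable P" and e: "range e \<subseteq> N'" and ex: "\<exists>x\<in>H. P (case_nat x e)"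
      and supp: "\<And>e e'. range e \<subseteq> H \<Longrightarrow> range e' \<subseteq> H \<Longrightarrow> e 0 = e' 0 \<Longrightarrow> e (Suc 0) = e' (Suc 0) \<Longrightarrow> P e = P e'"
    for P e
  proof -
    define PP where "PP x b = P (case_nat x (\<lambda>_. b))" for x b
    have dPP: "definable (\<lambda>e. PP (e i) (e j))" if ij: "i \<noteq> j" for i j
    proof (rule definable_cong)
      \<comment> \<open>Only the first two entries matter by \<open>supp\<close>; the remaining
        values merely keep the renaming injective.\<close>
      define \<rho> where "\<rho> k = (if k = 0 then i else if k = Suc 0 then j else k + i + j)" for k
      have "inj \<rho>" unfolding inj_def \<rho>_def using ij by auto
      then show "definable (\<lambda>e. P (e \<circ> \<rho>))" by (rule definable_rename[OF P])
      show "PP (e i) (e j) \<longleftrightarrow> P (e \<circ> \<rho>)" if "range e \<subseteq> H" for e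
        unfolding PP_def by (rule supp) (use that in \<open>auto simp: \<rho>_def image_subset_iff split: nat.splits\<close>)
    qed
    define b where "b = e 0"
    have b: "b \<in> N'" using e unfolding b_def by blast
    have PPe: "PP x b \<longleftrightarrow> P (case_nat x e)" if "x \<in> H" for x
      unfolding PP_def b_def
      by (rule supp) (use that e N'H in \<open>auto simp: image_subset_iff subset_iff split: nat.splits\<close>)
    obtain d where d: "d \<in> N" "b \<in> elts d" using ext b unfolding extends_def by blast
    let ?Q = "\<lambda>f e. isfun f \<and> (\<forall>b\<in>elts (e 0). (\<exists>x\<in>H. PP x b) \<longrightarrow> (\<exists>x\<in>H. vpair b x \<in> elts f \<and> PP x b))"
    \<comment> \<open>A choice function on \<open>d\<close> is first obtained in \<open>H\<close>,
      by choice and Replacement; elementarity then supplies one in \<open>N\<close>.\<close>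
    define w where "w b = (SOME x. x \<in> H \<and> PP x b)" for b
    have w: "w b \<in> H \<and> PP (w b) b" if "\<exists>x\<in>H. PP x b" for b
      using someI_ex[of "\<lambda>x. x \<in> H \<and> PP x b"] that unfolding w_def by blast
    define X where "X = (\<lambda>b. vpair b (w b)) ` {b \<in> elts d. \<exists>x\<in>H. PP x b}"
    have dH: "d \<in> H" using TV_H N d by blast
    have sub: "X \<subseteq> (\<lambda>b. vpair b (w b)) ` elts d" unfolding X_def by blast
    have "X \<subseteq> H"
    proof
      fix p assume "p \<in> X"
      then obtain b where b: "b \<in> elts d" "\<exists>x\<in>H. PP x b" "p = vpair b (w b)" unfolding X_def by blast
      show "p \<in> H" using w[OF b(2)] H_trans[OF dH b(1)] b(3) by simp
    qed
    note X = H_image[OF sub dH this]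
    have "\<exists>f\<in>N. ?Q f (penv N [d])"
    proof (rule TV_ex[OF N, of ?Q])
      have "definable (\<lambda>e. PP (e 0) (e (Suc 0)))" by (rule dPP) simp
      then show "definable (\<lambda>e. ?Q (e 0) (\<lambda>n. e (Suc n)))" by (intro definable)
      have "isfun (set_of X)" unfolding isfun_def X(1) by (auto simp: X_def)
      moreover have "vpair b (w b) \<in> elts (set_of X)" if "b \<in> elts d" "\<exists>x\<in>H. PP x b" for b
        unfolding X(1) using that by (auto simp: X_def)
      ultimately show "?Q (set_of X) (penv N [d])" using w by auto
    qed (use d X in auto)
    then obtain f where f: "f \<in> N" "isfun f"
      and fw: "\<And>b. b \<in> elts d \<Longrightarrow> \<exists>x\<in>H. PP x b \<Longrightarrow> \<exists>x\<in>H. vpair b x \<in> elts f \<and> PP x b" by auto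
    obtain x where "x \<in> H" "vpair b x \<in> elts f" "PP x b" using fw[OF d(2)] ex PPe by blast
    moreover from this have "x \<in> N'" using ext f b unfolding extends_def by blast
    ultimately show ?thesis using PPe by blast
  qed
  have many: "\<exists>x\<in>N'. P (case_nat x e)"
    if "definable P" "range e \<subseteq> N'" "\<exists>x\<in>H. P (case_nat x e)"
      and "\<And>e e'. range e \<subseteq> H \<Longrightarrow> range e' \<subseteq> H \<Longrightarrow> \<forall>n<Suc (Suc K). e n = e' n \<Longrightarrow> P e = P e'"
    for K P e
    using that
  proof (induction K arbitrary: P e)
    case 0
    have "P e = P e'" if "range e \<subseteq> H" "range e' \<subseteq> H" "e 0 = e' 0" "e (Suc 0) = e' (Suc 0)" for e e'
      using 0(4)[OF that(1,2)] that(3,4) by (auto simp: less_Suc_eq)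
    then show ?case by (rule one[OF 0(1-3)])
  next
    case (Suc K)
    define G where "G x u v e = P (case_nat x (case_nat u (case_nat v e)))" for x u v and e :: "nat \<Rightarrow> 'v"
    define P' where "P' e \<longleftrightarrow> (\<exists>u\<in>H. \<exists>v\<in>H. e (Suc 0) = vpair u v \<and> G (e 0) u v (\<lambda>n. e (Suc (Suc n))))" for e
    \<comment> \<open>After \<open>u\<close> and \<open>v\<close> are bound, the stack reads
      \<open>v\<close>, \<open>u\<close>, the witness, the pair, the rest. The renaming restores the
      order witness, \<open>u\<close>, \<open>v\<close>, the rest, and skips the pair.\<close>
    define \<rho> :: "nat \<Rightarrow> nat"
      where "\<rho> k = (if k = 0 then 2 else if k = 1 then 1 else if k = 2 then 0 else Suc k)" for k
    have \<rho>: "inj \<rho>" unfolding inj_def \<rho>_def by auto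
    have "(\<lambda>e. G (e (Suc (Suc 0))) (e (Suc 0)) (e 0) (\<lambda>n. e (Suc (Suc (Suc (Suc n)))))) = (\<lambda>e. P (e \<circ> \<rho>))"
      unfolding G_def by (intro HOL.ext arg_cong[of _ _ P]) (auto simp: \<rho>_def numeral_2_eq_2 split: nat.splits)
    then have "definable (\<lambda>e. G (e (Suc (Suc 0))) (e (Suc 0)) (e 0) (\<lambda>n. e (Suc (Suc (Suc (Suc n))))))"
      using definable_rename[OF Suc.prems(1) \<rho>] by (simp only:)
    then have dP': "definable P'" unfolding P'_def by (intro definable)
    define e' where "e' = case_nat (vpair (e 0) (e (Suc 0))) (\<lambda>n. e (Suc (Suc n)))"
    have eN: "e n \<in> N'" for n using Suc.prems(2) by blast
    have e': "range e' \<subseteq> N'" unfolding e'_def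
      using eN ext by (auto simp: extends_def split: nat.splits)
    have eq: "P' (case_nat x e') \<longleftrightarrow> P (case_nat x e)" for x
    proof -
      have "case_nat (e 0) (case_nat (e (Suc 0)) (\<lambda>n. e (Suc (Suc n)))) = e"
        by (auto split: nat.splits)
      moreover have "e 0 \<in> H" "e (Suc 0) \<in> H" using eN N'H by blast+
      ultimately show ?thesis unfolding P'_def e'_def G_def by auto
    qed
    have "\<exists>x\<in>N'. P' (case_nat x e')"
    proof (rule Suc.IH[OF dP' e'])
      show "\<exists>x\<in>H. P' (case_nat x e')" using Suc.prems(3) eq by simp
      fix c c' :: "nat \<Rightarrow> 'v"
      assume c: "range c \<subseteq> H" "range c' \<subseteq> H" "\<forall>n<Suc (Suc K). c n = c' n"
      have "G (c 0) u v (\<lambda>n. c (Suc (Suc n))) = G (c' 0) u v (\<lambda>n. c' (Suc (Suc n)))"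
        if "u \<in> H" "v \<in> H" for u v
        unfolding G_def
        by (rule Suc.prems(4)) (use c that in \<open>auto simp: image_subset_iff split: nat.splits\<close>)
      then show "P' c = P' c'" unfolding P'_def using c(3) by auto
    qed
    then show ?case using eq by blast
  qed
  have "\<exists>x\<in>N'. P (case_nat x e)"
    if P: "definable P" and e: "range e \<subseteq> N'" and ex: "\<exists>x\<in>H. P (case_nat x e)" for P e
  proof -
    obtain \<phi> where \<phi>: "\<And>e. range e \<subseteq> H \<Longrightarrow> satisfies A e \<phi> \<longleftrightarrow> P e" using P unfolding definable_def by blast
    obtain K where K: "\<forall>e e'. (\<forall>n<K. e n = e' n) \<longrightarrow> satisfies A e \<phi> = satisfies A e' \<phi>"
      using satisfies_finite_support ..
    have "P e = P e'" if "range e \<subseteq> H" "range e' \<subseteq> H" "\<forall>n<Suc (Suc K). e n = e' n" for e e'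
      using K that(3) \<phi>[OF that(1)] \<phi>[OF that(2)] by (metis less_Suc_eq)
    then show ?thesis using many[OF P e ex] by blast
  qed
  then show ?thesis unfolding TV_def using N NN' N'H unfolding TV_def by blast
qed

section \<open>Properties of extensions and of hulls\<close>

lemma TV_mem_some: "TV N \<Longrightarrow> x \<in> N \<Longrightarrow> \<exists>d\<in>N. x \<in> elts d"
  using TV_singleton elts_set_of_single by blast

lemma extends_refl: "TV N \<Longrightarrow> extends N N"
  unfolding extends_def using TV_mem_some TV_vpair TV_apply by blast

lemma TV_Union:
  assumes N: "TV N" and c: "c \<in> N"
  obtains u where "u \<in> N" "elts u = (\<Union>d\<in>elts c. elts d)"
proof -
  have cH: "c \<in> H" using TV_H N c by blast
  let ?X = "\<Union>d\<in>elts c. elts d"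
  have "?X \<prec> elts \<Theta>"
    by (rule regular_UN_lesspoll[OF regular H_lesspoll[OF cH] H_lesspoll[OF H_trans[OF cH]]])
  moreover have "?X \<subseteq> H" using cH H_trans by blast
  ultimately have X: "elts (set_of ?X) = ?X" "set_of ?X \<in> H" using H_set_of by blast+
  have "set_of ?X \<in> N"
    by (rule TV_set[OF N, of "[c]" "\<lambda>x e. \<exists>d\<in>elts (e 0). x \<in> elts d"])
      (use c X in \<open>auto intro: definable\<close>)
  then show ?thesis using that X(1) by blast
qed

text \<open>The only clause that needs an argument is the covering one: if x is in d, d in c, and c
  in \<open>N\<close>, then x is in the union of c, which belongs to \<open>N\<close> by
  elementarity.\<close>

lemma extends_trans:
  assumes N: "TV N" and 1: "extends N N'" and 2: "extends N' N''"
  shows "extends N N''"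
proof -
  have "\<exists>u\<in>N. x \<in> elts u" if x: "x \<in> N''" for x
  proof -
    obtain d where d: "d \<in> N'" "x \<in> elts d" using 2 x unfolding extends_def by blast
    obtain c where c: "c \<in> N" "d \<in> elts c" using 1 d(1) unfolding extends_def by blast
    obtain u where "u \<in> N" "elts u = (\<Union>d\<in>elts c. elts d)" using TV_Union[OF N c(1)] .
    then show ?thesis using c d by blast
  qed
  moreover have "N \<subseteq> N'" "N' \<subseteq> N''" using 1 2 extends_subset by auto
  ultimately show ?thesis using 2 unfolding extends_def by (auto simp: subset_iff)
qed

text \<open>Every clause is finitary, hence passes to the union. Elementarity of the union is then
  inherited from \<open>N\<close> alone.\<close>

lemma extends_Union_chain:
  fixes N' :: "nat \<Rightarrow> 'v set"
  assumes "\<And>n. extends N (N' n)" "\<And>n. N' n \<subseteq> N' (Suc n)"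
  shows "extends N (\<Union>n. N' n)"
proof -
  have mono: "N' n \<subseteq> N' m" if "n \<le> m" for n m using lift_Suc_mono_le[of N'] assms(2) that by blast
  have pair: "\<exists>k. x \<in> N' k \<and> y \<in> N' k" if "x \<in> N' n" "y \<in> N' m" for x y n m
    using mono[of n "max n m"] mono[of m "max n m"] that by (auto intro: exI[of _ "max n m"])
  show ?thesis unfolding extends_def
  proof (intro conjI ballI impI allI)
    fix x y assume "x \<in> (\<Union>n. N' n)" "y \<in> (\<Union>n. N' n)"
    then obtain k where "x \<in> N' k" "y \<in> N' k" using pair by blast
    then show "vpair x y \<in> (\<Union>n. N' n)" using assms(1) unfolding extends_def by blast
  next
    fix f x y assume f: "f \<in> N" "isfun f" "x \<in> (\<Union>n. N' n)" "vpair x y \<in> elts f"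
    then obtain n where "x \<in> N' n" by blast
    then have "y \<in> N' n" using assms(1)[of n] f unfolding extends_def by blast
    then show "y \<in> (\<Union>n. N' n)" by blast
  next
    show "N \<subseteq> (\<Union>n. N' n)" using extends_subset[OF assms(1), of 0] by blast
  next
    fix x assume "x \<in> (\<Union>n. N' n)"
    then show "\<exists>d\<in>N. x \<in> elts d" using assms(1) unfolding extends_def by blast
  qed
qed

text \<open>Each clause is witnessed by a set in \<open>N\<close>: constant functions on
  \<open>d\<close> give the inclusion, ranges give the covering, pairing and composition give the
  closure properties. The identity on \<open>d\<close> gives \<eta>.\<close>

lemma
  assumes N: "TV N" and d: "d \<in> N" "\<eta> \<in> elts d"
  shows extends_hull: "extends N (hull N \<eta>)" and mem_hull: "\<eta> \<in> hull N \<eta>"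
proof -
  have \<eta>H: "\<eta> \<in> H" using d TV_H[OF N] H_trans by blast
  show "\<eta> \<in> hull N \<eta>"
  proof -
    obtain f where "f \<in> N" "isfun f" "\<And>z y. vpair z y \<in> elts f \<longleftrightarrow> z \<in> elts d \<and> y \<in> H \<and> y = z"
      by (rule TV_fun[OF N d(1), of "[]" "\<lambda>z y e. y = z"]) (auto intro: definable)
    then show ?thesis unfolding hull_def using \<eta>H d(2) by blast
  qed
  show "extends N (hull N \<eta>)" unfolding extends_def
  proof (intro conjI ballI impI allI)
    show "N \<subseteq> hull N \<eta>"
    proof
      fix x assume x: "x \<in> N"
      obtain f where "f \<in> N" "isfun f" "\<And>z y. vpair z y \<in> elts f \<longleftrightarrow> z \<in> elts d \<and> y \<in> H \<and> y = penv N [x] 0"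
        by (rule TV_fun[OF N d(1), of "[x]" "\<lambda>z y e. y = e 0"]) (use x in \<open>auto intro: definable\<close>)
      then show "x \<in> hull N \<eta>" unfolding hull_def using TV_H[OF N x] d(2) by auto
    qed
  next
    fix y assume "y \<in> hull N \<eta>"
    then obtain f where f: "f \<in> N" "isfun f" "vpair \<eta> y \<in> elts f" unfolding hull_def by blast
    have fH: "f \<in> H" using TV_H N f by blast
    let ?X = "{y. \<exists>z. vpair z y \<in> elts f}"
    have sub: "?X \<subseteq> (\<lambda>p. THE y. \<exists>z. p = vpair z y) ` elts f" by force
    have "?X \<subseteq> H" using H_trans[OF fH] by fastforce
    note X = H_image[OF sub fH this]
    have "z \<in> H" if "vpair z y \<in> elts f" for z y using H_trans[OF fH that] by simp
    then have "set_of ?X \<in> N"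
      by (intro TV_set[OF N, of "[f]" "\<lambda>y e. \<exists>z\<in>H. vpair z y \<in> elts (e 0)"])
        (use f X in \<open>auto intro: definable\<close>)
    then show "\<exists>d\<in>N. y \<in> elts d" using f(3) X(1) by (intro bexI) auto
  next
    fix x y assume "x \<in> hull N \<eta>" "y \<in> hull N \<eta>"
    then obtain f g where f: "f \<in> N" "isfun f" "vpair \<eta> x \<in> elts f" and g: "g \<in> N" "isfun g" "vpair \<eta> y \<in> elts g"
      unfolding hull_def by blast
    have xy: "x \<in> H" "y \<in> H" using H_trans[OF TV_H[OF N f(1)] f(3)] H_trans[OF TV_H[OF N g(1)] g(3)] by auto
    obtain h where "h \<in> N" "isfun h" "\<And>z w. vpair z w \<in> elts h \<longleftrightarrow> z \<in> elts d \<and> w \<in> H \<and>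
        (\<exists>u\<in>H. \<exists>v\<in>H. vpair z u \<in> elts (penv N [f, g] 0) \<and> vpair z v \<in> elts (penv N [f, g] (Suc 0)) \<and> w = vpair u v)"
    proof (rule TV_fun[OF N d(1), of "[f, g]" "\<lambda>z w e. \<exists>u\<in>H. \<exists>v\<in>H. vpair z u \<in> elts (e 0) \<and> vpair z v \<in> elts (e (Suc 0)) \<and> w = vpair u v"])
      show "definable (\<lambda>e. \<exists>u\<in>H. \<exists>v\<in>H. vpair (e (Suc 0)) u \<in> elts (e (Suc (Suc (Suc (Suc (Suc 0)))))) \<and>
          vpair (e (Suc 0)) v \<in> elts (e (Suc (Suc (Suc (Suc (Suc (Suc 0))))))) \<and> e 0 = vpair u v)"
        by (intro definable)
    qed (use f g in \<open>auto simp: isfun_def\<close>)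
    then show "vpair x y \<in> hull N \<eta>" unfolding hull_def using f g xy d(2) by auto
  next
    fix f x y assume f: "f \<in> N" "isfun f" "vpair x y \<in> elts f" and "x \<in> hull N \<eta>"
    then obtain g where g: "g \<in> N" "isfun g" "vpair \<eta> x \<in> elts g" unfolding hull_def by blast
    have xy: "x \<in> H" "y \<in> H" using H_trans[OF TV_H[OF N f(1)] f(3)] by auto
    obtain h where "h \<in> N" "isfun h" "\<And>z w. vpair z w \<in> elts h \<longleftrightarrow> z \<in> elts d \<and> w \<in> H \<and>
        (\<exists>u\<in>H. vpair z u \<in> elts (penv N [g, f] 0) \<and> vpair u w \<in> elts (penv N [g, f] (Suc 0)))"
    proof (rule TV_fun[OF N d(1), of "[g, f]" "\<lambda>z w e. \<exists>u\<in>H. vpair z u \<in> elts (e 0) \<and> vpair u w \<in> elts (e (Suc 0))"])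
      show "definable (\<lambda>e. \<exists>u\<in>H. vpair (e (Suc 0)) u \<in> elts (e (Suc (Suc (Suc (Suc (Suc 0)))))) \<and>
          vpair u (e 0) \<in> elts (e (Suc (Suc (Suc (Suc (Suc (Suc 0))))))))"
        by (intro definable)
    next
      fix z w w' assume "\<exists>u\<in>H. vpair z u \<in> elts (penv N [g, f] 0) \<and> vpair u w \<in> elts (penv N [g, f] (Suc 0))"
        "\<exists>u\<in>H. vpair z u \<in> elts (penv N [g, f] 0) \<and> vpair u w' \<in> elts (penv N [g, f] (Suc 0))"
      then show "w = w'" using f(2) g(2) unfolding isfun_def by (auto, metis)
    qed (use f g in auto)
    then show "y \<in> hull N \<eta>" unfolding hull_def using f g xy d(2) by auto
  qed
qed

lemma definable_pfun [definable]: "definable (\<lambda>e. small_pfun (e i))"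
  unfolding small_pfun_def by (intro definable)

text \<open>A function in \<open>N\<close> with value \<open>y\<close> at \<eta> may be cut down to
  arguments below omega_2 and values below omega_1 within \<open>N\<close>. So only functions that
  player I can list decide whether a countable ordinal is added.\<close>

lemma hull_omega1:
  assumes N: "TV N" and \<eta>: "\<eta> \<in> elts omega2"
    and pres: "\<And>f y. f \<in> N \<Longrightarrow> small_pfun f \<Longrightarrow> vpair \<eta> y \<in> elts f \<Longrightarrow> y \<in> N"
  shows "hull N \<eta> \<inter> elts omega1 \<subseteq> N"
proof
  fix y assume "y \<in> hull N \<eta> \<inter> elts omega1"
  then obtain f where f: "f \<in> N" "isfun f" "vpair \<eta> y \<in> elts f" and y: "y \<in> elts omega1"
    unfolding hull_def by blast
  let ?X = "{p \<in> elts f. \<exists>a\<in>elts omega2. \<exists>b\<in>elts omega1. p = vpair a b}"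
  have fH: "f \<in> H" using TV_H N f by blast
  have sub: "?X \<subseteq> (\<lambda>p. p) ` elts f" by blast
  have "?X \<subseteq> H" using H_trans[OF fH] by blast
  note X = H_image[OF sub fH this]
  have g: "set_of ?X \<in> N"
  proof (rule TV_set[OF N, of "[f]" "\<lambda>p e. p \<in> elts (e 0) \<and> (\<exists>a\<in>elts omega2. \<exists>b\<in>elts omega1. p = vpair a b)"])
    show "definable (\<lambda>e. e 0 \<in> elts (e (Suc (Suc 0))) \<and> (\<exists>a\<in>elts omega2. \<exists>b\<in>elts omega1. e 0 = vpair a b))"
      by (intro definable)
  qed (use f X in auto)
  have "small_pfun (set_of ?X)" unfolding small_pfun_def isfun_def X(1)
    using f(2) unfolding isfun_def by blast
  moreover have "vpair \<eta> y \<in> elts (set_of ?X)" unfolding X(1) using f(3) \<eta> y by blast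
  ultimately show "y \<in> N" using pres g by blast
qed

end

section \<open>Coding a winning strategy\<close>

primrec vnat :: "nat \<Rightarrow> 'v::set_universe" where
  "vnat 0 = set_of {}"
| "vnat (Suc n) = vsucc (vnat n)"

lemma elts_set_of_empty [simp]: "elts (set_of {} :: 'v::set_universe) = {}"
  using elts_set_of_subset[of "{}" "undefined :: 'v"] by simp

lemma elts_vnat: "elts (vnat n) = vnat ` {..<n}"
  by (induction n) (auto simp: elts_vsucc lessThan_Suc)

lemma vnat_omega: "vnat n \<in> elts (omega :: 'v::set_universe)"
proof (induction n)
  case 0
  have "Ord (set_of {} :: 'v)" unfolding Ord_def transitive_set_def by simp
  then show ?case by (simp add: elts_omega)
next
  case (Suc n)
  moreover have "limit_ordinal (omega :: 'v)" by (rule limit_omega)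
  ultimately show ?case unfolding limit_ordinal_def by simp
qed

lemma elts_omega_eq: "elts (omega :: 'v::set_universe) = range vnat"
proof
  show "range vnat \<subseteq> elts (omega :: 'v)" using vnat_omega by blast
  have "x \<in> range vnat" if "x \<in> elts omega" for x :: 'v
    using that
  proof (induction x rule: wf_induct_rule[OF foundation])
    case (1 n)
    then have "Ord n" unfolding elts_omega by blast
    then show ?case
    proof (cases n rule: Ord_trichotomy)
      case 1
      then have "n = vnat 0" by (intro extensionality) simp
      then show ?thesis by blast
    next
      case 2
      then show ?thesis using omega_no_limit 1(2) by blast
    next
      case (3 k)
      then have "k \<in> range vnat" using 1(1)[of k] 1(2) Ord_subset[OF Ord_omega 1(2)] by blast
      then show ?thesis using 3(3) by (metis rangeE rangeI vnat.simps(2))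
    qed
  qed
  then show "elts (omega :: 'v) \<subseteq> range vnat" by blast
qed

section \<open>Rounds, moves and plays\<close>

definition game_round :: "'v::set_universe \<Rightarrow> nat \<Rightarrow> 'v" where
  "game_round l m = vplus (vtimes omega l) (vnat m)"

lemma elts_omega_times: "elts (vtimes omega i) = {game_round l m |l m. l \<in> elts i}"
  unfolding elts_vtimes game_round_def elts_omega_eq by blast

lemma elts_round: "elts (game_round i n) = elts (vtimes omega i) \<union> game_round i ` {..<n}"
  unfolding game_round_def elts_vplus elts_vnat by (simp add: image_image)

lemma round_less: "l \<in> elts i \<Longrightarrow> game_round l m \<in> elts (game_round i n)"
  unfolding elts_round elts_omega_times by blast

lemma round_inject:
  assumes "Ord i" "Ord l" "game_round i n = game_round l m"
  shows "i = l \<and> n = m"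
proof -
  have "i = l" using Ord_linear[OF assms(1,2)] round_less[of i l n m] round_less[of l i m n] assms(3) mem_irrefl
    by metis
  moreover have "game_round i k \<in> elts (game_round i k')" if "k < k'" for k k' using that unfolding elts_round by blast
  ultimately show ?thesis using assms(3) mem_irrefl by (metis linorder_neqE_nat)
qed

text \<open>A move has to be a total function, so the partial function is completed by 0. The
  definition gives such a function for every set \<open>f\<close>, whether or not it codes a partial
  one.\<close>

definition decode :: "'v::set_universe \<Rightarrow> 'v \<Rightarrow> 'v" where
  "decode f = (\<lambda>\<eta>\<in>elts omega2. if \<exists>y\<in>elts omega1. vpair \<eta> y \<in> elts f
     then SOME y. y \<in> elts omega1 \<and> vpair \<eta> y \<in> elts f else vnat 0)"

lemma decode_funcset: "decode f \<in> elts omega2 \<rightarrow>\<^sub>E elts (omega1 :: 'v::set_universe)"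
proof -
  have z: "vnat 0 \<in> elts (omega1 :: 'v)" using Ord_subset[OF Ord_omega1 omega_in_omega1] vnat_omega by blast
  have "(SOME y. y \<in> elts omega1 \<and> vpair \<eta> y \<in> elts f) \<in> elts omega1"
    if "\<exists>y\<in>elts omega1. vpair \<eta> y \<in> elts f" for \<eta> :: 'v
    using someI_ex[of "\<lambda>y. y \<in> elts omega1 \<and> vpair \<eta> y \<in> elts f"] that by blast
  then show ?thesis unfolding decode_def using z by (auto simp del: vnat.simps)
qed

lemma decode_eq:
  assumes "small_pfun f" "vpair \<eta> y \<in> elts f"
  shows "decode f \<eta> = y" "\<eta> \<in> elts omega2" "y \<in> elts omega1"
proof -
  show \<eta>: "\<eta> \<in> elts omega2" and y: "y \<in> elts omega1"
    using assms unfolding small_pfun_def by auto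
  have "(SOME y. y \<in> elts omega1 \<and> vpair \<eta> y \<in> elts f) = y"
    using assms y unfolding small_pfun_def isfun_def by (intro some_equality) auto
  then show "decode f \<eta> = y" unfolding decode_def using \<eta> y assms(2) by auto
qed

definition enum :: "'v::set_universe \<Rightarrow> nat \<Rightarrow> 'v" where
  "enum u = from_nat_into (elts u)"

text \<open>Lists are coded by pairing alone, starting from the empty set, so closure under pairs
  suffices to contain the code.\<close>

primrec nest :: "'v::set_universe list \<Rightarrow> 'v" where
  "nest [] = set_of {}"
| "nest (x # xs) = vpair (nest xs) x"

lemma inj_nest: "nest xs = nest ys \<Longrightarrow> xs = ys"
proof (induction xs arbitrary: ys)
  case Nil
  then have "elts (nest ys) = {}" by (metis elts_set_of_empty nest.simps(1))
  then show ?case using vpair_not_empty by (cases ys) auto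
next
  case (Cons x xs)
  then have "elts (nest ys) \<noteq> {}" using vpair_not_empty by (metis nest.simps(2))
  then show ?case using Cons by (cases ys) auto
qed

lemma vseq_eq_iff:
  fixes i :: "'v::set_universe"
  shows "vseq i F = vseq j G \<longleftrightarrow> i = j \<and> (\<forall>l\<in>elts i. F l = G l)"
proof
  assume eq: "vseq i F = vseq j G"
  have "l \<in> elts i \<longleftrightarrow> l \<in> elts j" for l using vpair_mem_vseq[of l _ i F] vpair_mem_vseq[of l _ j G] eq by metis
  then have "i = j" by (intro extensionality) blast
  moreover have "F l = G l" if "l \<in> elts i" for l
    using vpair_mem_vseq[of l "F l" i F] vpair_mem_vseq[of l "F l" j G] eq that by metis
  ultimately show "i = j \<and> (\<forall>l\<in>elts i. F l = G l)" by blast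
qed (auto intro: vseq_cong)

definition full_play :: "'v::set_universe \<Rightarrow> ('v \<Rightarrow> 'v) \<Rightarrow> 'v \<Rightarrow> 'v \<Rightarrow> 'v" where
  "full_play \<alpha> F = (\<lambda>\<beta>\<in>elts (vtimes omega \<alpha>).
     let (l, m) = (SOME (l, m). l \<in> elts \<alpha> \<and> \<beta> = game_round l m) in decode (enum (F l) m))"

lemma full_play_round:
  assumes "Ord \<alpha>" "l \<in> elts \<alpha>"
  shows "full_play \<alpha> F (game_round l m) = decode (enum (F l) m)"
proof -
  have "(SOME (l', m'). l' \<in> elts \<alpha> \<and> game_round l m = game_round l' m') = (l, m)"
  proof (rule some_equality)
    fix x assume "case x of (l', m') \<Rightarrow> l' \<in> elts \<alpha> \<and> game_round l m = game_round l' m'"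
    then show "x = (l, m)" using round_inject[of l "fst x" m "snd x"] Ord_in_Ord[OF assms(1)] assms(2)
      by (cases x) auto
  qed (use assms in auto)
  moreover have "game_round l m \<in> elts (vtimes omega \<alpha>)" unfolding elts_omega_times using assms by blast
  ultimately show ?thesis unfolding full_play_def by simp
qed

definition answer :: "('v::set_universe \<Rightarrow> ('v \<Rightarrow> 'v \<Rightarrow> 'v) \<Rightarrow> 'v) \<Rightarrow> 'v \<Rightarrow> 'v \<Rightarrow> nat \<Rightarrow> ('v \<Rightarrow> 'v) \<Rightarrow> 'v" where
  "answer \<sigma> \<alpha> i n F = \<sigma> (game_round i n) (restrict (full_play \<alpha> F) (elts (vsucc (game_round i n))))"

text \<open>\<open>Suc n\<close> moves are coded because player II answers after seeing the move of
  the same round. The length of the list also reveals \<open>n\<close>.\<close>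

definition block :: "'v::set_universe \<Rightarrow> nat \<Rightarrow> 'v" where
  "block u n = nest (map (enum u) (rev [0..<Suc n]))"

text \<open>The rounds up to the one answered are those of the blocks below \<open>i\<close> and the
  first \<open>Suc n\<close> of block \<open>i\<close>. Hence the code determines the answer, which
  makes the coded strategy single-valued.\<close>

lemma answer_cong:
  assumes \<alpha>: "Ord \<alpha>" "i \<in> elts \<alpha>" and eq: "vseq i F = vseq j G" "block (F i) n = block (G j) m"
  shows "answer \<sigma> \<alpha> i n F = answer \<sigma> \<alpha> j m G"
proof -
  have ij: "i = j" and FG: "\<And>l. l \<in> elts i \<Longrightarrow> F l = G l" using eq(1) unfolding vseq_eq_iff by auto
  have l: "map (enum (F i)) (rev [0..<Suc n]) = map (enum (G i)) (rev [0..<Suc m])"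
    using inj_nest eq(2) ij unfolding block_def by blast
  then have nm: "n = m" by (metis length_map length_rev length_upt diff_zero nat.inject)
  then have "rev (map (enum (F i)) (rev [0..<Suc n])) = rev (map (enum (G i)) (rev [0..<Suc n]))" using l by simp
  then have "map (enum (F i)) [0..<Suc n] = map (enum (G i)) [0..<Suc n]" by (simp only: rev_map rev_rev_ident)
  then have en: "enum (F i) k = enum (G i) k" if "k \<le> n" for k using that by (simp add: map_eq_conv del: upt_Suc)
  have "full_play \<alpha> F \<beta> = full_play \<alpha> G \<beta>" if \<beta>: "\<beta> \<in> elts (vsucc (game_round i n))" for \<beta>
  proof -
    consider l k where "l \<in> elts i" "\<beta> = game_round l k" | k where "k \<le> n" "\<beta> = game_round i k"
      using \<beta> less_imp_le[of _ n] unfolding elts_vsucc elts_round elts_omega_times by blast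
    then show ?thesis
    proof cases
      case 1
      then have "l \<in> elts \<alpha>" using Ord_subset[OF \<alpha>] by blast
      then show ?thesis using 1 FG full_play_round[OF \<alpha>(1)] by simp
    next
      case 2
      then show ?thesis using en full_play_round[OF \<alpha>] by simp
    qed
  qed
  then have "restrict (full_play \<alpha> F) (elts (vsucc (game_round i n))) = restrict (full_play \<alpha> G) (elts (vsucc (game_round i n)))"
    by (rule restrict_ext)
  then show ?thesis unfolding answer_def using ij nm by simp
qed

lemma full_play_cong: "(\<And>l. l \<in> elts \<alpha> \<Longrightarrow> F l = G l) \<Longrightarrow> Ord \<alpha> \<Longrightarrow> full_play \<alpha> F = full_play \<alpha> G"
proof (rule HOL.ext)
  fix \<beta> assume eq: "\<And>l. l \<in> elts \<alpha> \<Longrightarrow> F l = G l" and "Ord \<alpha>"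
  show "full_play \<alpha> F \<beta> = full_play \<alpha> G \<beta>"
  proof (cases "\<beta> \<in> elts (vtimes omega \<alpha>)")
    case True
    then obtain l m where "l \<in> elts \<alpha>" "\<beta> = game_round l m" unfolding elts_omega_times by blast
    then show ?thesis using full_play_round[OF \<open>Ord \<alpha>\<close>] eq by simp
  qed (simp add: full_play_def)
qed

text \<open>A positive set is unbounded in omega_2, so it has a member \<eta> outside any prescribed
  \<zeta>; one such member is enough.\<close>

lemma answer_wins:
  assumes \<sigma>: "winning_strategy_II (vtimes omega \<alpha>) I_bdd_cof_omega1 \<sigma>" and \<alpha>: "Ord \<alpha>"
  shows "i \<in> elts \<alpha> \<Longrightarrow> answer \<sigma> \<alpha> i n F \<in> elts omega1"
    and "\<zeta> \<in> elts omega2 \<Longrightarrow> \<exists>\<eta>\<in>elts omega2. \<eta> \<notin> elts \<zeta> \<and>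
      (\<forall>i\<in>elts \<alpha>. \<forall>n. elts (decode (enum (F i) n) \<eta>) \<subseteq> elts (answer \<sigma> \<alpha> i n F))"
proof -
  define \<xi> where "\<xi> = (\<lambda>\<beta>. \<sigma> \<beta> (restrict (full_play \<alpha> F) (elts (vsucc \<beta>))))"
  have "full_play \<alpha> F \<beta> \<in> elts omega2 \<rightarrow>\<^sub>E elts omega1" if "\<beta> \<in> elts (vtimes omega \<alpha>)" for \<beta>
  proof -
    obtain l m where "l \<in> elts \<alpha>" "\<beta> = game_round l m" using \<open>\<beta> \<in> _\<close> unfolding elts_omega_times by blast
    then show ?thesis using full_play_round[OF \<alpha>, of l F m] decode_funcset by metis
  qed
  then have "full_play \<alpha> F \<in> elts (vtimes omega \<alpha>) \<rightarrow>\<^sub>E (elts omega2 \<rightarrow>\<^sub>E elts omega1)"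
    by (intro PiE_I) (auto simp: full_play_def)
  then have w: "\<forall>\<beta>\<in>elts (vtimes omega \<alpha>). \<xi> \<beta> \<in> elts omega1"
    "II_wins_play (vtimes omega \<alpha>) I_bdd_cof_omega1 (full_play \<alpha> F) \<xi>"
    using \<sigma> unfolding winning_strategy_II_def Let_def \<xi>_def by blast+
  have mem: "game_round i n \<in> elts (vtimes omega \<alpha>)" if "i \<in> elts \<alpha>" for i n
    unfolding elts_omega_times using that by blast
  have ans: "\<xi> (game_round i n) = answer \<sigma> \<alpha> i n F" for i n unfolding \<xi>_def answer_def by simp
  show "answer \<sigma> \<alpha> i n F \<in> elts omega1" if "i \<in> elts \<alpha>" using w(1) mem[OF that] ans by metis
  assume \<zeta>: "\<zeta> \<in> elts omega2"
  obtain X where X: "X \<subseteq> elts omega2" "X \<notin> I_bdd_cof_omega1"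
    and le: "\<And>\<eta> \<beta>. \<eta> \<in> X \<Longrightarrow> \<beta> \<in> elts (vtimes omega \<alpha>) \<Longrightarrow> elts (full_play \<alpha> F \<beta> \<eta>) \<subseteq> elts (\<xi> \<beta>)"
    using w(2) unfolding II_wins_play_def positive_sets_def by blast
  have "\<not> bounded_in omega2 (X \<inter> E_omega2 omega1)" using X unfolding I_bdd_cof_omega1_def by blast
  then obtain \<eta> where \<eta>: "\<eta> \<in> X" "\<eta> \<notin> elts \<zeta>" using \<zeta> unfolding bounded_in_def by blast
  have "elts (decode (enum (F i) n) \<eta>) \<subseteq> elts (answer \<sigma> \<alpha> i n F)" if "i \<in> elts \<alpha>" for i n
    using le[OF \<eta>(1) mem[OF that]] full_play_round[OF \<alpha> that] ans by metis
  then show "\<exists>\<eta>\<in>elts omega2. \<eta> \<notin> elts \<zeta> \<and>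
      (\<forall>i\<in>elts \<alpha>. \<forall>n. elts (decode (enum (F i) n) \<eta>) \<subseteq> elts (answer \<sigma> \<alpha> i n F))"
    using \<eta> X(1) by blast
qed

lemma Pow_lepoll_mono:
  assumes "X \<lesssim> Y" shows "Pow X \<lesssim> Pow Y"
proof -
  obtain f where f: "inj_on f X" "f ` X \<subseteq> Y" using assms unfolding lepoll_def by blast
  have "inj_on (image f) (Pow X)" using f(1) by (rule inj_on_image_Pow)
  moreover have "image f ` Pow X \<subseteq> Pow Y" using f(2) by blast
  ultimately show ?thesis unfolding lepoll_def by blast
qed

context algebra begin

text \<open>Nonemptiness ensures that \<open>enum\<close> has exactly the members of
  \<open>u\<close> as values, with repetitions if \<open>u\<close> is finite.\<close>

definition legal :: "'v \<Rightarrow> bool" where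
  "legal u \<longleftrightarrow> countable (elts u) \<and> elts u \<noteq> {} \<and> (\<forall>f\<in>elts u. small_pfun f)"

text \<open>In the round \<open>\<omega> i + n\<close> player I plays the \<open>n\<close>-th member of the countable set \<open>F i\<close>. A coded
  strategy sees the sets \<open>F l\<close>, \<open>l < i\<close>, but only the finitely many members \<open>t\<close> of \<open>F i\<close> already
  played: the models which are to contain the answers do not contain the whole of \<open>F i\<close>.\<close>

definition answered :: "'v \<Rightarrow> 'v \<Rightarrow> 'v \<Rightarrow> 'v \<Rightarrow> 'v \<Rightarrow> 'v \<Rightarrow> bool" where
  "answered T F \<eta> i u f \<longleftrightarrow> (\<exists>t\<in>H. \<exists>\<xi>\<in>elts omega1.
     (\<exists>r\<in>H. \<exists>q\<in>H. r = seq_restrict F i \<and> q = vpair r t \<and> vpair q \<xi> \<in> elts T) \<and>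
     (\<forall>y\<in>H. vpair \<eta> y \<in> elts f \<longrightarrow> y \<in> elts \<xi> \<or> y = \<xi>) \<and>
     (\<forall>N\<in>H. elts u \<subseteq> elts N \<and> (\<exists>z\<in>elts N. elts z = {}) \<and>
       (\<forall>a\<in>elts N. \<forall>b\<in>elts N. \<exists>p\<in>elts N. p = vpair a b) \<longrightarrow> t \<in> elts N))"

text \<open>All quantifiers range over \<open>H\<close> or definable constants, so the notion is
  definable without parameters. Every elementary submodel therefore contains such a \<open>T\<close>
  as soon as \<open>H\<close> does.\<close>

definition coded_strategy :: "'v \<Rightarrow> bool" where
  "coded_strategy T \<longleftrightarrow> isfun T \<and> (\<forall>F\<in>H.
     isfun F \<and> (\<forall>l\<in>elts \<alpha>. \<exists>u\<in>H. vpair l u \<in> elts F \<and> legal u) \<longrightarrow>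
     (\<forall>\<zeta>\<in>elts omega2. \<exists>\<eta>\<in>elts omega2. \<eta> \<notin> elts \<zeta> \<and>
       (\<forall>i\<in>elts \<alpha>. \<forall>u\<in>H. vpair i u \<in> elts F \<longrightarrow> (\<forall>f\<in>elts u. answered T F \<eta> i u f))))"

lemma definable_legal [definable]: "definable (\<lambda>e. legal (e i))"
  unfolding legal_def by (intro definable)

lemma definable_coded_strategy: "definable (\<lambda>e. coded_strategy (e i))"
  unfolding coded_strategy_def answered_def by (intro definable)

lemma pfun_H: assumes "small_pfun f" shows "f \<in> H"
proof -
  let ?P = "(\<lambda>(a, b). vpair a b) ` (elts (omega2 :: 'v) \<times> elts omega1)"
  have f: "elts f \<subseteq> ?P" using assms unfolding small_pfun_def by force
  have inf: "infinite (elts (omega2 :: 'v))"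
    using infinite_omega1 omega1_subset_omega2 finite_subset by blast
  have "elts f \<lesssim> elts (omega2 :: 'v) \<times> elts (omega1 :: 'v)" using f by (rule subset_image_lepoll)
  then have "elts f \<lesssim> elts (omega2 :: 'v)"
    by (rule lepoll_trans) (intro times_lepoll_infinite inf lepoll_refl subset_imp_lepoll omega1_subset_omega2)
  then have "elts f \<prec> elts \<Theta>" by (rule lepoll_omega2_lesspoll)
  moreover have "elts f \<subseteq> H"
    using f H_trans[OF omega2_H] H_trans[OF omega1_H] by auto
  ultimately show ?thesis using H_iff by blast
qed

lemma legal_H: "legal u \<Longrightarrow> u \<in> H"
  unfolding legal_def using pfun_H H_iff countable_lesspoll_\<Theta> by blast

lemma enum_legal:
  assumes "legal u"
  shows "range (enum u) = elts u" "enum u n \<in> elts u"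
  using assms range_from_nat_into[of "elts u"] from_nat_into[of "elts u"] unfolding enum_def legal_def by auto

text \<open>This closure property is all that \<open>answered\<close> records about the code
  \<open>t\<close> of the moves made in the current block. Finite sequences thus never have to be
  defined by a formula.\<close>

lemma block_mem:
  assumes "elts u \<subseteq> N" "legal u" "set_of {} \<in> N" "\<And>a b. a \<in> N \<Longrightarrow> b \<in> N \<Longrightarrow> vpair a b \<in> N"
  shows "block u n \<in> N"
proof -
  have "nest xs \<in> N" if "set xs \<subseteq> elts u" for xs using that assms by (induction xs) auto
  moreover have "set (map (enum u) (rev [0..<Suc n])) \<subseteq> elts u" using enum_legal(2)[OF assms(2)] by auto
  ultimately show ?thesis unfolding block_def by blast
qed

lemma Ord_\<alpha>: "Ord \<alpha>"
  using \<alpha>_countable elts_omega1 by blast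

text \<open>The code maps the pair of the earlier blocks and the moves made so far in the current
  block to the answer. What needs proof is that it is single-valued and small enough to lie in
  \<open>H\<close>.\<close>

lemma coded_strategy_exists:
  assumes \<sigma>: "winning_strategy_II (vtimes omega \<alpha>) I_bdd_cof_omega1 \<sigma>"
  shows "\<exists>T\<in>H. coded_strategy T"
proof -
  define entry where "entry i n F = vpair (vpair (vseq i F) (block (F i) n)) (answer \<sigma> \<alpha> i n F)" for i n F
  define Fs where "Fs = {F. \<forall>l\<in>elts \<alpha>. legal (F l)}"
  define X where "X = {entry i n F |i n F. i \<in> elts \<alpha> \<and> F \<in> Fs}"
  note ans = answer_wins[OF \<sigma> Ord_\<alpha>]
  have XH: "X \<subseteq> H"
  proof
    fix x assume "x \<in> X"
    then obtain i n F where x: "x = entry i n F" and i: "i \<in> elts \<alpha>" and F: "\<And>l. l \<in> elts \<alpha> \<Longrightarrow> legal (F l)"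
      unfolding X_def Fs_def by blast
    have "vseq i F \<in> H"
      using H_trans[OF \<alpha>_H i] F legal_H Ord_subset[OF Ord_\<alpha> i] by (intro H_vseq) blast+
    moreover have "set_of {} \<in> H" by (rule countable_set_of_H) auto
    then have "block (F i) n \<in> H"
      using H_trans[OF legal_H[OF F[OF i]]] F[OF i] by (intro block_mem) auto
    moreover have "answer \<sigma> \<alpha> i n F \<in> H" using H_trans[OF omega1_H ans(1)[OF i]] .
    ultimately show "x \<in> H" unfolding x entry_def by simp
  qed
  have Xsize: "X \<prec> elts \<Theta>"
  proof -
    \<comment> \<open>\<open>Fc\<close> recovers all of \<open>F\<close> below \<alpha> from one
      subset of \<open>?I\<close>: the quadruples \<open>(l, m, a, b)\<close> such that the
      \<open>m\<close>-th member of \<open>F l\<close> sends \<open>a\<close> to \<open>b\<close>.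
      As \<open>?I\<close> embeds into omega_2, there are at most 2^{omega_2} entries.\<close>
    let ?I = "elts (omega1 :: 'v) \<times> (UNIV :: nat set) \<times> elts (omega2 :: 'v) \<times> elts (omega1 :: 'v)"
    define dcd where "dcd c l m = set_of {vpair a b |a b. (l, m, a, b) \<in> c}"
      for c :: "('v \<times> nat \<times> 'v \<times> 'v) set" and l :: 'v and m :: nat
    define Fc where "Fc c l = set_of (range (dcd c l))" for c l
    have inf: "infinite (elts (omega2 :: 'v))"
      using infinite_omega1 omega1_subset_omega2 finite_subset by blast
    have inf': "infinite (Pow (elts (omega2 :: 'v)))" using inf by simp
    have nat: "(UNIV :: nat set) \<lesssim> elts (omega2 :: 'v)" using inf infinite_le_lepoll by blast
    have "?I \<lesssim> elts (omega2 :: 'v)"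
      by (intro times_lepoll_infinite inf nat lepoll_refl subset_imp_lepoll omega1_subset_omega2)
    then have P: "Pow ?I \<lesssim> Pow (elts (omega2 :: 'v))" by (rule Pow_lepoll_mono)
    have "elts (omega1 :: 'v) \<lesssim> Pow (elts (omega2 :: 'v))"
      by (rule lepoll_trans[OF subset_imp_lepoll[OF omega1_subset_omega2] lepoll_Pow_self])
    moreover have "(UNIV :: nat set) \<lesssim> Pow (elts (omega2 :: 'v))" by (rule lepoll_trans[OF nat lepoll_Pow_self])
    ultimately have "elts (omega1 :: 'v) \<times> (UNIV :: nat set) \<times> Pow ?I \<lesssim> Pow (elts (omega2 :: 'v))"
      by (intro times_lepoll_infinite inf' P)
    moreover have "X \<subseteq> (\<lambda>(i, n, c). entry i n (Fc c)) ` (elts omega1 \<times> UNIV \<times> Pow ?I)"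
    proof
      fix x assume "x \<in> X"
      then obtain i n F where x: "x = entry i n F" and i: "i \<in> elts \<alpha>" and F: "\<And>l. l \<in> elts \<alpha> \<Longrightarrow> legal (F l)"
        unfolding X_def Fs_def by blast
      have \<alpha>1: "elts \<alpha> \<subseteq> elts omega1" using Ord_subset[OF Ord_omega1 \<alpha>_countable] .
      define c where "c = {(l, m, a, b). l \<in> elts \<alpha> \<and> vpair a b \<in> elts (enum (F l) m)}"
      have pf: "small_pfun (enum (F l) m)" if "l \<in> elts \<alpha>" for l m
        using enum_legal(2)[OF F[OF that]] F[OF that] unfolding legal_def by blast
      have "c \<subseteq> ?I"
      proof
        fix z assume "z \<in> c"
        then obtain l m a b where z: "z = (l, m, a, b)" "l \<in> elts \<alpha>" "vpair a b \<in> elts (enum (F l) m)"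
          unfolding c_def by auto
        then show "z \<in> ?I" using decode_eq(2,3)[OF pf z(3)] \<alpha>1 by auto
      qed
      moreover have FF: "Fc c l = F l" if l: "l \<in> elts \<alpha>" for l
      proof -
        have "dcd c l m = enum (F l) m" for m
        proof -
          have "{vpair a b |a b. (l, m, a, b) \<in> c} = elts (enum (F l) m)"
            using pf[OF l, of m] l unfolding c_def small_pfun_def by auto
          then show ?thesis unfolding dcd_def using elts_set_of_eq extensionality by metis
        qed
        then have "range (dcd c l) = elts (F l)" using enum_legal(1)[OF F[OF l]] by simp
        then show ?thesis unfolding Fc_def using elts_set_of_eq extensionality by metis
      qed
      \<comment> \<open>\<open>F\<close> and \<open>Fc c\<close> may differ outside \<alpha>, but an
        entry depends only on the values at indices below \<alpha>.\<close>
      moreover have "entry i n F = entry i n (Fc c)"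
      proof -
        have "vseq i F = vseq i (Fc c)" using FF Ord_subset[OF Ord_\<alpha> i] by (intro vseq_cong) auto
        moreover have "full_play \<alpha> F = full_play \<alpha> (Fc c)" using FF Ord_\<alpha> by (intro full_play_cong) auto
        ultimately show ?thesis unfolding entry_def answer_def using FF[OF i] by simp
      qed
      ultimately show "x \<in> (\<lambda>(i, n, c). entry i n (Fc c)) ` (elts omega1 \<times> UNIV \<times> Pow ?I)"
        using x i \<alpha>1 by (intro image_eqI[of _ _ "(i, n, c)"]) auto
    qed
    ultimately have "X \<lesssim> Pow (elts (omega2 :: 'v))" using lepoll_trans[OF subset_image_lepoll] by blast
    then show ?thesis using lesspoll_trans1 large by blast
  qed
  have T: "elts (set_of X) = X" "set_of X \<in> H" using H_set_of[OF XH Xsize] by auto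
  have isfun_T: "isfun (set_of X)" unfolding isfun_def T(1)
  proof (intro allI impI)
    fix q y z assume "vpair q y \<in> X" "vpair q z \<in> X"
    then obtain i n F j m G where i: "i \<in> elts \<alpha>" and y: "y = answer \<sigma> \<alpha> i n F" and z: "z = answer \<sigma> \<alpha> j m G"
      and eq: "vseq i F = vseq j G" "block (F i) n = block (G j) m"
      unfolding X_def entry_def by auto
    show "y = z" unfolding y z by (rule answer_cong[OF Ord_\<alpha> i eq])
  qed
  have wins: "\<exists>\<eta>\<in>elts omega2. \<eta> \<notin> elts \<zeta> \<and> (\<forall>i\<in>elts \<alpha>. \<forall>u\<in>H. vpair i u \<in> elts FF \<longrightarrow>
      (\<forall>f\<in>elts u. answered (set_of X) FF \<eta> i u f))"
    if FF: "isfun FF" "\<And>l. l \<in> elts \<alpha> \<Longrightarrow> \<exists>u\<in>H. vpair l u \<in> elts FF \<and> legal u"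
      and \<zeta>: "\<zeta> \<in> elts omega2" for FF \<zeta>
  proof -
    obtain F where F: "\<And>l. l \<in> elts \<alpha> \<Longrightarrow> vpair l (F l) \<in> elts FF \<and> legal (F l)" using FF(2) by metis
    have uniq: "u = F l" if "l \<in> elts \<alpha>" "vpair l u \<in> elts FF" for l u
      using F that FF(1) unfolding isfun_def by blast
    have restr: "seq_restrict FF i = vseq i F" if i: "i \<in> elts \<alpha>" for i
    proof (rule extensionality)
      show "elts (seq_restrict FF i) = elts (vseq i F)"
        unfolding elts_seq_restrict elts_vseq using Ord_subset[OF Ord_\<alpha> i] F uniq by blast
    qed
    obtain \<eta> where \<eta>: "\<eta> \<in> elts omega2" "\<eta> \<notin> elts \<zeta>"
      and le: "\<And>i n. i \<in> elts \<alpha> \<Longrightarrow> elts (decode (enum (F i) n) \<eta>) \<subseteq> elts (answer \<sigma> \<alpha> i n F)"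
      using ans(2)[OF \<zeta>, of F] by blast
    have "answered (set_of X) FF \<eta> i u f"
      if i: "i \<in> elts \<alpha>" and u: "vpair i u \<in> elts FF" and f: "f \<in> elts u" for i u f
    proof -
      have ui: "u = F i" using uniq i u by blast
      obtain n where n: "f = enum u n" using f enum_legal(1) F[OF i] ui by (metis rangeE)
      let ?\<xi> = "answer \<sigma> \<alpha> i n F"
      have "F \<in> Fs" unfolding Fs_def using F by blast
      then have e: "entry i n F \<in> X" unfolding X_def using i by blast
      then have eH: "entry i n F \<in> H" using XH by blast
      have "y \<in> elts ?\<xi> \<or> y = ?\<xi>" if y: "vpair \<eta> y \<in> elts f" for y
      proof -
        have "small_pfun f" using F[OF i] f ui unfolding legal_def by blast
        then have "decode f \<eta> = y" "y \<in> elts omega1" using decode_eq y by blast+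
        then have "elts y \<subseteq> elts ?\<xi>" using le[OF i, of n] n ui by simp
        then show ?thesis using Ord_subset_iff \<open>y \<in> elts omega1\<close> ans(1)[OF i] Ord_in_Ord[OF Ord_omega1] by blast
      qed
      moreover have "block (F i) n \<in> elts N" if "elts u \<subseteq> elts N" "\<exists>z\<in>elts N. elts z = {}"
        "\<forall>a\<in>elts N. \<forall>b\<in>elts N. \<exists>p\<in>elts N. p = vpair a b" for N
      proof (rule block_mem)
        show "set_of {} \<in> elts N" using that(2) elts_set_of_empty extensionality by metis
      qed (use that ui F[OF i] in auto)
      ultimately show ?thesis
        unfolding answered_def using e eH ans(1)[OF i, of n F] restr[OF i]
        by (intro bexI[of _ "block (F i) n"] bexI[of _ ?\<xi>] conjI bexI[of _ "vseq i F"]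
            bexI[of _ "vpair (vseq i F) (block (F i) n)"]) (auto simp: T(1) entry_def)
    qed
    then show ?thesis using \<eta> by blast
  qed
  have "coded_strategy (set_of X)"
    unfolding coded_strategy_def by (rule conjI[OF isfun_T], intro ballI impI, rule wins) blast+
  then show ?thesis using T(2) by blast
qed

text \<open>The arguments of \<open>T\<close> lie in \<open>N\<close>, hence so does the answer
  \<xi>. Since \<xi> is a countable ordinal, all ordinals up to \<xi> are in \<open>N\<close>, among
  them the value \<open>y\<close> at \<eta>.\<close>

lemma coded_strategy_apply:
  assumes T: "coded_strategy T" and F: "\<And>l. l \<in> elts \<alpha> \<Longrightarrow> legal (F l)" and \<zeta>: "\<zeta> \<in> elts omega2"
  obtains \<eta> where "\<eta> \<in> elts omega2" "\<eta> \<notin> elts \<zeta>"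
    "\<And>i f N y. i \<in> elts \<alpha> \<Longrightarrow> f \<in> elts (F i) \<Longrightarrow> TV N \<Longrightarrow> countable N \<Longrightarrow> elts (F i) \<subseteq> N \<Longrightarrow>
      T \<in> N \<Longrightarrow> vseq i F \<in> N \<Longrightarrow> vpair \<eta> y \<in> elts f \<Longrightarrow> y \<in> N"
proof -
  have FH: "vseq \<alpha> F \<in> H" using \<alpha>_H F legal_H by (intro H_vseq) auto
  have FF: "isfun (vseq \<alpha> F)" "\<forall>l\<in>elts \<alpha>. \<exists>u\<in>H. vpair l u \<in> elts (vseq \<alpha> F) \<and> legal u"
    using isfun_vseq F legal_H by auto
  obtain \<eta> where \<eta>: "\<eta> \<in> elts omega2" "\<eta> \<notin> elts \<zeta>"
    and *: "\<forall>i\<in>elts \<alpha>. \<forall>u\<in>H. vpair i u \<in> elts (vseq \<alpha> F) \<longrightarrow>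
      (\<forall>f\<in>elts u. answered T (vseq \<alpha> F) \<eta> i u f)"
    using T FH FF \<zeta> unfolding coded_strategy_def by blast
  have "y \<in> N" if i: "i \<in> elts \<alpha>" and f: "f \<in> elts (F i)" and N: "TV N" "countable N" "elts (F i) \<subseteq> N"
    and TN: "T \<in> N" "vseq i F \<in> N" and y: "vpair \<eta> y \<in> elts f" for i f N y
  proof -
    have NH: "N \<subseteq> H" using TV_H N(1) by blast
    have N': "elts (set_of N) = N" "set_of N \<in> H" using H_set_of[OF NH countable_lesspoll_\<Theta>[OF N(2)]] by auto
    have r: "seq_restrict (vseq \<alpha> F) i = vseq i F" by (rule seq_restrict_vseq[OF Ord_subset[OF Ord_\<alpha> i]])
    have Fi: "F i \<in> H" "vpair i (F i) \<in> elts (vseq \<alpha> F)" using F[OF i] legal_H i by auto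
    obtain t \<xi> where t: "\<xi> \<in> elts omega1" "vpair (vpair (vseq i F) t) \<xi> \<in> elts T"
      and le: "\<forall>y\<in>H. vpair \<eta> y \<in> elts f \<longrightarrow> y \<in> elts \<xi> \<or> y = \<xi>"
      and tN: "\<forall>N\<in>H. elts (F i) \<subseteq> elts N \<and> (\<exists>z\<in>elts N. elts z = {}) \<and>
            (\<forall>a\<in>elts N. \<forall>b\<in>elts N. \<exists>p\<in>elts N. p = vpair a b) \<longrightarrow> t \<in> elts N"
      using *[rule_format, OF i Fi f] unfolding r answered_def by blast
    have "vnat 0 \<in> N" using TV_omega_subset[OF N(1)] vnat_omega by blast
    then have "\<exists>z\<in>N. elts z = {}" by (intro bexI[of _ "vnat 0"]) simp_all
    \<comment> \<open>The countable model \<open>N\<close> is itself a set in \<open>H\<close>, so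
      the clause on \<open>t\<close> may be applied to it.\<close>
    then have "t \<in> N" using tN[rule_format, of "set_of N"] N N' TV_vpair[OF N(1)] by auto
    then have \<xi>: "\<xi> \<in> N"
      using TV_apply[OF N(1) TN(1) _ TV_vpair[OF N(1) TN(2)] t(2)] T unfolding coded_strategy_def by blast
    have "y \<in> H" using H_trans[OF H_trans[OF legal_H[OF F[OF i]] f] y] by simp
    then have "y \<in> elts \<xi> \<or> y = \<xi>" using le y by blast
    then show "y \<in> N" using TV_omega1_subset[OF N(1) \<xi> t(1)] \<xi> by blast
  qed
  then show ?thesis using that \<eta> by blast
qed

end

section \<open>Processes guided by a stationary set\<close>

lemma E_omega2_cofinal:
  fixes \<delta> :: "'v::set_universe"
  assumes "\<delta> \<in> E_omega2 omega"
  obtains \<zeta> where "\<And>n::nat. \<zeta> n \<in> elts \<delta>" "\<And>x. x \<in> elts \<delta> \<Longrightarrow> \<exists>n. elts x \<subseteq> elts (\<zeta> n)"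
proof -
  have \<delta>: "\<delta> \<in> elts omega2" "cf \<delta> = omega" using assms unfolding E_omega2_def by auto
  then have "Ord \<delta>" using Ord_in_Ord[OF Ord_omega2] by blast
  then have "has_cofinal_map \<delta> omega" using cf_props \<delta>(2) by metis
  then obtain f :: "'v \<Rightarrow> 'v" where f: "f \<in> elts omega \<rightarrow> elts \<delta>" "\<forall>x\<in>elts \<delta>. \<exists>y\<in>elts omega. elts x \<subseteq> elts (f y)"
    unfolding has_cofinal_map_def by metis
  show ?thesis
  proof (rule that[of "\<lambda>n. f (vnat n)"])
    show "f (vnat n) \<in> elts \<delta>" for n using f(1) vnat_omega by blast
    show "\<exists>n. elts x \<subseteq> elts (f (vnat n))" if "x \<in> elts \<delta>" for x
      using f(2) that unfolding elts_omega_eq by blast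
  qed
qed

lemma lists_bounded:
  fixes D :: "nat \<Rightarrow> 'a set"
  assumes mono: "\<And>n. D n \<subseteq> D (Suc n)" and xs: "xs \<in> lists (\<Union>n. D n)"
  shows "\<exists>n. xs \<in> lists (D n)"
  using xs
proof (induction xs)
  case (Cons x xs)
  then obtain n m where n: "x \<in> D n" "xs \<in> lists (D m)" by auto
  have "D n \<subseteq> D (max n m)" "D m \<subseteq> D (max n m)" using lift_Suc_mono_le[of D] mono by auto
  then have "x # xs \<in> lists (D (max n m))" using n lists_mono by auto
  then show ?case by blast
qed simp

text \<open>An ordinal below omega_2 has at most omega_1 finite lists, so their values are bounded,
  and omega iterations reach a closed ordinal. For closedness, a finite list below a limit of such
  ordinals already lies below one of them.\<close>

lemma club_closed_under:
  fixes \<Phi> :: "'v::set_universe list \<Rightarrow> 'v"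
  assumes \<Phi>: "\<And>zs. zs \<in> lists (elts omega2) \<Longrightarrow> \<Phi> zs \<in> elts omega2"
  shows "club omega2 {\<delta> \<in> elts omega2. \<forall>zs\<in>lists (elts \<delta>). \<Phi> zs \<in> elts \<delta>}" (is "club _ ?C")
  unfolding club_def
proof (intro conjI ballI impI)
  show "?C \<subseteq> elts omega2" by blast
  show "unbounded_in omega2 ?C" unfolding unbounded_in_def
  proof
    fix z :: 'v assume z: "z \<in> elts omega2"
    have "\<exists>d'. d' \<in> elts omega2 \<and> d \<in> elts d' \<and> (\<forall>zs\<in>lists (elts d). \<Phi> zs \<in> elts d')"
      if d: "d \<in> elts omega2" for d
    proof -
      let ?B = "insert d (\<Phi> ` lists (elts d))"
      have "lists (elts d) \<subseteq> lists (elts omega2)" using Ord_subset[OF Ord_omega2 d] by (rule lists_mono)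
      then have 1: "?B \<subseteq> elts omega2" using \<Phi> d by blast
      have "lists (elts d) \<lesssim> elts (omega1 :: 'v)"
        using d by (intro lists_lepoll infinite_omega1) (simp add: elts_omega2)
      then have "\<Phi> ` lists (elts d) \<lesssim> elts (omega1 :: 'v)" by (rule lepoll_trans[OF image_lepoll])
      then have 2: "?B \<lesssim> elts (omega1 :: 'v)"
        using finite_lepoll_infinite[OF infinite_omega1, of ?B]
          lepoll_trans[OF infinite_insert_lepoll[of "\<Phi> ` lists (elts d)" d]]
        by (cases "finite (\<Phi> ` lists (elts d))") simp_all
      obtain d' where "d' \<in> elts omega2" "\<And>b. b \<in> ?B \<Longrightarrow> b \<in> elts d'" using omega2_bounded[OF 1 2] by metis
      then show ?thesis by blast
    qed
    then obtain g where g: "\<And>d. d \<in> elts omega2 \<Longrightarrow> g d \<in> elts omega2 \<and> d \<in> elts (g d) \<and> (\<forall>zs\<in>lists (elts d). \<Phi> zs \<in> elts (g d))"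
      by metis
    \<comment> \<open>The iteration starts at the successor of \<open>z\<close>, which makes
      \<open>z\<close> a member of the closed ordinal.\<close>
    define D where "D n = (g ^^ n) (vsucc z)" for n
    have D2: "D n \<in> elts omega2" for n
    proof (induction n)
      case 0
      have "limit_ordinal (omega2 :: 'v)" by (rule limit_omega2)
      then show ?case unfolding D_def limit_ordinal_def using z by simp
    qed (use g in \<open>simp add: D_def\<close>)
    have DSuc: "D (Suc n) = g (D n)" for n unfolding D_def by simp
    have DO: "Ord (D n)" for n using D2 Ord_in_Ord[OF Ord_omega2] by blast
    have mono: "elts (D n) \<subseteq> elts (D (Suc n))" for n using g[OF D2] Ord_subset[OF DO[of "Suc n"], of "D n"] unfolding DSuc by blast
    define u where "u = set_of (\<Union>n. elts (D n))"
    have cnt: "countable (range D)" by simp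
    have "elts (set_of (range D)) = range D" by (rule countable_set_exists[OF cnt])
    then have u: "elts u = (\<Union>n. elts (D n))"
      using elts_set_of_UN[of "\<lambda>x. x" "set_of (range D)"] unfolding u_def by simp
    have "Ord u"
    proof (rule OrdI)
      fix y assume "y \<in> elts u"
      then obtain n where n: "y \<in> elts (D n)" using u by blast
      then show "Ord y \<and> elts y \<subseteq> elts u" using Ord_in_Ord[OF DO] Ord_subset[OF DO] u by blast
    qed
    moreover have "(\<Union>n. elts (D n)) \<lesssim> elts (omega1 :: 'v)"
      using D2 infinite_omega1 infinite_le_lepoll unfolding elts_omega2
      by (intro UN_lepoll_infinite infinite_omega1) blast+
    ultimately have "u \<in> elts omega2" by (simp add: elts_omega2 u)
    moreover have "\<Phi> zs \<in> elts u" if "zs \<in> lists (elts u)" for zs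
    proof -
      obtain n where "zs \<in> lists (elts (D n))" using lists_bounded[of "\<lambda>n. elts (D n)"] mono \<open>zs \<in> _\<close> unfolding u by blast
      then have "\<Phi> zs \<in> elts (D (Suc n))" using g[OF D2] unfolding DSuc by blast
      then show ?thesis unfolding u by blast
    qed
    moreover have "z \<in> elts (D 0)" unfolding D_def by (simp add: elts_vsucc)
    then have "z \<in> elts u" unfolding u by blast
    ultimately show "\<exists>c\<in>?C. c \<in> elts omega2 \<and> z \<in> elts c" by blast
  qed
next
  fix d assume d: "d \<in> elts omega2" and "limit_ordinal d \<and> unbounded_in d ?C"
  then have lim: "limit_ordinal d" and unb: "\<And>z. z \<in> elts d \<Longrightarrow> \<exists>c\<in>?C. c \<in> elts d \<and> z \<in> elts c"
    unfolding unbounded_in_def by auto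
  have dO: "Ord d" using lim unfolding limit_ordinal_def by blast
  have "\<exists>c\<in>?C. c \<in> elts d \<and> zs \<in> lists (elts c)" if "zs \<in> lists (elts d)" for zs
    using that
  proof (induction zs)
    case Nil
    obtain z where "z \<in> elts d" using lim unfolding limit_ordinal_def by blast
    then show ?case using unb by blast
  next
    case (Cons x xs)
    then obtain c where c: "c \<in> ?C" "c \<in> elts d" "xs \<in> lists (elts c)" by auto
    have x: "x \<in> elts d" using Cons by simp
    obtain m where m: "m \<in> elts d" "elts x \<subseteq> elts m" "elts c \<subseteq> elts m" "m = x \<or> m = c"
      using Ord_linear[of x c] Ord_subset[of c x] Ord_subset[of x c] Ord_in_Ord[OF dO] x c(2) by blast
    obtain c' where c': "c' \<in> ?C" "c' \<in> elts d" "m \<in> elts c'" using unb[OF m(1)] by blast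
    have O: "Ord c'" "Ord m" "Ord x" using Ord_in_Ord[OF dO] c'(2) m(1) x by auto
    have mc: "elts m \<subseteq> elts c'" using Ord_subset[OF O(1) c'(3)] .
    have "x \<in> elts m \<or> x = m" using Ord_subset_iff[OF O(3,2)] m(2) by blast
    then have "x \<in> elts c'" using mc c'(3) by blast
    moreover have "xs \<in> lists (elts c')" using c(3) lists_mono m(3) mc by blast
    ultimately show ?case using c'(1,2) by auto
  qed
  then have "\<Phi> zs \<in> elts d" if "zs \<in> lists (elts d)" for zs
    using that Ord_subset[OF dO] by blast
  then show "d \<in> ?C" using d by blast
qed

text \<open>All choices must be made before \<delta> is known. So \<open>st\<close> assigns a state
  to every finite list of ordinals; the stationary set then supplies a \<delta> closed under the
  bounds of these states, and only afterwards is a sequence cofinal in \<delta> fed in.\<close>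

lemma stationary_process:
  fixes S :: "'v::set_universe set" and Inv :: "nat \<Rightarrow> 's \<Rightarrow> bool" and Rel :: "nat \<Rightarrow> 's \<Rightarrow> 'v \<Rightarrow> 's \<Rightarrow> bool"
  assumes S: "stationary omega2 S" "S \<subseteq> E_omega2 omega"
    and start: "Inv 0 s0"
    and step: "\<And>n s \<zeta>. Inv n s \<Longrightarrow> \<zeta> \<in> elts omega2 \<Longrightarrow> \<exists>s'. Inv (Suc n) s' \<and> Rel n s \<zeta> s'"
    and bd: "\<And>n s. Inv n s \<Longrightarrow> bd s \<in> elts omega2"
  obtains \<delta> \<zeta> s where "\<delta> \<in> S" "s 0 = s0" "\<And>n. Inv n (s n)" "\<And>n. Rel n (s n) (\<zeta> n) (s (Suc n))"
    "\<And>n. bd (s n) \<in> elts \<delta>" "\<And>x. x \<in> elts \<delta> \<Longrightarrow> \<exists>n. elts x \<subseteq> elts (\<zeta> n)"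
proof -
  obtain nx where nx: "\<And>n s \<zeta>. Inv n s \<Longrightarrow> \<zeta> \<in> elts omega2 \<Longrightarrow> Inv (Suc n) (nx n s \<zeta>) \<and> Rel n s \<zeta> (nx n s \<zeta>)"
    using step by metis
  \<comment> \<open>The newest ordinal stands first, and the length of the remaining list is the
    number of the stage.\<close>
  define st where "st = rec_list s0 (\<lambda>z zs s. nx (length zs) s z)"
  have st: "st [] = s0" "st (z # zs) = nx (length zs) (st zs) z" for z zs unfolding st_def by auto
  have inv: "Inv (length zs) (st zs)" if "zs \<in> lists (elts omega2)" for zs
    using that by (induction zs) (use st start nx in auto)
  let ?C = "{\<delta> \<in> elts omega2. \<forall>zs\<in>lists (elts \<delta>). bd (st zs) \<in> elts \<delta>}"
  have "club omega2 ?C" using inv bd by (intro club_closed_under) blast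
  then obtain \<delta> where \<delta>: "\<delta> \<in> S" "\<delta> \<in> ?C" using S(1) unfolding stationary_def by blast
  obtain \<zeta> where \<zeta>: "\<And>n::nat. \<zeta> n \<in> elts \<delta>" "\<And>x. x \<in> elts \<delta> \<Longrightarrow> \<exists>n. elts x \<subseteq> elts (\<zeta> n)"
    using E_omega2_cofinal \<delta>(1) S(2) by blast
  define s where "s n = st (rev (map \<zeta> [0..<n]))" for n
  have \<delta>2: "elts \<delta> \<subseteq> elts omega2" using Ord_subset[OF Ord_omega2] \<delta>(2) by blast
  have l: "rev (map \<zeta> [0..<n]) \<in> lists (elts \<delta>)" for n using \<zeta>(1) by auto
  have l2: "rev (map \<zeta> [0..<n]) \<in> lists (elts omega2)" for n using subsetD[OF \<delta>2 \<zeta>(1)] by auto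
  have Inv: "Inv n (s n)" for n using inv[OF l2, of n] unfolding s_def by simp
  have "s (Suc n) = nx n (s n) (\<zeta> n)" for n unfolding s_def by (simp add: st)
  then have "Rel n (s n) (\<zeta> n) (s (Suc n))" for n using nx[OF Inv subsetD[OF \<delta>2 \<zeta>(1)]] by simp
  moreover have "bd (s n) \<in> elts \<delta>" for n using \<delta>(2) l unfolding s_def by blast
  moreover have "s 0 = s0" unfolding s_def by (simp add: st)
  ultimately show ?thesis using that \<delta>(1) Inv \<zeta>(2) by blast
qed

section \<open>Adding an ordinal to a tower\<close>

context algebra begin

section \<open>Towers and their indices\<close>

definition model_tower :: "'v \<Rightarrow> ('v \<Rightarrow> 'v) \<Rightarrow> bool" where
  "model_tower \<gamma> M \<longleftrightarrow>
     (\<forall>i\<in>elts \<gamma>. countable (elts (M i)) \<and> TV (elts (M i))) \<and>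
     (\<forall>d\<in>elts \<gamma>. limit_ordinal d \<longrightarrow> elts (M d) = (\<Union>i\<in>elts d. elts (M i))) \<and>
     (\<forall>j\<in>elts \<gamma>. successor_ordinal j \<longrightarrow> vseq j M \<in> elts (M j))"

lemma tower_iff: "tower A \<gamma> M \<longleftrightarrow> model_tower \<gamma> M"
  unfolding tower_def model_tower_def using elementary_imp_TV TV_imp_elementary by blast

text \<open>The case \<open>j = \<alpha>\<close> of a limit \<open>\<alpha>\<close> is included: no round is played for the models of limit index.\<close>

definition admissible :: "'v \<Rightarrow> bool" where
  "admissible j \<longleftrightarrow> Ord j \<and> (\<forall>i\<in>elts (vsucc j). \<not> limit_ordinal i \<longrightarrow> i \<in> elts \<alpha>)"

definition omega1_ext :: "'v \<Rightarrow> 'v \<Rightarrow> bool" where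
  "omega1_ext m m' \<longleftrightarrow> extends (elts m) (elts m') \<and> elts m \<inter> elts omega1 = elts m' \<inter> elts omega1"

lemma omega1_ext_trans:
  "TV (elts m) \<Longrightarrow> omega1_ext m m' \<Longrightarrow> omega1_ext m' m'' \<Longrightarrow> omega1_ext m m''"
  unfolding omega1_ext_def using extends_trans by blast

lemma omega1_ext_refl: "TV (elts m) \<Longrightarrow> omega1_ext m m"
  unfolding omega1_ext_def using extends_refl by blast

lemma admissible_subset:
  assumes "admissible j" shows "elts j \<subseteq> elts \<alpha>"
proof
  fix i assume i: "i \<in> elts j"
  then have "vsucc i \<in> elts \<alpha>" using assms vsucc_mem_vsucc[of j i] not_limit_vsucc unfolding admissible_def by blast
  then show "i \<in> elts \<alpha>" using Ord_subset[OF Ord_\<alpha>] elts_vsucc by blast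
qed

lemma admissible_mem:
  assumes j: "admissible j" and k: "k \<in> elts j" shows "admissible k"
proof -
  have "Ord j" using j unfolding admissible_def by blast
  moreover have "elts (vsucc k) \<subseteq> elts (vsucc j)"
    using k Ord_subset[OF \<open>Ord j\<close> k] unfolding elts_vsucc by blast
  ultimately show ?thesis using j Ord_in_Ord k unfolding admissible_def by blast
qed

context
  fixes j and M :: "'v \<Rightarrow> 'v"
  assumes j: "admissible j" and M: "model_tower (vsucc j) M"
begin

lemma index_subset: assumes "i \<in> elts (vsucc j)" shows "elts i \<subseteq> elts (vsucc j)" "elts i \<subseteq> elts \<alpha>" "Ord i"
proof -
  have jO: "Ord j" using j unfolding admissible_def by blast
  show "elts i \<subseteq> elts (vsucc j)" using Ord_subset[OF Ord_vsucc[OF jO] assms] .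
  have "elts i \<subseteq> elts j" using assms Ord_subset[OF jO] unfolding elts_vsucc by blast
  then show "elts i \<subseteq> elts \<alpha>" using admissible_subset[OF j] by blast
  show "Ord i" using Ord_in_Ord[OF Ord_vsucc[OF jO] assms] .
qed

lemma tower_TV: "i \<in> elts (vsucc j) \<Longrightarrow> TV (elts (M i))"
  and tower_countable: "i \<in> elts (vsucc j) \<Longrightarrow> countable (elts (M i))"
  using M unfolding model_tower_def by auto

lemma tower_H: "i \<in> elts (vsucc j) \<Longrightarrow> M i \<in> H"
  using H_iff TV_H tower_TV tower_countable countable_lesspoll_\<Theta> by blast

lemma tower_mem_successor:
  assumes i: "i \<in> elts (vsucc j)" "successor_ordinal i" and k: "k \<in> elts i"
  shows "M k \<in> elts (M i)"
proof -
  have "vseq i M \<in> elts (M i)" using M i unfolding model_tower_def by blast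
  moreover have "k \<in> elts (M i)" using TV_\<alpha>_subset[OF tower_TV[OF i(1)]] index_subset(2)[OF i(1)] k by blast
  moreover have "vpair k (M k) \<in> elts (vseq i M)" using k by simp
  ultimately show ?thesis by (rule TV_apply[OF tower_TV[OF i(1)] _ isfun_vseq])
qed

text \<open>At a successor \<open>i\<close> inclusion comes from membership: \<open>M k\<close> is a
  value of the sequence in \<open>M i\<close>, and countable members of a model are subsets of
  it.\<close>

lemma tower_mono:
  assumes i: "i \<in> elts (vsucc j)" and k: "k \<in> elts i"
  shows "elts (M k) \<subseteq> elts (M i)"
proof (cases rule: Ord_trichotomy[OF index_subset(3)[OF i]])
  case 1
  then show ?thesis using k by simp
next
  case 2
  then show ?thesis using M i k unfolding model_tower_def by blast
next
  case (3 l)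
  then have "successor_ordinal i" unfolding successor_ordinal_def by blast
  then have "M k \<in> elts (M i)" using tower_mem_successor i k by blast
  moreover have "k \<in> elts (vsucc j)" using index_subset(1)[OF i] k by blast
  ultimately show ?thesis using TV_countable_subset[OF tower_TV[OF i]] tower_countable by blast
qed

end

definition add_ordinal :: "'v \<Rightarrow> ('v \<Rightarrow> 'v) \<Rightarrow> 'v \<Rightarrow> 'v \<Rightarrow> 'v" where
  "add_ordinal \<beta> M \<eta> i = (if i \<in> elts \<beta> then M i else set_of (hull (elts (M i)) \<eta>))"

lemma add_ordinal_tower:
  assumes wins: "\<exists>\<sigma>. winning_strategy_II (vtimes omega \<alpha>) I_bdd_cof_omega1 \<sigma>"
    and j: "admissible j" and M: "model_tower (vsucc j) M"
    and \<beta>: "\<beta> \<in> elts (vsucc j)" "\<not> limit_ordinal \<beta>" and \<zeta>: "\<zeta> \<in> elts omega2"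
  obtains \<eta> where "\<eta> \<in> elts omega2" "elts \<zeta> \<subseteq> elts \<eta>" "model_tower (vsucc j) (add_ordinal \<beta> M \<eta>)"
    "\<And>i. i \<in> elts (vsucc j) \<Longrightarrow> omega1_ext (M i) (add_ordinal \<beta> M \<eta> i)"
    "\<eta> \<in> elts (add_ordinal \<beta> M \<eta> \<beta>)"
proof -
  let ?J = "elts (vsucc j)"
  note idx = index_subset[OF j M] and mTV = tower_TV[OF j M] and mcnt = tower_countable[OF j M]
    and mmono = tower_mono[OF j M] and mH = tower_H[OF j M]
  have jO: "Ord j" and nl: "\<And>i. i \<in> ?J \<Longrightarrow> \<not> limit_ordinal i \<Longrightarrow> i \<in> elts \<alpha>"
    using j unfolding admissible_def by auto
  have zero: "vnat 0 \<in> elts (M i)" if "i \<in> ?J" for i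
    using TV_omega_subset[OF mTV[OF that]] vnat_omega by blast
  have zj: "vnat 0 \<in> ?J"
  proof -
    have "Ord (vnat 0 :: 'v)" using Ord_in_Ord[OF Ord_omega vnat_omega] .
    then show ?thesis using Ord_subset_iff[of "vnat 0" j] jO unfolding elts_vsucc by auto
  qed
  obtain T0 where "T0 \<in> H" "coded_strategy T0" using coded_strategy_exists wins by blast
  \<comment> \<open>One code in the least model serves all of them, because the models
    increase.\<close>
  then have "\<exists>T\<in>elts (M (vnat 0)). coded_strategy T"
    using TV_ex[OF mTV[OF zj], of "\<lambda>T e. coded_strategy T" "[]"] definable_coded_strategy by auto
  then obtain T where T0: "T \<in> elts (M (vnat 0))" and T: "coded_strategy T" by blast
  have TM: "T \<in> elts (M i)" if i: "i \<in> ?J" for i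
  proof -
    have "vnat 0 \<in> elts i \<or> vnat 0 = i"
      using Ord_subset_iff[of "vnat 0" i] idx(3)[OF i] idx(3)[OF zj] by auto
    then show ?thesis using mmono[OF i] T0 by blast
  qed
  \<comment> \<open>Blocks beyond \<open>j\<close> have to be played as well; the empty partial
    function yields the constant move 0.\<close>
  define F where "F l = (if l \<in> ?J then set_of {f \<in> elts (M l). small_pfun f} else set_of {vnat 0})" for l
  have Fin: "elts (F l) = {f \<in> elts (M l). small_pfun f}" if "l \<in> ?J" for l
    unfolding F_def using that elts_set_of_subset[of _ "M l"] by auto
  have p0: "small_pfun (vnat 0 :: 'v)" unfolding small_pfun_def isfun_def by simp
  have legal: "legal (F l)" for l
  proof (cases "l \<in> ?J")
    case True
    have "countable {f \<in> elts (M l). small_pfun f}"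
      by (rule countable_subset[OF _ mcnt[OF True]]) blast
    then show ?thesis unfolding legal_def Fin[OF True] using p0 zero[OF True] by blast
  next
    case False
    then show ?thesis unfolding legal_def F_def using p0 elts_set_of_single[of "vnat 0 :: 'v"]
      by (simp del: vnat.simps)
  qed
  \<comment> \<open>For a successor \<open>i\<close> the lists of the earlier blocks are definable
    from \<open>vseq i M\<close>. At a limit the tower does not provide this sequence, so those
    models are treated through their unions.\<close>
  have vseqF: "vseq i F \<in> elts (M i)" if i: "i \<in> ?J" "\<not> limit_ordinal i" for i
  proof (cases rule: Ord_trichotomy[OF idx(3)[OF i(1)]])
    case 1
    then have "elts (vseq i F) = elts (vnat 0)" by (simp add: elts_vseq)
    then show ?thesis using zero[OF i(1)] extensionality by metis
  next
    case 2
    then show ?thesis using i by blast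
  next
    case (3 k)
    then have vM: "vseq i M \<in> elts (M i)" using M i unfolding model_tower_def successor_ordinal_def by blast
    have i\<alpha>: "i \<in> elts \<alpha>" using nl i by blast
    then have iM: "i \<in> elts (M i)" using TV_\<alpha>_subset[OF mTV[OF i(1)]] by blast
    let ?P = "\<lambda>p e. \<exists>l\<in>elts (e 0). \<exists>m\<in>H. \<exists>u\<in>H. p = vpair l u \<and> vpair l m \<in> elts (e (Suc 0)) \<and>
        (\<forall>f\<in>H. f \<in> elts u \<longleftrightarrow> f \<in> elts m \<and> small_pfun f)"
    show ?thesis
    proof (rule TV_set[OF mTV[OF i(1)], of "[i, vseq i M]" ?P])
      show "definable (\<lambda>e. ?P (e 0) (\<lambda>n. e (Suc (Suc n))))" by (intro definable)
      show "vseq i F \<in> H" using legal_H[OF legal] H_trans[OF \<alpha>_H i\<alpha>] by (intro H_vseq) auto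
      have u: "u = F l" if "l \<in> elts i" "u \<in> H" "\<forall>f\<in>H. f \<in> elts u \<longleftrightarrow> f \<in> elts (M l) \<and> small_pfun f" for u l
        using that eq_iff_H[OF that(2) legal_H[OF legal]] Fin idx(1)[OF i(1)] by blast
      show "p \<in> elts (vseq i F) \<longleftrightarrow> ?P p (penv (elts (M i)) [i, vseq i M])" for p
      proof
        assume "p \<in> elts (vseq i F)"
        then obtain l where l: "l \<in> elts i" "p = vpair l (F l)" unfolding elts_vseq by blast
        then have lj: "l \<in> ?J" using idx(1)[OF i(1)] by blast
        show "?P p (penv (elts (M i)) [i, vseq i M])"
          using l Fin[OF lj] mH[OF lj] legal_H[OF legal]
          by (auto intro!: bexI[of _ l] bexI[of _ "M l"] bexI[of _ "F l"])
      next
        assume "?P p (penv (elts (M i)) [i, vseq i M])"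
        then show "p \<in> elts (vseq i F)" using u by auto
      qed
    qed (use vM iM in auto)
  qed
  obtain \<eta> where \<eta>: "\<eta> \<in> elts omega2" "\<eta> \<notin> elts \<zeta>"
    and pres: "\<And>i f N y. i \<in> elts \<alpha> \<Longrightarrow> f \<in> elts (F i) \<Longrightarrow> TV N \<Longrightarrow> countable N \<Longrightarrow> elts (F i) \<subseteq> N \<Longrightarrow>
      T \<in> N \<Longrightarrow> vseq i F \<in> N \<Longrightarrow> vpair \<eta> y \<in> elts f \<Longrightarrow> y \<in> N"
    by (rule coded_strategy_apply[OF T legal \<zeta>]) (rule that; assumption)
  have \<zeta>\<eta>: "elts \<zeta> \<subseteq> elts \<eta>"
    using Ord_not_mem_iff[of \<eta> \<zeta>] \<eta> \<zeta> Ord_in_Ord[OF Ord_omega2] by blast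
  have hull_pres: "hull (elts (M i)) \<eta> \<inter> elts omega1 \<subseteq> elts (M i)"
    if i: "i \<in> ?J" "\<not> limit_ordinal i" for i
  proof (rule hull_omega1[OF mTV[OF i(1)] \<eta>(1)])
    fix f y assume "f \<in> elts (M i)" "small_pfun f" and y: "vpair \<eta> y \<in> elts f"
    then have "f \<in> elts (F i)" using Fin[OF i(1)] by blast
    then show "y \<in> elts (M i)"
      using pres[OF nl[OF i] _ mTV[OF i(1)] mcnt[OF i(1)] _ TM[OF i(1)] vseqF[OF i] y] Fin[OF i(1)] by blast
  qed
  have ext_hull: "extends (elts (M i)) (hull (elts (M i)) \<eta>)" "\<eta> \<in> hull (elts (M i)) \<eta>"
    if "i \<in> ?J" for i
    using extends_hull mem_hull mTV[OF that] TV_omega2 \<eta>(1) by blast+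
  have lim: "elts (M d) = (\<Union>i\<in>elts d. elts (M i))" if "d \<in> ?J" "limit_ordinal d" for d
    using M that unfolding model_tower_def by blast
  have hull_pres': "hull (elts (M i)) \<eta> \<inter> elts omega1 \<subseteq> elts (M i)" if i: "i \<in> ?J" for i
  proof (cases "limit_ordinal i")
    case True
    show ?thesis
    proof
      fix y assume "y \<in> hull (elts (M i)) \<eta> \<inter> elts omega1"
      then obtain k where k: "k \<in> elts i" "y \<in> hull (elts (M k)) \<eta>" "y \<in> elts omega1"
        unfolding lim[OF i True] hull_UN by blast
      \<comment> \<open>The index \<open>k\<close> may again be a limit; its successor is not, and
        still lies below \<open>i\<close>.\<close>
      have sk: "vsucc k \<in> elts i" using True k unfolding limit_ordinal_def by blast
      then have sj: "vsucc k \<in> ?J" using idx(1)[OF i] by blast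
      have "elts (M k) \<subseteq> elts (M (vsucc k))" using mmono[OF sj] elts_vsucc by blast
      then have "y \<in> hull (elts (M (vsucc k))) \<eta>" using hull_mono k by blast
      then have "y \<in> elts (M (vsucc k))" using hull_pres[OF sj not_limit_vsucc] k by blast
      then show "y \<in> elts (M i)" using mmono[OF i sk] by blast
    qed
  qed (use hull_pres i in blast)
  let ?M = "add_ordinal \<beta> M \<eta>"
  have Mlow: "?M i = M i" if "i \<in> elts \<beta>" for i using that unfolding add_ordinal_def by simp
  have Mhigh: "elts (?M i) = hull (elts (M i)) \<eta>" if "i \<in> ?J" "i \<notin> elts \<beta>" for i
    unfolding add_ordinal_def using that countable_set_exists[OF countable_hull[OF mcnt[OF that(1)]]] by simp
  have ext: "omega1_ext (M i) (?M i)" if i: "i \<in> ?J" for i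
  proof (cases "i \<in> elts \<beta>")
    case True
    then show ?thesis using Mlow omega1_ext_refl mTV[OF i] by simp
  next
    case False
    then show ?thesis unfolding omega1_ext_def Mhigh[OF i False]
      using ext_hull(1)[OF i] hull_pres'[OF i] extends_subset by blast
  qed
  have newTV: "TV (elts (?M i))" if i: "i \<in> ?J" for i
    using ext[OF i] TV_extends[OF mTV[OF i]] unfolding omega1_ext_def by blast
  have newcnt: "countable (elts (?M i))" if i: "i \<in> ?J" for i
    using Mlow Mhigh[OF i] mcnt[OF i] countable_hull by (cases "i \<in> elts \<beta>") auto
  have newH: "?M i \<in> H" if i: "i \<in> ?J" for i
    using H_iff TV_H newTV[OF i] newcnt[OF i] countable_lesspoll_\<Theta> by blast
  have \<beta>O: "Ord \<beta>" using idx(3)[OF \<beta>(1)] .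
  have newlim: "elts (?M d) = (\<Union>i\<in>elts d. elts (?M i))" if d: "d \<in> ?J" "limit_ordinal d" for d
  proof (cases "d \<in> elts \<beta>")
    case True
    then have "\<And>i. i \<in> elts d \<Longrightarrow> ?M i = M i" using Ord_subset[OF \<beta>O] Mlow by blast
    then show ?thesis using lim[OF d] Mlow[OF True] by simp
  next
    case False
    \<comment> \<open>As \<beta> is no limit, a limit \<open>d\<close> not below \<beta> lies
      strictly above it. The hulls of the unchanged models are then absorbed by the new model of
      index \<beta>.\<close>
    have \<beta>d: "\<beta> \<in> elts d" using Ord_linear[OF \<beta>O idx(3)[OF d(1)]] False d \<beta>(2) by blast
    have dj: "i \<in> ?J" if "i \<in> elts d" for i using idx(1)[OF d(1)] that by blast
    have eq: "elts (?M d) = (\<Union>i\<in>elts d. hull (elts (M i)) \<eta>)"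
      unfolding Mhigh[OF d(1) False] lim[OF d] hull_UN by blast
    show ?thesis unfolding eq
    proof (intro equalityI UN_least)
      fix i assume i: "i \<in> elts d"
      show "hull (elts (M i)) \<eta> \<subseteq> (\<Union>i\<in>elts d. elts (?M i))"
      proof (cases "i \<in> elts \<beta>")
        case True
        then have "hull (elts (M i)) \<eta> \<subseteq> elts (?M \<beta>)"
          using hull_mono[OF mmono[OF \<beta>(1)]] Mhigh[OF \<beta>(1) mem_irrefl] by simp
        then show ?thesis using \<beta>d by blast
      qed (use Mhigh[OF dj[OF i]] i in blast)
      show "elts (?M i) \<subseteq> (\<Union>i\<in>elts d. hull (elts (M i)) \<eta>)"
        using Mlow Mhigh[OF dj[OF i]] extends_subset[OF ext_hull(1)[OF dj[OF i]]] i
        by (cases "i \<in> elts \<beta>") auto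
    qed
  qed
  have newsucc: "vseq i ?M \<in> elts (?M i)" if i: "i \<in> ?J" "successor_ordinal i" for i
  proof (cases "i \<in> elts \<beta>")
    case True
    then have "vseq i ?M = vseq i M" using Ord_subset[OF \<beta>O] Mlow by (intro vseq_cong) blast
    then show ?thesis using Mlow[OF True] M i unfolding model_tower_def by simp
  next
    case False
    let ?N = "elts (?M i)"
    have MN: "elts (M i) \<subseteq> ?N" using ext[OF i(1)] extends_subset unfolding omega1_ext_def by blast
    have vM: "vseq i M \<in> ?N" using M i MN unfolding model_tower_def by blast
    have "\<not> limit_ordinal i" using i(2) not_limit_vsucc unfolding successor_ordinal_def by blast
    then have i\<alpha>: "i \<in> elts \<alpha>" using nl i by blast
    have \<beta>\<alpha>: "\<beta> \<in> elts \<alpha>" using nl \<beta> by blast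
    have iN: "i \<in> ?N" "\<beta> \<in> ?N" using TV_\<alpha>_subset[OF newTV[OF i(1)]] i\<alpha> \<beta>\<alpha> by auto
    have \<eta>N: "\<eta> \<in> ?N" unfolding Mhigh[OF i(1) False] by (rule ext_hull(2)[OF i(1)])
    have ij: "l \<in> ?J" if "l \<in> elts i" for l using idx(1)[OF i(1)] that by blast
    \<comment> \<open>The new sequence is definable from \<open>i\<close>, the old sequence, \<beta>
      and \<eta>. All four belong to the new \<open>i\<close>-th model, \<eta> because
      \<open>i\<close> is not below \<beta>.\<close>
    let ?P = "\<lambda>p e. \<exists>l\<in>elts (e 0). \<exists>m\<in>H. \<exists>u\<in>H. p = vpair l u \<and> vpair l m \<in> elts (e (Suc 0)) \<and>
        ((l \<in> elts (e (Suc (Suc 0))) \<and> u = m) \<or>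
         (\<not> l \<in> elts (e (Suc (Suc 0))) \<and> (\<forall>y\<in>H. y \<in> elts u \<longleftrightarrow>
            (\<exists>f\<in>elts m. isfun f \<and> vpair (e (Suc (Suc (Suc 0)))) y \<in> elts f))))"
    show ?thesis
    proof (rule TV_set[OF newTV[OF i(1)], of "[i, vseq i M, \<beta>, \<eta>]" ?P])
      show "definable (\<lambda>e. ?P (e 0) (\<lambda>n. e (Suc (Suc n))))" by (intro definable)
      show "vseq i ?M \<in> H" using newH[OF ij] H_trans[OF \<alpha>_H i\<alpha>] by (intro H_vseq) auto
      define C where "C l u \<longleftrightarrow> (l \<in> elts \<beta> \<and> u = M l) \<or> (\<not> l \<in> elts \<beta> \<and> (\<forall>y\<in>H. y \<in> elts u \<longleftrightarrow>
            (\<exists>f\<in>elts (M l). isfun f \<and> vpair \<eta> y \<in> elts f)))" for l u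
      have C: "C l u \<longleftrightarrow> u = ?M l" if l: "l \<in> elts i" and uH: "u \<in> H" for l u
      proof (cases "l \<in> elts \<beta>")
        case True
        then show ?thesis using Mlow unfolding C_def by auto
      next
        case False
        have "u = ?M l \<longleftrightarrow> (\<forall>y\<in>H. y \<in> elts u \<longleftrightarrow> y \<in> hull (elts (M l)) \<eta>)"
          using eq_iff_H[OF uH newH[OF ij[OF l]]] Mhigh[OF ij[OF l] False] by simp
        then show ?thesis using False unfolding hull_def C_def by auto
      qed
      show "p \<in> elts (vseq i ?M) \<longleftrightarrow> ?P p (penv ?N [i, vseq i M, \<beta>, \<eta>])" for p
      proof -
        have "p \<in> elts (vseq i ?M) \<longleftrightarrow> (\<exists>l\<in>elts i. \<exists>u\<in>H. p = vpair l u \<and> u = ?M l)"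
          unfolding elts_vseq using newH[OF ij] by auto
        also have "\<dots> \<longleftrightarrow> (\<exists>l\<in>elts i. \<exists>m\<in>H. \<exists>u\<in>H. p = vpair l u \<and> m = M l \<and> C l u)"
        proof (rule bex_cong[OF refl])
          fix l assume "l \<in> elts i"
          then show "(\<exists>u\<in>H. p = vpair l u \<and> u = ?M l) \<longleftrightarrow> (\<exists>m\<in>H. \<exists>u\<in>H. p = vpair l u \<and> m = M l \<and> C l u)"
            using C[of l] mH[OF ij] by auto
        qed
        also have "\<dots> \<longleftrightarrow> ?P p (penv ?N [i, vseq i M, \<beta>, \<eta>])"
          unfolding C_def by (intro bex_cong refl) auto
        finally show ?thesis .
      qed
    qed (use vM iN \<eta>N in auto)
  qed
  have "model_tower (vsucc j) ?M" unfolding model_tower_def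
    by (intro conjI ballI impI newTV newcnt newlim newsucc)
  moreover have "\<eta> \<in> elts (?M \<beta>)" unfolding Mhigh[OF \<beta>(1) mem_irrefl] by (rule ext_hull(2)[OF \<beta>(1)])
  ultimately show ?thesis using that[OF \<eta>(1) \<zeta>\<eta> _ ext] by simp
qed

end

section \<open>Improving a tower\<close>

text \<open>Along an enumeration of \<open>j\<close>, the index is raised just past the next member
  whenever it does not exceed it yet. The values are \<beta> or successors, so none is a
  limit.\<close>

lemma exhausting_ladder:
  fixes j \<beta> :: "'v::set_universe"
  assumes j: "Ord j" "countable (elts j)" and \<beta>: "\<beta> \<in> elts (vsucc j)" "\<not> limit_ordinal \<beta>"
  obtains lam where "lam 0 = \<beta>" "\<And>n::nat. lam n \<in> elts (vsucc j)" "\<And>n. \<not> limit_ordinal (lam n)"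
    "\<And>n. lam (Suc n) = lam n \<or> (\<exists>k\<in>elts j. lam (Suc n) = vsucc k \<and> lam n \<in> elts (vsucc k))"
    "\<And>i. i \<in> elts j \<Longrightarrow> \<exists>n. i \<in> elts (lam n)"
proof (cases "elts j = {}")
  case True
  then show ?thesis using that[of "\<lambda>_. \<beta>"] \<beta> by auto
next
  case False
  define x where "x = from_nat_into (elts j)"
  have x: "range x = elts j" unfolding x_def using range_from_nat_into[OF False j(2)] .
  define lam where "lam = rec_nat \<beta> (\<lambda>n l. if l \<in> elts (vsucc (x n)) then vsucc (x n) else l)"
  have lam: "lam 0 = \<beta>" "lam (Suc n) = (if lam n \<in> elts (vsucc (x n)) then vsucc (x n) else lam n)" for n
    unfolding lam_def by auto
  have xj: "x n \<in> elts j" for n using x by blast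
  have in_j: "lam n \<in> elts (vsucc j)" for n
    by (induction n) (use lam \<beta> vsucc_mem_vsucc[OF j(1) xj] in auto)
  have nl: "\<not> limit_ordinal (lam n)" for n
    by (induction n) (use lam \<beta> not_limit_vsucc in auto)
  have "x n \<in> elts (lam (Suc n))" for n
  proof (cases "lam n \<in> elts (vsucc (x n))")
    case True
    then show ?thesis using lam elts_vsucc by auto
  next
    case False
    have "Ord (vsucc (x n))" "Ord (lam n)"
      using Ord_vsucc Ord_in_Ord[OF j(1) xj] Ord_in_Ord[OF Ord_vsucc[OF j(1)] in_j] by auto
    then have "elts (vsucc (x n)) \<subseteq> elts (lam n)" using False Ord_not_mem_iff by blast
    then show ?thesis using False lam elts_vsucc by auto
  qed
  then have "\<exists>n. i \<in> elts (lam n)" if "i \<in> elts j" for i using that x by (metis rangeE)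
  moreover have "lam (Suc n) = lam n \<or> (\<exists>k\<in>elts j. lam (Suc n) = vsucc k \<and> lam n \<in> elts (vsucc k))" for n
    using lam(2)[of n] xj by auto
  ultimately show ?thesis using that lam(1) in_j nl by blast
qed

context algebra begin

text \<open>A formula sees finitely many parameters, and these lie in one \<open>N i\<close>. The
  environment is changed beyond them to one that lies entirely in \<open>N i\<close>.\<close>

lemma TV_directed_Union:
  assumes ne: "I \<noteq> {}" and TV: "\<And>i. i \<in> I \<Longrightarrow> TV (N i)"
    and dir: "\<And>i k. i \<in> I \<Longrightarrow> k \<in> I \<Longrightarrow> \<exists>l\<in>I. N i \<subseteq> N l \<and> N k \<subseteq> N l"
  shows "TV (\<Union>i\<in>I. N i)"
proof -
  have NH: "N i \<subseteq> H" if "i \<in> I" for i using TV_H TV that by blast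
  have "\<exists>x\<in>(\<Union>i\<in>I. N i). P (case_nat x e)"
    if P: "definable P" and e: "range e \<subseteq> (\<Union>i\<in>I. N i)" and ex: "\<exists>x\<in>H. P (case_nat x e)" for P e
  proof -
    obtain \<phi> where \<phi>: "\<And>e. range e \<subseteq> H \<Longrightarrow> satisfies A e \<phi> \<longleftrightarrow> P e" using P unfolding definable_def by blast
    obtain K where K: "\<forall>e e'. (\<forall>n<K. e n = e' n) \<longrightarrow> satisfies A e \<phi> = satisfies A e' \<phi>"
      using satisfies_finite_support ..
    have "\<exists>i\<in>I. \<forall>n<K. e n \<in> N i"
    proof (induction K)
      case 0
      then show ?case using ne by blast
    next
      case (Suc K)
      then obtain i where i: "i \<in> I" "\<forall>n<K. e n \<in> N i" by blast
      obtain k where k: "k \<in> I" "e K \<in> N k" using e by blast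
      obtain l where "l \<in> I" "N i \<subseteq> N l" "N k \<subseteq> N l" using dir i k by blast
      then show ?case using i k by (intro bexI[of _ l]) (auto simp: less_Suc_eq)
    qed
    then obtain i where i: "i \<in> I" "\<forall>n<K. e n \<in> N i" by blast
    obtain z where z: "z \<in> N i" using TV[OF i(1)] unfolding TV_def by blast
    define e' where "e' n = (if n < K then e n else z)" for n
    have e': "range e' \<subseteq> N i" unfolding e'_def using i z by auto
    have eq: "P (case_nat x e) = P (case_nat x e')" if x: "x \<in> H" for x
    proof -
      have "range e \<subseteq> H" "range e' \<subseteq> H" using e e' NH i(1) by blast+
      then have "range (case_nat x e) \<subseteq> H" "range (case_nat x e') \<subseteq> H"
        using x by (auto simp: image_subset_iff split: nat.splits)
      moreover have "\<forall>n<K. case_nat x e n = case_nat x e' n" unfolding e'_def by (auto split: nat.splits)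
      ultimately show ?thesis using K \<phi> by metis
    qed
    then have "\<exists>x\<in>H. P (case_nat x e')" using ex by blast
    then obtain x where "x \<in> N i" "P (case_nat x e')" using TV[OF i(1)] P e' unfolding TV_def by blast
    then show ?thesis using eq NH i(1) by blast
  qed
  moreover have "(\<Union>i\<in>I. N i) \<noteq> {}"
  proof -
    obtain i where i: "i \<in> I" using ne by blast
    then have "N i \<noteq> {}" using TV[OF i] unfolding TV_def by simp
    then show ?thesis using i by blast
  qed
  ultimately show ?thesis unfolding TV_def using NH by blast
qed

lemma TV_countable_H: "TV (elts m) \<Longrightarrow> countable (elts m) \<Longrightarrow> m \<in> H"
  using H_iff[of m] countable_lesspoll_\<Theta> unfolding TV_def by simp

lemma model_tower_subset:
  assumes M: "model_tower \<gamma> M" and sub: "elts \<gamma>' \<subseteq> elts \<gamma>"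
  shows "model_tower \<gamma>' M"
  unfolding model_tower_def
proof (intro conjI ballI impI)
  fix i assume "i \<in> elts \<gamma>'"
  then have i: "i \<in> elts \<gamma>" using sub by blast
  show "countable (elts (M i))" "TV (elts (M i))" using M i unfolding model_tower_def by auto
  show "elts (M i) = (\<Union>k\<in>elts i. elts (M k))" if "limit_ordinal i"
    using M i that unfolding model_tower_def by auto
  show "vseq i M \<in> elts (M i)" if "successor_ordinal i"
    using M i that unfolding model_tower_def by auto
qed

section \<open>Improvements and their reflection into a model\<close>

definition sup_in_S :: "'v \<Rightarrow> bool" where
  "sup_in_S m \<longleftrightarrow> vsup (elts m \<inter> elts omega2) \<in> elts S"

definition improves :: "'v \<Rightarrow> 'v \<Rightarrow> ('v \<Rightarrow> 'v) \<Rightarrow> ('v \<Rightarrow> 'v) \<Rightarrow> bool" where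
  "improves \<gamma> \<beta> M M' \<longleftrightarrow> model_tower \<gamma> M' \<and>
     (\<forall>i\<in>elts \<gamma>. omega1_ext (M i) (M' i) \<and> sup_in_S (M' i) \<and> (i \<in> elts \<beta> \<longrightarrow> M' i = M i))"

lemma definable_sup_in_S [definable]: "definable (\<lambda>e. sup_in_S (e i))"
  unfolding sup_in_S_def by (intro definable)

lemma definable_omega1_ext [definable]: "definable (\<lambda>e. omega1_ext (e i) (e j))"
proof (rule definable_cong)
  show "definable (\<lambda>e. extends (elts (e i)) (elts (e j)) \<and> (\<forall>x\<in>elts omega1. x \<in> elts (e i) \<longleftrightarrow> x \<in> elts (e j)))"
    by (intro definable)
qed (auto simp: omega1_ext_def)

text \<open>The first-order form of \<open>improves\<close> for towers given as sets of pairs: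
  elementarity of the new models is left to \<open>omega1_ext\<close>, which contains
  \<open>extends\<close>. The first two clauses make \<open>x'\<close> a sequence with no entries
  outside \<gamma>.\<close>

definition coded_improvement :: "'v \<Rightarrow> 'v \<Rightarrow> 'v \<Rightarrow> 'v \<Rightarrow> bool" where
  "coded_improvement \<gamma> \<beta> x x' \<longleftrightarrow> isfun x' \<and> (\<forall>p\<in>elts x'. \<exists>i\<in>elts \<gamma>. \<exists>m\<in>H. p = vpair i m) \<and>
     (\<forall>i\<in>elts \<gamma>. \<exists>m\<in>H. \<exists>m'\<in>H. vpair i m \<in> elts x \<and> vpair i m' \<in> elts x' \<and>
        countable (elts m') \<and> omega1_ext m m' \<and> sup_in_S m' \<and> (i \<in> elts \<beta> \<longrightarrow> m' = m) \<and>
        (limit_ordinal i \<longrightarrow> (\<forall>y\<in>H. y \<in> elts m' \<longleftrightarrow> (\<exists>l\<in>elts i. \<exists>n\<in>H. vpair l n \<in> elts x' \<and> y \<in> elts n))) \<and>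
        (successor_ordinal i \<longrightarrow> (\<exists>r\<in>elts m'. r = seq_restrict x' i)))"

text \<open>The sequence of \<open>M2\<close> is a witness in \<open>H\<close> for a definable
  property with parameters in \<open>M (vsucc k)\<close>, so this model contains a witness too. That
  its terms are elementary submodels follows from \<open>TV_extends\<close>.\<close>

lemma internalize:
  assumes j: "admissible j" and M: "model_tower (vsucc j) M" and k: "k \<in> elts j"
    and \<beta>: "\<beta> \<in> elts (vsucc k)" and imp: "improves (vsucc k) \<beta> M M2"
  obtains M3 where "improves (vsucc k) \<beta> M M3" "vseq (vsucc k) M3 \<in> elts (M (vsucc k))"
proof -
  note idx = index_subset[OF j M] and mTV = tower_TV[OF j M] and mH = tower_H[OF j M]
  let ?g = "vsucc k" and ?N = "elts (M (vsucc k))"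
  have jO: "Ord j" using j unfolding admissible_def by blast
  have g: "?g \<in> elts (vsucc j)" using vsucc_mem_vsucc[OF jO k] .
  have g\<alpha>: "?g \<in> elts \<alpha>" using j g not_limit_vsucc unfolding admissible_def by blast
  have sg: "successor_ordinal ?g" unfolding successor_ordinal_def using Ord_in_Ord[OF jO k] by blast
  note N = mTV[OF g]
  have gN: "?g \<in> ?N" using TV_\<alpha>_subset[OF N] g\<alpha> by blast
  have \<beta>N: "\<beta> \<in> ?N" using TV_\<alpha>_subset[OF N] Ord_subset[OF Ord_\<alpha> g\<alpha>] \<beta> by blast
  have vM: "vseq ?g M \<in> ?N" using M g sg unfolding model_tower_def by blast
  have ij: "i \<in> elts (vsucc j)" if "i \<in> elts ?g" for i using idx(1)[OF g] that by blast
  have O: "Ord ?g" using idx(3)[OF g] .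
  have t2: "model_tower ?g M2" using imp unfolding improves_def by blast
  have H2: "M2 i \<in> H" if "i \<in> elts ?g" for i
    using t2 that TV_countable_H unfolding model_tower_def by simp
  let ?Q = "\<lambda>x e. coded_improvement (e 0) (e (Suc (Suc 0))) (e (Suc 0)) x"
  have "\<exists>x\<in>?N. ?Q x (penv ?N [?g, vseq ?g M, \<beta>])"
  proof (rule TV_ex[OF N, of ?Q _ "vseq ?g M2"])
    show "definable (\<lambda>e. ?Q (e 0) (\<lambda>n. e (Suc n)))" 
      unfolding coded_improvement_def by (intro definable)
    show "vseq ?g M2 \<in> H" using H2 TV_H[OF N gN] by (intro H_vseq) auto
    have "\<forall>p\<in>elts (vseq ?g M2). \<exists>i\<in>elts ?g. \<exists>m\<in>H. p = vpair i m" unfolding elts_vseq using H2 by auto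
    moreover have "\<exists>m\<in>H. \<exists>m'\<in>H. vpair i m \<in> elts (vseq ?g M) \<and> vpair i m' \<in> elts (vseq ?g M2) \<and>
        countable (elts m') \<and> omega1_ext m m' \<and> sup_in_S m' \<and>
        (i \<in> elts \<beta> \<longrightarrow> m' = m) \<and>
        (limit_ordinal i \<longrightarrow> (\<forall>y\<in>H. y \<in> elts m' \<longleftrightarrow> (\<exists>l\<in>elts i. \<exists>n\<in>H. vpair l n \<in> elts (vseq ?g M2) \<and> y \<in> elts n))) \<and>
        (successor_ordinal i \<longrightarrow> (\<exists>r\<in>elts m'. r = seq_restrict (vseq ?g M2) i))"
      if i: "i \<in> elts ?g" for i
    proof (rule bexI[of _ "M i"], rule bexI[of _ "M2 i"], intro conjI impI)
      have ig: "elts i \<subseteq> elts ?g" using Ord_subset[OF O i] .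
      show "\<forall>y\<in>H. y \<in> elts (M2 i) \<longleftrightarrow> (\<exists>l\<in>elts i. \<exists>n\<in>H. vpair l n \<in> elts (vseq ?g M2) \<and> y \<in> elts n)"
        if "limit_ordinal i"
      proof -
        have "elts (M2 i) = (\<Union>l\<in>elts i. elts (M2 l))" using t2 i that unfolding model_tower_def by blast
        then show ?thesis using ig H2 by auto
      qed
      show "\<exists>r\<in>elts (M2 i). r = seq_restrict (vseq ?g M2) i" if "successor_ordinal i"
        unfolding seq_restrict_vseq[OF ig] using t2 i that unfolding model_tower_def by blast
    qed (use i imp t2 mH[OF ij] H2 in \<open>auto simp: improves_def model_tower_def\<close>)
    ultimately show "?Q (vseq ?g M2) (penv ?N [?g, vseq ?g M, \<beta>])"
      unfolding coded_improvement_def using isfun_vseq by simp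
  qed (use gN vM \<beta>N in auto)
  then obtain x where xN: "x \<in> ?N" and xQ: "coded_improvement ?g \<beta> (vseq ?g M) x" by auto
  note Q = xQ[unfolded coded_improvement_def, THEN conjunct2, THEN conjunct2]
    and x = xN xQ[unfolded coded_improvement_def, THEN conjunct1]
      xQ[unfolded coded_improvement_def, THEN conjunct2, THEN conjunct1]
  have "\<forall>i\<in>elts ?g. \<exists>m'. m' \<in> H \<and> vpair i m' \<in> elts x" using Q by blast
  then obtain M3 where M3: "\<And>i. i \<in> elts ?g \<Longrightarrow> M3 i \<in> H \<and> vpair i (M3 i) \<in> elts x" by metis
  have uniq: "vpair i m \<in> elts x \<longleftrightarrow> i \<in> elts ?g \<and> m = M3 i" for i m
    using M3 x(2,3) unfolding isfun_def by (metis vpair_inject)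
  have xeq: "x = vseq ?g M3"
  proof (rule extensionality, rule set_eqI)
    fix p
    show "p \<in> elts x \<longleftrightarrow> p \<in> elts (vseq ?g M3)"
    proof
      assume p: "p \<in> elts x"
      then obtain i m where "p = vpair i m" using x(3) by blast
      then show "p \<in> elts (vseq ?g M3)" using p uniq by simp
    next
      assume "p \<in> elts (vseq ?g M3)"
      then show "p \<in> elts x" unfolding elts_vseq using M3 by blast
    qed
  qed
  have Q3: "countable (elts (M3 i)) \<and> omega1_ext (M i) (M3 i) \<and> sup_in_S (M3 i) \<and>
        (i \<in> elts \<beta> \<longrightarrow> M3 i = M i) \<and>
        (limit_ordinal i \<longrightarrow> (\<forall>y\<in>H. y \<in> elts (M3 i) \<longleftrightarrow> (\<exists>l\<in>elts i. \<exists>n\<in>H. vpair l n \<in> elts x \<and> y \<in> elts n))) \<and>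
        (successor_ordinal i \<longrightarrow> seq_restrict x i \<in> elts (M3 i))" if i: "i \<in> elts ?g" for i
    using Q[rule_format, OF i] unfolding uniq by auto
  have TV3: "TV (elts (M3 i))" if i: "i \<in> elts ?g" for i
    using Q3[OF i] TV_extends[OF mTV[OF ij[OF i]]] unfolding omega1_ext_def by blast
  have "model_tower ?g M3" unfolding model_tower_def
  proof (intro conjI ballI impI)
    fix d assume d: "d \<in> elts ?g" "limit_ordinal d"
    have dg: "elts d \<subseteq> elts ?g" using Ord_subset[OF O d(1)] .
    have "y \<in> elts (M3 d) \<longleftrightarrow> (\<exists>l\<in>elts d. y \<in> elts (M3 l))" if "y \<in> H" for y
      using Q3[OF d(1)] d(2) that dg M3 unfolding uniq by auto
    then show "elts (M3 d) = (\<Union>i\<in>elts d. elts (M3 i))" 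
      using H_trans[OF conjunct1[OF M3]] dg d(1) by (intro set_eqI) (metis (no_types, lifting) UN_iff subsetD)
  next
    fix i assume i: "i \<in> elts ?g" "successor_ordinal i"
    then show "vseq i M3 \<in> elts (M3 i)"
      using Q3[OF i(1)] seq_restrict_vseq[OF Ord_subset[OF O i(1)]] unfolding xeq by simp
  qed (use Q3 TV3 in auto)
  then have "improves ?g \<beta> M M3" unfolding improves_def using Q3 by blast
  then show ?thesis using that x(1) xeq by blast
qed

text \<open>The sequence of \<open>M3\<close> is a member of \<open>M (vsucc k)\<close>, so its
  terms are countable members and hence subsets of this model. From there on no model has to change:
  unions stay the same, and the new sequences are definable from the old ones and that of
  \<open>M3\<close>.\<close>

lemma splice:
  assumes j: "admissible j" and M: "model_tower (vsucc j) M" and k: "k \<in> elts j"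
    and M3: "model_tower (vsucc k) M3" "vseq (vsucc k) M3 \<in> elts (M (vsucc k))"
    and sub: "\<And>i. i \<in> elts (vsucc k) \<Longrightarrow> elts (M i) \<subseteq> elts (M3 i)"
  shows "model_tower (vsucc j) (\<lambda>i. if i \<in> elts (vsucc k) then M3 i else M i)" (is "model_tower _ ?M")
proof -
  let ?J = "elts (vsucc j)"
  note idx = index_subset[OF j M] and mTV = tower_TV[OF j M] and mH = tower_H[OF j M]
    and mmono = tower_mono[OF j M]
  let ?g = "vsucc k"
  have jO: "Ord j" using j unfolding admissible_def by blast
  have g: "?g \<in> ?J" using vsucc_mem_vsucc[OF jO k] .
  have g\<alpha>: "?g \<in> elts \<alpha>" using j g not_limit_vsucc unfolding admissible_def by blast
  have O: "Ord ?g" using idx(3)[OF g] .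
  have gN: "elts ?g \<subseteq> elts (M ?g)" using TV_\<alpha>_subset[OF mTV[OF g]] Ord_subset[OF Ord_\<alpha> g\<alpha>] by blast
  have M3g: "elts (M3 i) \<subseteq> elts (M ?g)" "M3 i \<in> H" if i: "i \<in> elts ?g" for i
  proof -
    have "M3 i \<in> elts (M ?g)"
      using TV_apply[OF mTV[OF g] M3(2) isfun_vseq, of i "M3 i"] i gN by auto
    then show "elts (M3 i) \<subseteq> elts (M ?g)" "M3 i \<in> H"
      using TV_countable_subset[OF mTV[OF g]] M3(1) i TV_H[OF mTV[OF g]] unfolding model_tower_def by auto
  qed
  show ?thesis unfolding model_tower_def
  proof (intro conjI ballI impI)
    show "countable (elts (?M i))" "TV (elts (?M i))" if "i \<in> ?J" for i
      using M M3(1) that unfolding model_tower_def by auto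
  next
    fix d assume d: "d \<in> ?J" "limit_ordinal d"
    show "elts (?M d) = (\<Union>i\<in>elts d. elts (?M i))"
    proof (cases "d \<in> elts ?g")
      case True
      then have "elts (M3 d) = (\<Union>i\<in>elts d. elts (M3 i))" using M3(1) d(2) unfolding model_tower_def by blast
      moreover have "(\<Union>i\<in>elts d. elts (?M i)) = (\<Union>i\<in>elts d. elts (M3 i))"
        using Ord_subset[OF O True] by (intro SUP_cong refl) auto
      ultimately show ?thesis using True by simp
    next
      case False
      have "d \<noteq> ?g" using d(2) not_limit_vsucc by blast
      then have gd: "?g \<in> elts d" using Ord_linear[OF O idx(3)[OF d(1)]] False by blast
      have Md: "elts (M d) = (\<Union>i\<in>elts d. elts (M i))" using M d unfolding model_tower_def by blast
      have "elts (M d) = (\<Union>i\<in>elts d. elts (?M i))"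
      proof
        show "elts (M d) \<subseteq> (\<Union>i\<in>elts d. elts (?M i))"
        proof
          fix x assume "x \<in> elts (M d)"
          then obtain i where i: "i \<in> elts d" "x \<in> elts (M i)" unfolding Md by blast
          then have "x \<in> elts (?M i)" using sub[of i] by auto
          then show "x \<in> (\<Union>i\<in>elts d. elts (?M i))" using i(1) by blast
        qed
        show "(\<Union>i\<in>elts d. elts (?M i)) \<subseteq> elts (M d)"
        proof
          fix x assume "x \<in> (\<Union>i\<in>elts d. elts (?M i))"
          then obtain i where i: "i \<in> elts d" "x \<in> elts (?M i)" by blast
          then show "x \<in> elts (M d)"
            using M3g(1)[of i] mmono[OF d(1) gd] mmono[OF d(1) i(1)] by (cases "i \<in> elts ?g") auto
        qed
      qed
      then show ?thesis using False by simp
    qed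
  next
    fix i assume i: "i \<in> ?J" "successor_ordinal i"
    show "vseq i ?M \<in> elts (?M i)"
    proof (cases "i \<in> elts ?g")
      case True
      then have "vseq i ?M = vseq i M3" using Ord_subset[OF O True] by (intro vseq_cong) auto
      then show ?thesis using M3(1) i True unfolding model_tower_def by simp
    next
      case False
      then have gi: "?g = i \<or> ?g \<in> elts i" using Ord_linear[OF O idx(3)[OF i(1)]] by blast
      then have "elts (M ?g) \<subseteq> elts (M i)" using mmono[OF i(1)] by blast
      then have N: "vseq ?g M3 \<in> elts (M i)" "vseq i M \<in> elts (M i)"
        using M3(2) M i unfolding model_tower_def by auto
      have "\<not> limit_ordinal i" using i(2) not_limit_vsucc unfolding successor_ordinal_def by blast
      then have i\<alpha>: "i \<in> elts \<alpha>" using j i unfolding admissible_def by blast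
      have giN: "?g \<in> elts (M i)" using TV_\<alpha>_subset[OF mTV[OF i(1)]] g\<alpha> by blast
      have ig: "elts ?g \<subseteq> elts i" using gi Ord_subset[OF idx(3)[OF i(1)]] by blast
      let ?P = "\<lambda>p e. p \<in> elts (e 0) \<or> (p \<in> elts (e (Suc 0)) \<and> (\<forall>l\<in>elts (e (Suc (Suc 0))). \<forall>m\<in>H. \<not> p = vpair l m))"
      have "vseq i ?M \<in> elts (M i)"
      proof (rule TV_set[OF mTV[OF i(1)], of "[vseq ?g M3, vseq i M, ?g]" ?P])
        show "definable (\<lambda>e. ?P (e 0) (\<lambda>n. e (Suc (Suc n))))" by (intro definable)
        have "?M l \<in> H" if "l \<in> elts i" for l
          using M3g(2) mH idx(1)[OF i(1)] that by auto
        then show "vseq i ?M \<in> H" using H_trans[OF \<alpha>_H i\<alpha>] by (intro H_vseq) auto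
        fix p
        have Hl: "M l \<in> H" if "l \<in> elts ?g" for l using mH idx(1)[OF g] that by blast
        show "p \<in> elts (vseq i ?M) \<longleftrightarrow> ?P p (penv (elts (M i)) [vseq ?g M3, vseq i M, ?g])"
        proof (cases "\<exists>l m. p = vpair l m")
          case True
          then obtain l m where p: "p = vpair l m" by blast
          show ?thesis unfolding p using ig Hl by (cases "l \<in> elts ?g") auto
        next
          case False
          then show ?thesis unfolding penv_simps elts_vseq by blast
        qed
      qed (use N giN in auto)
      then show ?thesis using False by simp
    qed
  qed
qed

text \<open>The base \<beta> is there for the induction: in a later stage the hypothesis is applied
  to a shorter tower of which an initial segment is already final and must not be touched.\<close>

lemma tower_improvement:
  assumes wins: "\<exists>\<sigma>. winning_strategy_II (vtimes omega \<alpha>) I_bdd_cof_omega1 \<sigma>"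
    and S: "elts S \<subseteq> E_omega2 omega" "stationary omega2 (elts S)"
    and "admissible j" "model_tower (vsucc j) M" "\<beta> \<in> elts (vsucc j)" "\<not> limit_ordinal \<beta>"
    and "\<And>i. i \<in> elts \<beta> \<Longrightarrow> sup_in_S (M i)"
  shows "\<exists>M'. improves (vsucc j) \<beta> M M'"
  using assms(4-)
proof (induction j arbitrary: M \<beta> rule: wf_induct_rule[OF foundation])
  case (1 j)
  note IH = 1(1) and j = 1(2) and M0 = 1(3) and \<beta> = 1(4,5) and good = 1(6)
  let ?J = "elts (vsucc j)"
  have jO: "Ord j" using j unfolding admissible_def by blast
  have jj: "j \<in> ?J" by (simp add: elts_vsucc)
  have "countable (elts j)"
    using admissible_subset[OF j] \<alpha>_countable countable_subset unfolding elts_omega1 by blast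
  then obtain lam where lam: "lam 0 = \<beta>" "\<And>n::nat. lam n \<in> ?J" "\<And>n. \<not> limit_ordinal (lam n)"
    "\<And>n. lam (Suc n) = lam n \<or> (\<exists>k\<in>elts j. lam (Suc n) = vsucc k \<and> lam n \<in> elts (vsucc k))"
    "\<And>i. i \<in> elts j \<Longrightarrow> \<exists>n. i \<in> elts (lam n)"
    using exhausting_ladder[OF jO _ \<beta>] by metis
  have idx: "elts i \<subseteq> ?J" if "i \<in> ?J" for i
    using Ord_subset[OF Ord_vsucc[OF jO] that] .
  define Inv where "Inv n M \<longleftrightarrow> model_tower (vsucc j) M \<and> (\<forall>i\<in>elts (lam n). sup_in_S (M i))" for n M
  \<comment> \<open>The new ordinal above \<zeta> is demanded only of the last model, whose supremum
    is to become \<delta>. The models below it receive theirs from the induction hypothesis.\<close>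
  define Rel where "Rel n M \<zeta> M' \<longleftrightarrow> (\<forall>i\<in>?J. omega1_ext (M i) (M' i)) \<and>
      (\<forall>i\<in>elts (lam n). M' i = M i) \<and> (\<exists>\<eta>\<in>elts (M' j). \<eta> \<in> elts omega2 \<and> elts \<zeta> \<subseteq> elts \<eta>)"
    for n and M M' :: "'v \<Rightarrow> 'v" and \<zeta>
  have step: "\<exists>M'. Inv (Suc n) M' \<and> Rel n M \<zeta> M'" if inv: "Inv n M" and \<zeta>: "\<zeta> \<in> elts omega2" for n M \<zeta>
  proof -
    have M: "model_tower (vsucc j) M" and gd: "\<And>i. i \<in> elts (lam n) \<Longrightarrow> sup_in_S (M i)"
      using inv unfolding Inv_def by auto
    obtain \<eta> where \<eta>: "\<eta> \<in> elts omega2" "elts \<zeta> \<subseteq> elts \<eta>"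
      and M1: "model_tower (vsucc j) (add_ordinal (lam n) M \<eta>)"
      and ext: "\<And>i. i \<in> ?J \<Longrightarrow> omega1_ext (M i) (add_ordinal (lam n) M \<eta> i)"
      and \<eta>M: "\<eta> \<in> elts (add_ordinal (lam n) M \<eta> (lam n))"
      using add_ordinal_tower[OF wins j M lam(2,3) \<zeta>] by metis
    define M1 where "M1 = add_ordinal (lam n) M \<eta>"
    note M1 = M1[folded M1_def] and ext = ext[folded M1_def] and \<eta>M = \<eta>M[folded M1_def]
    have low: "M1 i = M i" if "i \<in> elts (lam n)" for i unfolding M1_def add_ordinal_def using that by simp
    have \<eta>j: "\<eta> \<in> elts (M1 j)"
    proof (cases "lam n = j")
      case False
      then have "lam n \<in> elts j" using lam(2)[of n] unfolding elts_vsucc by blast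
      then show ?thesis using tower_mono[OF j M1 jj] \<eta>M by blast
    qed (use \<eta>M in simp)
    consider "lam (Suc n) = lam n" | k where "k \<in> elts j" "lam (Suc n) = vsucc k" "lam n \<in> elts (vsucc k)"
      using lam(4) by blast
    then show ?thesis
    proof cases
      case 1
      then have "Inv (Suc n) M1" unfolding Inv_def using M1 low gd by simp
      moreover have "Rel n M \<zeta> M1" unfolding Rel_def using ext low \<eta>j \<eta> by blast
      ultimately show ?thesis by blast
    next
      case (2 k)
      let ?g = "vsucc k"
      have g: "?g \<in> ?J" using vsucc_mem_vsucc[OF jO 2(1)] .
      have gj: "elts ?g \<subseteq> ?J" using idx[OF g] .
      have "model_tower ?g M1" using model_tower_subset[OF M1 gj] .
      \<comment> \<open>The base is now \<open>lam n\<close>: adding \<eta> has left the models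
        below it unchanged, so their suprema are still in \<open>S\<close>.\<close>
      then obtain M2 where "improves ?g (lam n) M1 M2"
        using IH[of k M1 "lam n"] 2 admissible_mem[OF j] lam(3) low gd by auto
      then obtain M3 where M3: "improves ?g (lam n) M1 M3" "vseq ?g M3 \<in> elts (M1 ?g)"
        using internalize[OF j M1 2(1,3)] by metis
      have t3: "model_tower ?g M3" using M3(1) unfolding improves_def by blast
      have e3: "omega1_ext (M1 i) (M3 i) \<and> sup_in_S (M3 i) \<and> (i \<in> elts (lam n) \<longrightarrow> M3 i = M1 i)"
        if "i \<in> elts ?g" for i using M3(1) that unfolding improves_def by blast
      define M4 where "M4 = (\<lambda>i. if i \<in> elts ?g then M3 i else M1 i)"
      have M4: "model_tower (vsucc j) M4" unfolding M4_def
        using e3 extends_subset unfolding omega1_ext_def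
        by (intro splice[OF j M1 2(1) t3 M3(2)]) blast
      then have "Inv (Suc n) M4" unfolding Inv_def using e3 by (simp add: 2(2) M4_def)
      moreover have "Rel n M \<zeta> M4" unfolding Rel_def
      proof (intro conjI ballI)
        fix i assume i: "i \<in> ?J"
        then show "omega1_ext (M i) (M4 i)"
          using ext[OF i] e3 omega1_ext_trans[OF tower_TV[OF j M i]] unfolding M4_def by auto
      next
        fix i assume i: "i \<in> elts (lam n)"
        then have "i \<in> elts ?g" using Ord_subset[OF Ord_in_Ord[OF Ord_vsucc[OF jO] g] 2(3)] by blast
        then show "M4 i = M i" using e3 low i unfolding M4_def by simp
      next
        have "j \<notin> elts ?g" using 2(1) mem_asym mem_irrefl unfolding elts_vsucc by blast
        then show "\<exists>\<eta>\<in>elts (M4 j). \<eta> \<in> elts omega2 \<and> elts \<zeta> \<subseteq> elts \<eta>"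
          unfolding M4_def using \<eta>j \<eta> by auto
      qed
      ultimately show ?thesis by blast
    qed
  qed
  \<comment> \<open>Any bound of the countable trace of the last model on omega_2 will do; closure
    of \<delta> under these bounds keeps every stage below \<delta>.\<close>
  define bd where "bd M = (SOME b. b \<in> elts omega2 \<and> elts (M j) \<inter> elts omega2 \<subseteq> elts b)" for M :: "'v \<Rightarrow> 'v"
  have bd: "bd M \<in> elts omega2 \<and> elts (M j) \<inter> elts omega2 \<subseteq> elts (bd M)" if "Inv n M" for n M
  proof -
    have "countable (elts (M j) \<inter> elts omega2)"
      using that jj unfolding Inv_def model_tower_def by (auto intro: countable_subset[of _ "elts (M j)"])
    then have "elts (M j) \<inter> elts omega2 \<lesssim> elts (omega1 :: 'v)"
      using uncountable_lepoll uncountable_omega1 by blast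
    then obtain b where "b \<in> elts omega2" "\<And>x. x \<in> elts (M j) \<inter> elts omega2 \<Longrightarrow> x \<in> elts b"
      using omega2_bounded[of "elts (M j) \<inter> elts omega2"] by blast
    then show ?thesis unfolding bd_def
      using someI_ex[of "\<lambda>b. b \<in> elts omega2 \<and> elts (M j) \<inter> elts omega2 \<subseteq> elts b"] by blast
  qed
  have "Inv 0 M" unfolding Inv_def using M0 good lam(1) by simp
  then obtain \<delta> \<zeta> s where \<delta>: "\<delta> \<in> elts S" "s 0 = M" and sInv: "\<And>n. Inv n (s n)"
    and sRel: "\<And>n. Rel n (s n) (\<zeta> n) (s (Suc n))"
    and sbd: "\<And>n. bd (s n) \<in> elts \<delta>" and cof: "\<And>x. x \<in> elts \<delta> \<Longrightarrow> \<exists>n. elts x \<subseteq> elts (\<zeta> n)"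
    using stationary_process[OF S(2,1), of Inv M Rel bd] step bd by metis
  have st: "model_tower (vsucc j) (s n)" for n using sInv unfolding Inv_def by blast
  have s1: "omega1_ext (s n i) (s (Suc n) i)" if "i \<in> ?J" for n i
    using sRel that unfolding Rel_def by blast
  have ext: "omega1_ext (M i) (s n i)" if i: "i \<in> ?J" for n i
  proof (induction n)
    case 0
    then show ?case using omega1_ext_refl tower_TV[OF j M0 i] \<delta>(2) by simp
  next
    case (Suc n)
    then show ?case using omega1_ext_trans[OF tower_TV[OF j M0 i]] s1[OF i] by blast
  qed
  have mono: "elts (s n i) \<subseteq> elts (s (Suc n) i)" if "i \<in> ?J" for n i
    using s1[OF that] extends_subset unfolding omega1_ext_def by blast
  define M' where "M' i = set_of (\<Union>n. elts (s n i))" for i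
  have M': "elts (M' i) = (\<Union>n. elts (s n i))" and cM': "countable (elts (M' i))" if i: "i \<in> ?J" for i
  proof -
    have "countable (\<Union>n. elts (s n i))" using st i unfolding model_tower_def by blast
    then show "elts (M' i) = (\<Union>n. elts (s n i))" "countable (elts (M' i))"
      unfolding M'_def using countable_set_exists[of "\<Union>n. elts (s n i)"] by auto
  qed
  have ext': "omega1_ext (M i) (M' i)" if i: "i \<in> ?J" for i
  proof -
    have "extends (elts (M i)) (\<Union>n. elts (s n i))"
      using ext[OF i] mono[OF i] by (intro extends_Union_chain) (auto simp: omega1_ext_def)
    then show ?thesis unfolding omega1_ext_def M'[OF i] using ext[OF i] unfolding omega1_ext_def by blast
  qed
  have TV': "TV (elts (M' i))" if i: "i \<in> ?J" for i
    using TV_extends[OF tower_TV[OF j M0 i]] ext'[OF i] unfolding omega1_ext_def by blast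
  have lam_mono: "elts (lam n) \<subseteq> elts (lam m)" if "n \<le> m" for n m
  proof -
    have "elts (lam n) \<subseteq> elts (lam (Suc n))" for n
      using lam(4)[of n] Ord_subset[OF Ord_in_Ord[OF Ord_vsucc[OF jO] lam(2)], of "lam n" "Suc n"] by auto
    then show ?thesis using lift_Suc_mono_le[of "\<lambda>n. elts (lam n)"] that by blast
  qed
  have stable: "s m i = s n i" if "n \<le> m" "i \<in> elts (lam n)" for n m i
    using that(1)
  proof (induction m rule: dec_induct)
    case (step m)
    then have "i \<in> elts (lam m)" using lam_mono that(2) by blast
    then show ?case using sRel[of m] step.IH unfolding Rel_def by simp
  qed simp
  have lam_sub: "i \<in> ?J" if "i \<in> elts (lam n)" for i n using idx[OF lam(2)] that by blast
  have M's: "M' i = s n i" if i: "i \<in> elts (lam n)" for i n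
  proof (rule extensionality)
    have "elts (s m i) \<subseteq> elts (s n i)" for m
    proof (cases "n \<le> m")
      case True
      then show ?thesis using stable[OF True i] by simp
    next
      case False
      then have "m \<le> n" by simp
      then show ?thesis using lift_Suc_mono_le[of "\<lambda>n. elts (s n i)"] mono[OF lam_sub[OF i]] by blast
    qed
    then show "elts (M' i) = elts (s n i)" unfolding M'[OF lam_sub[OF i]] by blast
  qed
  have "model_tower (vsucc j) M'" unfolding model_tower_def
  proof (intro conjI ballI impI)
    fix d assume d: "d \<in> ?J" "limit_ordinal d"
    have "elts (s n d) = (\<Union>i\<in>elts d. elts (s n i))" for n using st d unfolding model_tower_def by blast
    then have "elts (M' d) = (\<Union>i\<in>elts d. \<Union>n. elts (s n i))" unfolding M'[OF d(1)] by auto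
    also have "\<dots> = (\<Union>i\<in>elts d. elts (M' i))" using M' idx[OF d(1)] by (intro SUP_cong) auto
    finally show "elts (M' d) = (\<Union>i\<in>elts d. elts (M' i))" .
  next
    fix i assume i: "i \<in> ?J" "successor_ordinal i"
    then obtain k where k: "k \<in> elts i" "Ord k" "i = vsucc k" unfolding successor_ordinal_iff by blast
    then have "k \<in> elts j" using i(1) Ord_subset[OF jO] unfolding elts_vsucc by blast
    then obtain n where n: "k \<in> elts (lam n)" using lam(5) by blast
    have lO: "Ord (lam n)" using Ord_in_Ord[OF Ord_vsucc[OF jO] lam(2)] .
    \<comment> \<open>All models below the successor \<open>i\<close> are final from stage
      \<open>n\<close> on. Hence their sequence is the one which the tower \<open>s n\<close>
      already has in its \<open>i\<close>-th model.\<close>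
    have "elts i \<subseteq> elts (lam n)" unfolding k(3) elts_vsucc using n Ord_subset[OF lO n] by blast
    then have "vseq i M' = vseq i (s n)" using M's by (intro vseq_cong) blast
    moreover have "vseq i (s n) \<in> elts (s n i)" using st i unfolding model_tower_def by blast
    ultimately show "vseq i M' \<in> elts (M' i)" unfolding M'[OF i(1)] by auto
  qed (use cM' TV' in auto)
  moreover have "sup_in_S (M' i)" if i: "i \<in> ?J" for i
  proof (cases "i = j")
    case False
    then obtain n where n: "i \<in> elts (lam n)" using lam(5) i unfolding elts_vsucc by blast
    then show ?thesis using sInv[of n] M's[OF n] unfolding Inv_def by simp
  next
    case True
    have \<delta>2: "\<delta> \<in> elts omega2" using \<delta>(1) S(1) unfolding E_omega2_def by blast
    then have \<delta>O: "Ord \<delta>" using Ord_in_Ord[OF Ord_omega2] by blast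
    have "vsup (elts (M' j) \<inter> elts omega2) = \<delta>"
    proof (rule extensionality, unfold vsup_omega2, intro equalityI subsetI)
      fix x assume "x \<in> (\<Union>b\<in>elts (M' j) \<inter> elts omega2. elts b)"
      then obtain b n where b: "b \<in> elts (s n j)" "b \<in> elts omega2" "x \<in> elts b" unfolding M'[OF jj] by blast
      then have "b \<in> elts (bd (s n))" using bd[OF sInv] by blast
      then have "b \<in> elts \<delta>" using Ord_subset[OF \<delta>O sbd] by blast
      then show "x \<in> elts \<delta>" using Ord_subset[OF \<delta>O] b(3) by blast
    next
      fix x assume x: "x \<in> elts \<delta>"
      then obtain n where n: "elts x \<subseteq> elts (\<zeta> n)" using cof by blast
      obtain \<eta> where \<eta>: "\<eta> \<in> elts (s (Suc n) j)" "\<eta> \<in> elts omega2" "elts (\<zeta> n) \<subseteq> elts \<eta>"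
        using sRel[of n] unfolding Rel_def by blast
      have "Ord x" "Ord \<eta>" using Ord_in_Ord[OF \<delta>O x] Ord_in_Ord[OF Ord_omega2 \<eta>(2)] by auto
      \<comment> \<open>The cofinal sequence only gives \<eta> at least \<open>x\<close>, so the
        strict bound is the successor of \<eta>, which the model contains as well.\<close>
      then have "x \<in> elts (vsucc \<eta>)" unfolding elts_vsucc using Ord_subset_iff n \<eta>(3) by blast
      moreover have "\<eta> \<in> elts (M' j)" unfolding M'[OF jj] using \<eta>(1) by blast
      then have "vsucc \<eta> \<in> elts (M' j)" using TV_vsucc[OF TV'[OF jj]] by blast
      moreover have "vsucc \<eta> \<in> elts omega2" using limit_omega2 \<eta>(2) unfolding limit_ordinal_def by blast
      ultimately show "x \<in> (\<Union>b\<in>elts (M' j) \<inter> elts omega2. elts b)" by blast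
    qed
    then show ?thesis unfolding sup_in_S_def True using \<delta>(1) by simp
  qed
  moreover have "M' i = M i" if "i \<in> elts \<beta>" for i using M's[of i 0] that lam(1) \<delta>(2) by simp
  ultimately show ?case unfolding improves_def using ext' by blast
qed

end

theorem theorem7p9:
  fixes S \<alpha> \<Theta> :: "'v::set_universe"
    and W :: "'v rel"
    and A :: "('f::countable, 'r::countable, 'v) model"
    and M :: "'v \<Rightarrow> 'v"
  assumes "\<alpha> \<in> elts omega1"
    and "\<exists>\<sigma>. winning_strategy_II (vtimes omega \<alpha>) I_bdd_cof_omega1 \<sigma>"
    and "elts S \<subseteq> E_omega2 omega"
    and "stationary omega2 (elts S)"
    and "regular_cardinal \<Theta>"
    and "Pow (elts omega2) \<prec> elts \<Theta>"
    and "well_order_on (hereditary \<Theta>) W"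
    and "algebra_extending A \<Theta> S \<alpha> W"
    and "tower A \<alpha> M"
  shows "\<exists>M'. tower A \<alpha> M' \<and>
           (\<forall>i\<in>elts \<alpha>. elts (M i) \<subseteq> elts (M' i) \<and>
              elts (M i) \<inter> elts omega1 = elts (M' i) \<inter> elts omega1 \<and>
              vsup (elts (M' i) \<inter> elts omega2) \<in> elts S)"
proof -
  \<comment> \<open>The omega_2 of the hypothesis may come from another universe; it is at least as
    large as the one here.\<close>
  have "Pow (elts (omega2 :: 'v)) \<prec> elts \<Theta>"
    by (rule lesspoll_trans1[OF Pow_lepoll_mono[OF omega2_lepoll_omega2] assms(6)])
  then interpret algebra A \<Theta> S \<alpha>
    using assms(1,5,8) by unfold_locales (auto simp: algebra_extending_def)
  have M: "model_tower \<alpha> M" using assms(9) unfolding tower_iff .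
  \<comment> \<open>With base 0 nothing has to be kept and the condition on earlier suprema is
    vacuous.\<close>
  have improve: "\<exists>M'. improves (vsucc j) (vnat 0) N M'" if "admissible j" "model_tower (vsucc j) N" for j N
  proof (rule tower_improvement[OF assms(2,3,4) that])
    have "Ord (vnat 0 :: 'v)" by (rule Ord_in_Ord[OF Ord_omega vnat_omega])
    moreover have "Ord j" using that(1) unfolding admissible_def by blast
    ultimately show "vnat 0 \<in> elts (vsucc j)" using Ord_subset_iff[of "vnat 0" j] unfolding elts_vsucc by auto
    show "\<not> limit_ordinal (vnat 0 :: 'v)" unfolding limit_ordinal_def by simp
  qed simp
  have finish: ?thesis if "\<alpha> = \<gamma> \<or> \<alpha> \<in> elts \<gamma>" "Ord \<gamma>" "improves \<gamma> \<beta> N M'" "\<And>i. i \<in> elts \<alpha> \<Longrightarrow> N i = M i" for \<gamma> \<beta> N M'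
  proof -
    have sub: "elts \<alpha> \<subseteq> elts \<gamma>" using that(1) Ord_subset[OF that(2)] by blast
    then have "model_tower \<alpha> M'" using that(3) model_tower_subset unfolding improves_def by blast
    moreover have "omega1_ext (M i) (M' i) \<and> sup_in_S (M' i)" if i: "i \<in> elts \<alpha>" for i
    proof -
      have "omega1_ext (N i) (M' i) \<and> sup_in_S (M' i)"
        using \<open>improves \<gamma> \<beta> N M'\<close> sub i unfolding improves_def by blast
      then show ?thesis using \<open>i \<in> elts \<alpha> \<Longrightarrow> N i = M i\<close>[OF i] by simp
    qed
    ultimately show ?thesis unfolding tower_iff omega1_ext_def sup_in_S_def using extends_subset by blast
  qed
  show ?thesis
  proof (cases rule: Ord_trichotomy[OF Ord_\<alpha>])
    case 1
    then show ?thesis using assms(9) by auto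
  next
    case 2
    \<comment> \<open>A tower of limit length has no last model to run the induction on. The union
      of all models is appended at index \<alpha>, the tower of length \<alpha> + 1 is improved, and
      the result is cut back to \<alpha>.\<close>
    have adm: "admissible \<alpha>" unfolding admissible_def elts_vsucc using Ord_\<alpha> 2 by blast
    have ne: "elts \<alpha> \<noteq> {}" using 2 unfolding limit_ordinal_def by blast
    let ?U = "\<Union>i\<in>elts \<alpha>. elts (M i)"
    have "countable (elts \<alpha>)" using \<alpha>_countable elts_omega1 by blast
    then have cU: "countable ?U" by (rule countable_UN) (use M in \<open>simp add: model_tower_def\<close>)
    have U: "elts (set_of ?U) = ?U" using countable_set_exists[OF cU] .
    define N where "N = M(\<alpha> := set_of ?U)"
    have NM: "N i = M i" if "i \<in> elts \<alpha>" for i unfolding N_def using that mem_irrefl by auto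
    have N\<alpha>: "elts (N \<alpha>) = ?U" unfolding N_def using U by simp
    have mono: "elts (M k) \<subseteq> elts (M i)" if i: "i \<in> elts \<alpha>" "k \<in> elts i" for i k
    proof -
      have ai: "admissible i" using admissible_mem[OF adm i(1)] .
      have "vsucc i \<in> elts \<alpha>" using 2 i(1) unfolding limit_ordinal_def by blast
      then have "model_tower (vsucc i) M" using model_tower_subset[OF M Ord_subset[OF Ord_\<alpha>]] by blast
      then show ?thesis using tower_mono[OF ai _ _ i(2)] elts_vsucc[of i] by blast
    qed
    have "TV ?U"
    proof (rule TV_directed_Union[OF ne])
      fix i k assume ik: "i \<in> elts \<alpha>" "k \<in> elts \<alpha>"
      then have "i \<in> elts k \<or> i = k \<or> k \<in> elts i" using Ord_linear Ord_in_Ord[OF Ord_\<alpha>] by blast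
      then show "\<exists>l\<in>elts \<alpha>. elts (M i) \<subseteq> elts (M l) \<and> elts (M k) \<subseteq> elts (M l)" using mono ik by blast
    qed (use M in \<open>auto simp: model_tower_def\<close>)
    have "model_tower (vsucc \<alpha>) N" unfolding model_tower_def
    proof (intro conjI ballI impI)
      show "countable (elts (N i))" "TV (elts (N i))" if "i \<in> elts (vsucc \<alpha>)" for i
        using that M NM N\<alpha> cU \<open>TV ?U\<close> unfolding model_tower_def elts_vsucc by auto
    next
      fix d assume d: "d \<in> elts (vsucc \<alpha>)" "limit_ordinal d"
      show "elts (N d) = (\<Union>i\<in>elts d. elts (N i))"
      proof (cases "d = \<alpha>")
        case False
        then have d\<alpha>: "d \<in> elts \<alpha>" using d unfolding elts_vsucc by blast
        then have "elts (M d) = (\<Union>i\<in>elts d. elts (M i))" using M d(2) unfolding model_tower_def by blast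
        moreover have "(\<Union>i\<in>elts d. elts (N i)) = (\<Union>i\<in>elts d. elts (M i))"
          using NM Ord_subset[OF Ord_\<alpha> d\<alpha>] by (intro SUP_cong refl) auto
        ultimately show ?thesis using NM d\<alpha> by simp
      qed (use N\<alpha> NM in simp)
    next
      fix i assume i: "i \<in> elts (vsucc \<alpha>)" "successor_ordinal i"
      have "i \<noteq> \<alpha>" using i(2) 2 not_limit_vsucc unfolding successor_ordinal_def by blast
      then have i\<alpha>: "i \<in> elts \<alpha>" using i unfolding elts_vsucc by blast
      have "vseq i N = vseq i M" using NM Ord_subset[OF Ord_\<alpha> i\<alpha>] by (intro vseq_cong) blast
      then show "vseq i N \<in> elts (N i)" using M i(2) i\<alpha> NM unfolding model_tower_def by auto
    qed
    then obtain M' where "improves (vsucc \<alpha>) (vnat 0) N M'" using improve adm by blast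
    then show ?thesis using finish[of "vsucc \<alpha>"] elts_vsucc[of \<alpha>] Ord_vsucc[OF Ord_\<alpha>] NM by blast
  next
    case (3 k)
    have "admissible k" unfolding admissible_def using 3 by blast
    then obtain M' where "improves \<alpha> (vnat 0) M M'" using improve[of k M] M 3(3) by blast
    then show ?thesis using finish[of \<alpha>] Ord_\<alpha> by blast
  qed
qed

end
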